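(* Suppose that $\mathcal{K}$ is a function defined on $\{x\in\mathbb{R}^3: x_1x_2x_3\neq 0\}$ which satisfies, with a constant $C$ and exponents $0<\theta_1\le1$, $0<\theta_2<1$, the conditions (R), (C1.a), (C1.b), (C1.c), (C1.d) stated in the context. For $\epsilon=(\epsilon_1,\epsilon_2,\epsilon_3)$, $N=(N_1,N_2,N_3)$ with $0<\epsilon_i\le N_i<\infty$, let $\mathcal{K}_\epsilon^N(x_1,x_2,x_3)=\mathcal{K}(x_1,x_2,x_3)$ if $\epsilon_i\le|x_i|\le N_i$ for $i=1,2,3$, and $\mathcal{K}_\epsilon^N(x_1,x_2,x_3)=0$ otherwise. Suppose in addition that the three integrals $$\int_{|x_3|\le1}\int_{|x_2|\le1}\int_{|x_1|\le1}\mathcal{K}_\epsilon^N(x_1,x_2,x_3)\,dx_1dx_2dx_3,$$ $$\int_{|x_3|\le1}\int_{|x_2|\le1}\mathcal{K}_\epsilon^N(x_1,x_2,x_3)\,dx_2dx_3,\qquad \int_{|x_3|\le1}\int_{|x_1|\le1}\mathcal{K}_\epsilon^N(x_1,x_2,x_3)\,dx_1dx_3$$ converge almost everywhere (the second as a function of $x_1$, the third as a function of $x_2$) as $\epsilon_1,\epsilon_2,\epsilon_3\to0$ and $N_1,N_2,N_3\to\infty$. Then for $f\in L^2(\mathbb{R}^3)$ the limit $$\lim_{\epsilon_1,\epsilon_2,\epsilon_3\to0,\; N_1,N_2,N_3\to\infty}\mathcal{K}_\epsilon^N*f=:\mathcal{K}*f$$ exists in the $L^2(\mathbb{R}^3)$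 norm. Moreover, $\|\mathcal{K}*f\|_{L^2(\mathbb{R}^3)}\le A\|f\|_{L^2(\mathbb{R}^3)}$ with the constant $A$ depending only on the constant $C$ (the exponents $\theta_1,\theta_2$ being fixed).
   Context: Fix $0<\theta_1\le1$, $0<\theta_2<1$ and a constant $C$. For $\alpha,\beta,\gamma\in\{0,1\}$ and $h_1,h_2,h_3\in\mathbb{R}$ define $\Delta^\alpha_{x_1,h_1}\mathcal{K}(x_1,x_2,x_3)=\alpha\mathcal{K}(x_1+h_1,x_2,x_3)-\mathcal{K}(x_1,x_2,x_3)$, $\Delta^\beta_{x_2,h_2}\mathcal{K}(x_1,x_2,x_3)=\beta\mathcal{K}(x_1,x_2+h_2,x_3)-\mathcal{K}(x_1,x_2,x_3)$, $\Delta^\gamma_{x_3,h_3}\mathcal{K}(x_1,x_2,x_3)=\gamma\mathcal{K}(x_1,x_2,x_3+h_3)-\mathcal{K}(x_1,x_2,x_3)$. (R): $$|\Delta^\alpha_{x_1,h_1}\Delta^\beta_{x_2,h_2}\Delta^\gamma_{x_3,h_3}\mathcal{K}(x_1,x_2,x_3)|\le \frac{C|h_1|^{\alpha\theta_1}|h_2|^{\beta\theta_1}|h_3|^{\gamma\theta_1}}{|x_1|^{\alpha\theta_1+1}|x_2|^{\beta\theta_1+1}|x_3|^{\gamma\theta_1+1}\big(|\frac{x_1x_2}{x_3}|+|\frac{x_3}{x_1x_2}|\big)^{\theta_2}}$$ for all $\alpha,\beta,\gamma\in\{0,1\}$ with ($0\le\alpha\le1$, $0\le\beta+\gamma\le1$)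 or ($0\le\alpha+\gamma\le1$, $0\le\beta\le1$), and all $|x_1|\ge2|h_1|>0$, $|x_2|\ge2|h_2|>0$, $|x_3|\ge2|h_3|>0$. (C1.a): $\Big|\int_{\delta_1\le|x_1|\le r_1}\int_{\delta_2\le|x_2|\le r_2}\int_{\delta_3\le|x_3|\le r_3}\mathcal{K}(x_1,x_2,x_3)\,dx_1dx_2dx_3\Big|\le C$ uniformly for all $\delta_1,\delta_2,\delta_3,r_1,r_2,r_3>0$. (C1.b): $\Big|\int_{\delta_1\le|x_1|\le r_1}\int_{\delta_2\le|x_2|\le r_2}\Delta^\gamma_{x_3,h_3}\mathcal{K}(x_1,x_2,x_3)\,dx_1dx_2\Big|\le \frac{C|h_3|^{\gamma\theta_1}}{|x_3|^{\gamma\theta_1+1}}$ uniformly for all $\delta_1,\delta_2,r_1,r_2>0$, $|x_3|\ge2|h_3|>0$, $\gamma\in\{0,1\}$. (C1.c): $\Big|\int_{\delta_2\le|x_2|\le r_2}\int_{\delta_3\le|x_3|\le r_3}\Delta^\alpha_{x_1,h_1}\mathcal{K}(x_1,x_2,x_3)\,dx_2dx_3\Big|\le \frac{C|h_1|^{\alpha\theta_1}}{|x_1|^{\alpha\theta_1+1}}$ uniformly for all $\delta_2,\delta_3,r_2,r_3>0$, $|x_1|\ge2|h_1|>0$, $\alpha\in\{0,1\}$. (C1.d): $\Big|\int_{\delta_1\le|x_1|\le r_1}\int_{\delta_3\le|x_3|\le r_3}\Delta^\beta_{x_2,h_2}\mathcal{K}(x_1,x_2,x_3)\,dx_3dx_1\Big|\le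 \frac{C|h_2|^{\beta\theta_1}}{|x_2|^{\beta\theta_1+1}}$ uniformly for all $\delta_1,\delta_3,r_1,r_3>0$, $|x_2|\ge2|h_2|>0$, $\beta\in\{0,1\}$. *)

theory Defs
  imports "HOL-Analysis.Analysis"
begin

text \<open>
  A kernel on \<open>{x. x\<^sub>1 x\<^sub>2 x\<^sub>3 \<noteq> 0}\<close> is represented by a total function on \<^typ>\<open>real \<times> real \<times> real\<close>.
  None of the conditions below, nor the truncated kernels, depend on its values on the
  coordinate planes.
\<close>

type_synonym R3 = "real \<times> real \<times> real"

text \<open>The parameter \<open>a\<close> is only used with \<open>a \<in> {0, 1}\<close>; for \<open>a = 0\<close> the operator is \<open>K \<mapsto> - K\<close>.\<close>

definition diff1 :: "nat \<Rightarrow> real \<Rightarrow> (R3 \<Rightarrow> complex) \<Rightarrow> R3 \<Rightarrow> complex" where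
  "diff1 a h K = (\<lambda>(x1, x2, x3). of_nat a * K (x1 + h, x2, x3) - K (x1, x2, x3))"

definition diff2 :: "nat \<Rightarrow> real \<Rightarrow> (R3 \<Rightarrow> complex) \<Rightarrow> R3 \<Rightarrow> complex" where
  "diff2 a h K = (\<lambda>(x1, x2, x3). of_nat a * K (x1, x2 + h, x3) - K (x1, x2, x3))"

definition diff3 :: "nat \<Rightarrow> real \<Rightarrow> (R3 \<Rightarrow> complex) \<Rightarrow> R3 \<Rightarrow> complex" where
  "diff3 a h K = (\<lambda>(x1, x2, x3). of_nat a * K (x1, x2, x3 + h) - K (x1, x2, x3))"

definition regularity :: "real \<Rightarrow> real \<Rightarrow> real \<Rightarrow> (R3 \<Rightarrow> complex) \<Rightarrow> bool" where
  "regularity \<theta>1 \<theta>2 C K \<longleftrightarrow>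
    (\<forall>\<alpha>\<in>{0, 1}. \<forall>\<beta>\<in>{0, 1}. \<forall>\<gamma>\<in>{0, 1}.
      (\<alpha> \<le> 1 \<and> \<beta> + \<gamma> \<le> 1 \<or> \<alpha> + \<gamma> \<le> 1 \<and> \<beta> \<le> 1) \<longrightarrow>
      (\<forall>x1 x2 x3 h1 h2 h3.
        \<bar>x1\<bar> \<ge> 2 * \<bar>h1\<bar> \<and> \<bar>h1\<bar> > 0 \<and> \<bar>x2\<bar> \<ge> 2 * \<bar>h2\<bar> \<and> \<bar>h2\<bar> > 0 \<and> \<bar>x3\<bar> \<ge> 2 * \<bar>h3\<bar> \<and> \<bar>h3\<bar> > 0 \<longrightarrow>
        norm (diff1 \<alpha> h1 (diff2 \<beta> h2 (diff3 \<gamma> h3 K)) (x1, x2, x3))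
          \<le> C * \<bar>h1\<bar> powr (real \<alpha> * \<theta>1) * \<bar>h2\<bar> powr (real \<beta> * \<theta>1) * \<bar>h3\<bar> powr (real \<gamma> * \<theta>1) /
            (\<bar>x1\<bar> powr (real \<alpha> * \<theta>1 + 1) * \<bar>x2\<bar> powr (real \<beta> * \<theta>1 + 1) *
             \<bar>x3\<bar> powr (real \<gamma> * \<theta>1 + 1) *
             (\<bar>x1 * x2 / x3\<bar> + \<bar>x3 / (x1 * x2)\<bar>) powr \<theta>2)))"

definition annulus :: "real \<Rightarrow> real \<Rightarrow> real set" where
  "annulus \<delta> r = {t. \<delta> \<le> \<bar>t\<bar> \<and> \<bar>t\<bar> \<le> r}"

text \<open>
  For a kernel satisfying \<open>regularity\<close> (hence continuous off the coordinate planes) all the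
  integrands below are bounded on the bounded domains of integration, so the multiple integrals
  converge absolutely and agree with the iterated ones in any order.
\<close>

definition cancellation_a :: "real \<Rightarrow> (R3 \<Rightarrow> complex) \<Rightarrow> bool" where
  "cancellation_a C K \<longleftrightarrow>
    (\<forall>\<delta>1>0. \<forall>\<delta>2>0. \<forall>\<delta>3>0. \<forall>r1>0. \<forall>r2>0. \<forall>r3>0.
      norm (LINT x:annulus \<delta>1 r1 \<times> annulus \<delta>2 r2 \<times> annulus \<delta>3 r3|lborel. K x) \<le> C)"

definition cancellation_b :: "real \<Rightarrow> real \<Rightarrow> (R3 \<Rightarrow> complex) \<Rightarrow> bool" where
  "cancellation_b \<theta>1 C K \<longleftrightarrow>
    (\<forall>\<delta>1>0. \<forall>\<delta>2>0. \<forall>r1>0. \<forall>r2>0. \<forall>\<gamma>\<in>{0, 1}. \<forall>x3 h3. \<bar>x3\<bar> \<ge> 2 * \<bar>h3\<bar> \<and> \<bar>h3\<bar> > 0 \<longrightarrow>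
      norm (LINT (x1, x2):annulus \<delta>1 r1 \<times> annulus \<delta>2 r2|lborel. diff3 \<gamma> h3 K (x1, x2, x3))
        \<le> C * \<bar>h3\<bar> powr (real \<gamma> * \<theta>1) / \<bar>x3\<bar> powr (real \<gamma> * \<theta>1 + 1))"

definition cancellation_c :: "real \<Rightarrow> real \<Rightarrow> (R3 \<Rightarrow> complex) \<Rightarrow> bool" where
  "cancellation_c \<theta>1 C K \<longleftrightarrow>
    (\<forall>\<delta>2>0. \<forall>\<delta>3>0. \<forall>r2>0. \<forall>r3>0. \<forall>\<alpha>\<in>{0, 1}. \<forall>x1 h1. \<bar>x1\<bar> \<ge> 2 * \<bar>h1\<bar> \<and> \<bar>h1\<bar> > 0 \<longrightarrow>
      norm (LINT (x2, x3):annulus \<delta>2 r2 \<times> annulus \<delta>3 r3|lborel. diff1 \<alpha> h1 K (x1, x2, x3))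
        \<le> C * \<bar>h1\<bar> powr (real \<alpha> * \<theta>1) / \<bar>x1\<bar> powr (real \<alpha> * \<theta>1 + 1))"

definition cancellation_d :: "real \<Rightarrow> real \<Rightarrow> (R3 \<Rightarrow> complex) \<Rightarrow> bool" where
  "cancellation_d \<theta>1 C K \<longleftrightarrow>
    (\<forall>\<delta>1>0. \<forall>\<delta>3>0. \<forall>r1>0. \<forall>r3>0. \<forall>\<beta>\<in>{0, 1}. \<forall>x2 h2. \<bar>x2\<bar> \<ge> 2 * \<bar>h2\<bar> \<and> \<bar>h2\<bar> > 0 \<longrightarrow>
      norm (LINT (x1, x3):annulus \<delta>1 r1 \<times> annulus \<delta>3 r3|lborel. diff2 \<beta> h2 K (x1, x2, x3))
        \<le> C * \<bar>h2\<bar> powr (real \<beta> * \<theta>1) / \<bar>x2\<bar> powr (real \<beta> * \<theta>1 + 1))"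

definition truncate :: "R3 \<Rightarrow> R3 \<Rightarrow> (R3 \<Rightarrow> complex) \<Rightarrow> R3 \<Rightarrow> complex" where
  "truncate = (\<lambda>(\<epsilon>1, \<epsilon>2, \<epsilon>3) (N1, N2, N3) K x.
     if x \<in> annulus \<epsilon>1 N1 \<times> annulus \<epsilon>2 N2 \<times> annulus \<epsilon>3 N3 then K x else 0)"

text \<open>
  The six truncation parameters tend to their limits jointly and independently;
  \<open>0 < \<epsilon>\<^sub>i \<le> N\<^sub>i\<close> holds eventually.
\<close>

definition trunc_limit :: "(R3 \<times> R3) filter" where
  "trunc_limit = (at_right 0 \<times>\<^sub>F at_right 0 \<times>\<^sub>F at_right 0) \<times>\<^sub>F (at_top \<times>\<^sub>F at_top \<times>\<^sub>F at_top)"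

definition truncated_integrals_converge :: "(R3 \<Rightarrow> complex) \<Rightarrow> bool" where
  "truncated_integrals_converge K \<longleftrightarrow>
    (\<exists>l. ((\<lambda>(\<epsilon>, N). LINT x:{-1..1} \<times> {-1..1} \<times> {-1..1}|lborel. truncate \<epsilon> N K x)
        \<longlongrightarrow> l) trunc_limit) \<and>
    (AE x1 in lborel. \<exists>l. ((\<lambda>(\<epsilon>, N). LINT (x2, x3):{-1..1} \<times> {-1..1}|lborel. truncate \<epsilon> N K (x1, x2, x3))
        \<longlongrightarrow> l) trunc_limit) \<and>
    (AE x2 in lborel. \<exists>l. ((\<lambda>(\<epsilon>, N). LINT (x1, x3):{-1..1} \<times> {-1..1}|lborel. truncate \<epsilon> N K (x1, x2, x3))
        \<longlongrightarrow> l) trunc_limit)"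

definition convolution :: "(R3 \<Rightarrow> complex) \<Rightarrow> (R3 \<Rightarrow> complex) \<Rightarrow> R3 \<Rightarrow> complex" where
  "convolution k f x = (LINT y|lborel. k (x - y) * f y)"

text \<open>Elements of \<open>L\<^sup>2\<close> are given by Borel representatives, which every class has.\<close>

definition in_L2 :: "(R3 \<Rightarrow> complex) \<Rightarrow> bool" where
  "in_L2 f \<longleftrightarrow> f \<in> borel_measurable lborel \<and> integrable lborel (\<lambda>x. (norm (f x))\<^sup>2)"

definition L2_norm :: "(R3 \<Rightarrow> complex) \<Rightarrow> real" where
  "L2_norm f = sqrt (LINT x|lborel. (norm (f x))\<^sup>2)"

text \<open>Membership is required explicitly because \<open>L2_norm\<close> is \<open>0\<close> when the integral diverges.\<close>

definition tendsto_L2 :: "('i \<Rightarrow> R3 \<Rightarrow> complex) \<Rightarrow> (R3 \<Rightarrow> complex) \<Rightarrow> 'i filter \<Rightarrow> bool" where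
  "tendsto_L2 u g F \<longleftrightarrow> (\<forall>\<^sub>F i in F. in_L2 (u i)) \<and> in_L2 g \<and>
     ((\<lambda>i. L2_norm (\<lambda>x. u i x - g x)) \<longlongrightarrow> 0) F"

end

theory Submission
  imports Defs "HOL-Probability.Characteristic_Functions"
begin

text \<open>
  Convolution with a truncated kernel acts on the Fourier side as multiplication by
  \<open>m(\<xi>) = \<integral> K\<^sub>\<epsilon>\<^sup>N(x) e\<^sup>-\<^sup>i\<^sup>x\<^sup>\<xi> dx\<close>. Both claims therefore follow from two facts about these multipliers: one constant
  bounds them for all truncations and almost all \<open>\<xi>\<close>, and they converge for almost every \<open>\<xi>\<close> along every
  sequence of truncations. Given these, \<open>convolution_sequence_converges\<close> provides the \<open>L\<^sup>2\<close> limit and its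
  norm. Instead of the full theorem of Plancherel it uses two inequalities, \<open>fourier_bounded_energy\<close>
  for integrable square integrable functions and \<open>energy_le_fourier\<close> for bounded continuous ones, which
  both come from inserting a Gaussian into \<open>\<integral> |f\<^sup>^|\<^sup>2\<close>.

  To estimate \<open>m\<close>, split the character in the \<open>i\<close>-th variable as \<open>w\<^sub>i = p\<^sub>i + q\<^sub>i\<close>, where \<open>p\<^sub>i\<close> is the
  indicator of \<open>|x\<^sub>i| \<le> r\<^sub>i\<close>. Integration against \<open>q\<^sub>i\<close> is harmless for any function of one variable that
  has size \<open>1/|x|\<close> and matching Hoelder smoothness: near the origin \<open>q\<^sub>i\<close> is \<open>O(|x|)\<close>, and far out a shift by
  half a period trades the function for its difference (\<open>osc_annulus_bound\<close>,
  \<open>osc_annulus_convergent\<close>). The identity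
  \<open>w\<^sub>1w\<^sub>2w\<^sub>3 = p\<^sub>1p\<^sub>2p\<^sub>3 + q\<^sub>1p\<^sub>2p\<^sub>3 + p\<^sub>1q\<^sub>2p\<^sub>3 + p\<^sub>1p\<^sub>2q\<^sub>3 + q\<^sub>1q\<^sub>2w\<^sub>3 + q\<^sub>1p\<^sub>2q\<^sub>3 + p\<^sub>1q\<^sub>2q\<^sub>3\<close>
  splits \<open>m\<close> into seven terms (\<open>multiplier_decomposition\<close>).
  The first is bounded by the first cancellation condition. In a term with one \<open>q\<close> the other two
  variables are integrated over boxes, and the remaining cancellation conditions say precisely that
  the result is a one-variable function of the required kind. In a term with two \<open>q\<close>'s the third variable is
  integrated absolutely: the factor \<open>(|x\<^sub>1x\<^sub>2/x\<^sub>3| + |x\<^sub>3/(x\<^sub>1x\<^sub>2)|)\<^sup>-\<^sup>\<theta>\<close> is integrable with respect to \<open>dx\<^sub>i/|x\<^sub>i|\<close>,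
  with a bound that does not depend on the other two variables (\<open>ratio_decay_integral\<close>).

  The radii \<open>r\<^sub>i\<close> are free. For the uniform bound \<open>multiplier_bound\<close> they are the periods \<open>2\<pi>/|\<xi>\<^sub>i|\<close>, which makes
  all constants independent of \<open>\<xi>\<close>. For \<open>multiplier_convergent\<close> they are \<open>1\<close>, the radius in the
  hypothesis on the truncated integrals; that hypothesis covers the terms with \<open>p\<^sub>1p\<^sub>2p\<^sub>3\<close>, \<open>q\<^sub>1p\<^sub>2p\<^sub>3\<close> and
  \<open>p\<^sub>1q\<^sub>2p\<^sub>3\<close>, and the inner integrals of the other terms converge absolutely.

  Finally, the limit in six parameters is a limit along a filter with a countable basis, so it
  can be tested on sequences.
\<close>

text \<open>Here \<open>convolution\<close> means that of functions, not of measures.\<close>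

hide_const (open) Convolution.convolution

section \<open>Energies and completeness of the square integrable functions\<close>

lemma Fatou_bounded_integrals:
  fixes f :: "nat \<Rightarrow> 'a \<Rightarrow> real"
  assumes int: "\<And>i. integrable M (f i)" and nonneg: "\<And>i x. 0 \<le> f i x"
    and meas: "g \<in> borel_measurable M" and lim: "AE x in M. (\<lambda>i. f i x) \<longlonglongrightarrow> g x"
    and bound: "\<And>i. (LINT x|M. f i x) \<le> c"
  shows "integrable M g" and "(LINT x|M. g x) \<le> c"
proof -
  have g0: "AE x in M. 0 \<le> g x"
    using lim by eventually_elim (rule LIMSEQ_le_const, auto simp: nonneg)
  have c0: "0 \<le> c"
    using bound[of 0] Bochner_Integration.integral_nonneg[of M "f 0"] nonneg by (meson order_trans)
  have "(\<integral>\<^sup>+x. ennreal (g x) \<partial>M) = (\<integral>\<^sup>+x. liminf (\<lambda>i. ennreal (f i x)) \<partial>M)"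
    using lim by (intro nn_integral_cong_AE, eventually_elim)
      (auto intro!: lim_imp_Liminf[symmetric] tendsto_ennrealI)
  also have "\<dots> \<le> liminf (\<lambda>i. \<integral>\<^sup>+x. ennreal (f i x) \<partial>M)"
    using int by (intro nn_integral_liminf) auto
  also have "\<dots> \<le> ennreal c"
    using bound nonneg int
    by (auto intro!: Liminf_le simp: nn_integral_eq_integral ennreal_leI)
  finally have le: "(\<integral>\<^sup>+x. ennreal (g x) \<partial>M) \<le> ennreal c" .
  show *: "integrable M g"
    using meas g0 le by (intro integrableI_nonneg) (auto simp: le_less_trans)
  have "ennreal (LINT x|M. g x) \<le> ennreal c"
    using le nn_integral_eq_integral[OF * g0] by simp
  thus "(LINT x|M. g x) \<le> c" using c0 by simp
qed

definition square_integrable :: "'a measure \<Rightarrow> ('a \<Rightarrow> complex) \<Rightarrow> bool" where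
  "square_integrable M f \<longleftrightarrow> f \<in> borel_measurable M \<and> integrable M (\<lambda>x. (norm (f x))\<^sup>2)"

text \<open>
  The square of the \<open>L\<^sup>2\<close> norm. It satisfies the triangle inequality only up to a constant, which is
  enough for limits; bounds with sharp constants come from Fatou's lemma.
\<close>

definition energy :: "'a measure \<Rightarrow> ('a \<Rightarrow> complex) \<Rightarrow> real" where
  "energy M f = (LINT x|M. (norm (f x))\<^sup>2)"

lemma energy_nonneg [simp]: "0 \<le> energy M f"
  by (simp add: energy_def)

lemma norm_add_sq_le:
  fixes a b :: complex and t :: real assumes "0 < t"
  shows "(norm (a + b))\<^sup>2 \<le> (1 + t) * (norm a)\<^sup>2 + (1 + 1 / t) * (norm b)\<^sup>2"
proof -
  have "(norm (a + b))\<^sup>2 \<le> (norm a + norm b)\<^sup>2"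
    by (simp add: norm_triangle_ineq power_mono)
  also have "\<dots> = (norm a)\<^sup>2 + (norm b)\<^sup>2 + 2 * norm a * norm b"
    by (simp add: power2_sum)
  also have "2 * norm a * norm b \<le> t * (norm a)\<^sup>2 + (1 / t) * (norm b)\<^sup>2"
  proof -
    have "0 \<le> (t * norm a - norm b)\<^sup>2 / t" using assms by simp
    also have "\<dots> = t * (norm a)\<^sup>2 + (1 / t) * (norm b)\<^sup>2 - 2 * norm a * norm b"
      using assms by (simp add: power2_diff field_simps power2_eq_square)
    finally show ?thesis by simp
  qed
  finally show ?thesis by (simp add: algebra_simps)
qed

lemma square_integrable_add:
  assumes "square_integrable M f" "square_integrable M g"
  shows "square_integrable M (\<lambda>x. f x + g x)"
  unfolding square_integrable_def
proof
  have [measurable]: "f \<in> borel_measurable M" "g \<in> borel_measurable M"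
    using assms by (auto simp: square_integrable_def)
  show "(\<lambda>x. f x + g x) \<in> borel_measurable M" by simp
  show "integrable M (\<lambda>x. (norm (f x + g x))\<^sup>2)"
  proof (rule Bochner_Integration.integrable_bound)
    show "integrable M (\<lambda>x. 2 * (norm (f x))\<^sup>2 + 2 * (norm (g x))\<^sup>2)"
      using assms by (auto simp: square_integrable_def)
    show "AE x in M. norm ((norm (f x + g x))\<^sup>2) \<le> norm (2 * (norm (f x))\<^sup>2 + 2 * (norm (g x))\<^sup>2)"
      using norm_add_sq_le[of 1] by simp
  qed simp
qed

lemma square_integrable_scale:
  "square_integrable M f \<Longrightarrow> square_integrable M (\<lambda>x. c * f x)"
  by (auto simp: square_integrable_def norm_mult power_mult_distrib)

lemma square_integrable_diff:
  assumes "square_integrable M f" "square_integrable M g"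
  shows "square_integrable M (\<lambda>x. f x - g x)"
  using square_integrable_add[OF assms(1) square_integrable_scale[OF assms(2), of "-1"]] by simp

lemma energy_minus: "energy M (\<lambda>x. f x - g x) = energy M (\<lambda>x. g x - f x)"
  by (simp add: energy_def norm_minus_commute)

lemma energy_add_le:
  assumes "square_integrable M f" "square_integrable M g" "0 < t"
  shows "energy M (\<lambda>x. f x + g x) \<le> (1 + t) * energy M f + (1 + 1 / t) * energy M g"
proof -
  have "energy M (\<lambda>x. f x + g x)
      \<le> (LINT x|M. (1 + t) * (norm (f x))\<^sup>2 + (1 + 1 / t) * (norm (g x))\<^sup>2)"
    unfolding energy_def
    using assms square_integrable_add[OF assms(1,2)]
    by (intro integral_mono) (auto simp: square_integrable_def intro!: norm_add_sq_le)
  also have "\<dots> = (1 + t) * energy M f + (1 + 1 / t) * energy M g"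
    using assms by (simp add: square_integrable_def energy_def)
  finally show ?thesis .
qed

lemma energy_diff_triangle:
  assumes "square_integrable M f" "square_integrable M g" "square_integrable M h"
  shows "energy M (\<lambda>x. f x - h x) \<le> 2 * energy M (\<lambda>x. f x - g x) + 2 * energy M (\<lambda>x. g x - h x)"
  using energy_add_le[of M "\<lambda>x. f x - g x" "\<lambda>x. g x - h x" 1] assms
  by (simp add: square_integrable_diff)

text \<open>
  A Cauchy sequence in \<open>L\<^sup>2\<close> becomes a Cauchy sequence in \<open>L\<^sup>1\<close> when it is multiplied by a fixed positive
  square integrable weight. A subsequence then converges almost everywhere, and Fatou's lemma turns
  its limit into the limit in \<open>L\<^sup>2\<close>. The subsequence is part of the conclusion because it also transports
  bounds on the energy.
\<close>

lemma (in sigma_finite_measure) L2_complete: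
  assumes u: "\<And>n. square_integrable M (u n)"
    and Cauchy: "\<And>e. 0 < e \<Longrightarrow> \<exists>N. \<forall>i\<ge>N. \<forall>j\<ge>N. energy M (\<lambda>x. u i x - u j x) < e"
  obtains g r where "square_integrable M g" "(\<lambda>n. energy M (\<lambda>x. u n x - g x)) \<longlonglongrightarrow> 0"
    "strict_mono r" "AE x in M. (\<lambda>i. u (r i) x) \<longlonglongrightarrow> g x"
proof -
  have um[measurable]: "u n \<in> borel_measurable M" and ui: "integrable M (\<lambda>x. (norm (u n x))\<^sup>2)" for n
    using u by (auto simp: square_integrable_def)
  obtain v :: "'a \<Rightarrow> real" where v[measurable]: "v \<in> borel_measurable M"
    and vpos: "\<And>x. 0 < v x" and vint: "integrable M v"
    by (rule obtain_positive_integrable_function) blast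
  define w :: "'a \<Rightarrow> complex" where "w x = complex_of_real (sqrt (v x))" for x
  have [measurable]: "w \<in> borel_measurable M" unfolding w_def by measurable
  have wn: "(norm (w x))\<^sup>2 = v x"  for x
    using vpos[of x] by (simp add: w_def)
  have w2: "integrable M (\<lambda>x. (norm (w x))\<^sup>2)"
    using vint by (simp add: wn)
  have young: "norm (w x * d) \<le> (norm (w x))\<^sup>2 / t + t * (norm d)\<^sup>2" if "0 < t" for x d t
  proof -
    have "0 \<le> (norm (w x) - t * norm d)\<^sup>2 / t" using that by simp
    also have "\<dots> = (norm (w x))\<^sup>2 / t + t * (norm d)\<^sup>2 - 2 * (norm (w x) * norm d)"
      using that by (simp add: power2_diff field_simps power2_eq_square)
    finally have "2 * (norm (w x) * norm d) \<le> (norm (w x))\<^sup>2 / t + t * (norm d)\<^sup>2" by simp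
    moreover have "0 \<le> norm (w x) * norm d" by simp
    ultimately show ?thesis unfolding norm_mult by linarith
  qed
  have L1: "integrable M (\<lambda>x. w x * d x)" if "square_integrable M d" for d
  proof (rule Bochner_Integration.integrable_bound)
    show "integrable M (\<lambda>x. (norm (w x))\<^sup>2 / 1 + 1 * (norm (d x))\<^sup>2)"
      using w2 that by (auto simp: square_integrable_def)
    show "AE x in M. norm (w x * d x) \<le> norm ((norm (w x))\<^sup>2 / 1 + 1 * (norm (d x))\<^sup>2)"
      using young[of 1] by simp
    show "(\<lambda>x. w x * d x) \<in> borel_measurable M" using that by (auto simp: square_integrable_def)
  qed
  have CauchyL1: "\<exists>N. \<forall>i\<ge>N. \<forall>j\<ge>N. (LINT x|M. norm (w x * u i x - w x * u j x)) < e" if "0 < e" for e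
  proof -
    define W where "W = energy M w"
    \<comment> \<open>The parameter makes the weight contribute less than e / 2 in Young's inequality.\<close>
    define t where "t = 2 * (W + 1) / e"
    have W0: "0 \<le> W" by (simp add: W_def)
    have t0: "0 < t" and Wt: "W / t < e / 2"
      using that W0 by (auto simp: t_def field_simps)
    obtain N where N: "\<And>i j. i \<ge> N \<Longrightarrow> j \<ge> N \<Longrightarrow> energy M (\<lambda>x. u i x - u j x) < e / (2 * t)"
      using Cauchy[of "e / (2 * t)"] t0 \<open>0 < e\<close> by auto
    have "(LINT x|M. norm (w x * u i x - w x * u j x)) < e" if "i \<ge> N" "j \<ge> N" for i j
    proof -
      have d: "square_integrable M (\<lambda>x. u i x - u j x)" using u by (simp add: square_integrable_diff)
      have "(LINT x|M. norm (w x * u i x - w x * u j x)) = (LINT x|M. norm (w x * (u i x - u j x)))"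
        by (simp add: algebra_simps)
      also have "\<dots> \<le> (LINT x|M. (norm (w x))\<^sup>2 / t + t * (norm (u i x - u j x))\<^sup>2)"
        using L1[OF d] d w2 young[OF t0] by (intro integral_mono) (auto simp: square_integrable_def)
      also have "\<dots> = W / t + t * energy M (\<lambda>x. u i x - u j x)"
        using w2 d by (simp add: W_def energy_def square_integrable_def)
      also have "\<dots> < e / 2 + t * (e / (2 * t))"
        using Wt mult_strict_left_mono[OF N[OF that] t0] by linarith
      also have "\<dots> = e" using t0 by simp
      finally show ?thesis .
    qed
    thus ?thesis by blast
  qed
  obtain r where r: "strict_mono r" and rC: "AE x in M. Cauchy (\<lambda>i. w x * u (r i) x)"
    using cauchy_L1_AE_cauchy_subseq[of M "\<lambda>n x. w x * u n x", OF L1[OF u] CauchyL1] by blast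
  define g where "g x = lim (\<lambda>i. u (r i) x)" for x
  have [measurable]: "g \<in> borel_measurable M" unfolding g_def by measurable
  have lim: "AE x in M. (\<lambda>i. u (r i) x) \<longlonglongrightarrow> g x"
    using rC AE_space
  proof eventually_elim
    fix x assume C: "Cauchy (\<lambda>i. w x * u (r i) x)" and x: "x \<in> space M"
    have "w x \<noteq> 0" using vpos[of x] by (simp add: w_def)
    moreover obtain l where "(\<lambda>i. w x * u (r i) x) \<longlonglongrightarrow> l"
      using C by (metis Cauchy_convergent_iff convergent_def)
    hence "(\<lambda>i. w x * u (r i) x / w x) \<longlonglongrightarrow> l / w x"
      using \<open>w x \<noteq> 0\<close> by (intro tendsto_divide) auto
    ultimately have "(\<lambda>i. u (r i) x) \<longlonglongrightarrow> l / w x" by simp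
    thus "(\<lambda>i. u (r i) x) \<longlonglongrightarrow> g x" unfolding g_def by (simp add: limI)
  qed
  have tail: "integrable M (\<lambda>x. (norm (u n x - g x))\<^sup>2) \<and> energy M (\<lambda>x. u n x - g x) \<le> e"
    if N: "\<And>i j. i \<ge> N \<Longrightarrow> j \<ge> N \<Longrightarrow> energy M (\<lambda>x. u i x - u j x) < e" and n: "n \<ge> N" for n N e
  proof -
    have lim': "AE x in M. (\<lambda>i. (norm (u n x - u (r (i + N)) x))\<^sup>2) \<longlonglongrightarrow> (norm (u n x - g x))\<^sup>2"
      using lim by eventually_elim (intro tendsto_intros LIMSEQ_ignore_initial_segment)
    have b: "(LINT x|M. (norm (u n x - u (r (i + N)) x))\<^sup>2) \<le> e" for i
      using N[OF n, of "r (i + N)"] seq_suble[OF r, of "i + N"] unfolding energy_def by simp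
    have int: "integrable M (\<lambda>x. (norm (u n x - u (r (i + N)) x))\<^sup>2)" for i
      using square_integrable_diff[OF u[of n] u] by (simp add: square_integrable_def)
    show ?thesis unfolding energy_def
      using Fatou_bounded_integrals[OF int _ _ lim' b] by simp
  qed
  obtain N1 where N1: "\<And>i j. i \<ge> N1 \<Longrightarrow> j \<ge> N1 \<Longrightarrow> energy M (\<lambda>x. u i x - u j x) < 1"
    using Cauchy[of 1] by auto
  have "square_integrable M (\<lambda>x. u N1 x - g x)"
    using tail[OF N1, of N1] by (simp add: square_integrable_def)
  hence g: "square_integrable M g"
    using square_integrable_diff[OF u[of N1], of "\<lambda>x. u N1 x - g x"] by simp
  have "(\<lambda>n. energy M (\<lambda>x. u n x - g x)) \<longlonglongrightarrow> 0"
  proof (rule LIMSEQ_I)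
    fix e :: real assume "0 < e"
    then obtain N where N: "\<And>i j. i \<ge> N \<Longrightarrow> j \<ge> N \<Longrightarrow> energy M (\<lambda>x. u i x - u j x) < e / 2"
      using Cauchy[of "e / 2"] by auto
    have "norm (energy M (\<lambda>x. u n x - g x) - 0) < e" if "n \<ge> N" for n
      using tail[OF N that] \<open>0 < e\<close> by simp
    thus "\<exists>N. \<forall>n\<ge>N. norm (energy M (\<lambda>x. u n x - g x) - 0) < e" by blast
  qed
  from that[OF g this r lim] show thesis .
qed

section \<open>The Gaussian and its Fourier transform\<close>

lemma (in pair_sigma_finite) integrable_mult_pair:
  fixes f :: "'a \<Rightarrow> 'c::{real_normed_field, banach, second_countable_topology}" and g :: "'b \<Rightarrow> 'c"
  assumes f: "integrable M1 f" and g: "integrable M2 g"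
  shows "integrable (M1 \<Otimes>\<^sub>M M2) (\<lambda>p. f (fst p) * g (snd p))"
proof (rule Fubini_integrable)
  show "(\<lambda>p. f (fst p) * g (snd p)) \<in> borel_measurable (M1 \<Otimes>\<^sub>M M2)"
    using f g by measurable
  show "integrable M1 (\<lambda>x. LINT y|M2. norm (f (fst (x, y)) * g (snd (x, y))))"
    using f by (simp add: norm_mult)
qed (use g in auto)

lemma (in pair_sigma_finite) integral_mult_pair:
  fixes f :: "'a \<Rightarrow> complex" and g :: "'b \<Rightarrow> complex"
  assumes f: "integrable M1 f" and g: "integrable M2 g"
  shows "(LINT p|(M1 \<Otimes>\<^sub>M M2). f (fst p) * g (snd p)) = (LINT x|M1. f x) * (LINT y|M2. g y)"
  by (subst integral_fst'[symmetric]) (auto simp: integrable_mult_pair assms)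

lemma lborel_distr_reflect:
  "distr lborel borel (\<lambda>y. x - y) = (lborel :: 'a::euclidean_space measure)"
  using lborel_affine[of "-1" x] by (simp add: density_1)

lemma integral_lborel_reflect:
  fixes f :: "'a::euclidean_space \<Rightarrow> 'b::{banach, second_countable_topology}"
  assumes "f \<in> borel_measurable borel"
  shows "(LINT y|lborel. f (x - y)) = (LINT y|lborel. f y)"
proof -
  have "(LINT y|lborel. f y) = (LINT y|distr lborel borel (\<lambda>y. x - y). f y)"
    by (simp add: lborel_distr_reflect)
  also have "\<dots> = (LINT y|lborel. f (x - y))"
    using assms by (subst integral_distr) auto
  finally show ?thesis ..
qed

lemma integrable_lborel_reflect:
  fixes f :: "'a::euclidean_space \<Rightarrow> 'b::{banach, second_countable_topology}"
  assumes "integrable lborel f"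
  shows "integrable lborel (\<lambda>y. f (x - y))"
proof -
  have "integrable (distr lborel borel (\<lambda>y. x - y)) f"
    using assms by (simp add: lborel_distr_reflect)
  thus ?thesis by (subst (asm) integrable_distr_eq) (use assms in auto)
qed

lemma integral_lborel_scale_reflect:
  fixes f :: "'a::euclidean_space \<Rightarrow> complex"
  assumes "f \<in> borel_measurable borel" "0 < s"
  shows "(LINT y|lborel. f y) = complex_of_real (s ^ DIM('a)) * (LINT z|lborel. f (x - s *\<^sub>R z))"
proof -
  have "(LINT y|lborel. f y)
      = (LINT y|density (distr lborel borel (\<lambda>z. x + (- s) *\<^sub>R z)) (\<lambda>_. \<bar>- s\<bar> ^ DIM('a)). f y)"
    using lborel_affine[of "-s" x] assms by simp
  also have "\<dots> = (LINT y|distr lborel borel (\<lambda>z. x + (- s) *\<^sub>R z). (s ^ DIM('a)) *\<^sub>R f y)"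
    using assms by (subst integral_density) auto
  also have "\<dots> = (LINT z|lborel. (s ^ DIM('a)) *\<^sub>R f (x - s *\<^sub>R z))"
    using assms by (subst integral_distr) auto
  finally show ?thesis by (simp add: scaleR_conv_of_real)
qed

lemma cis_measurable [measurable]: "cis \<in> borel_measurable borel"
  by (intro borel_measurable_continuous_onI continuous_on_cis continuous_on_id)

definition gauss :: "real \<Rightarrow> 'a::euclidean_space \<Rightarrow> real" where
  "gauss s x = exp (- (s * norm x)\<^sup>2 / 2)"

lemma gauss_measurable [measurable]: "gauss s \<in> borel_measurable borel"
  unfolding gauss_def by measurable

lemma gauss_pos: "0 < gauss s x" and gauss_le_1: "gauss s x \<le> 1"
  by (auto simp: gauss_def)

text \<open>
  This is the characteristic function of the standard normal distribution after a dilation.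
\<close>

lemma fourier_gauss_real:
  fixes s t :: real assumes "0 < s"
  shows "integrable lborel (gauss s :: real \<Rightarrow> real)"
    and "(LINT x|lborel. cis (- (x * t)) * complex_of_real (gauss s x))
           = complex_of_real (sqrt (2 * pi) / s * gauss (1 / s) t)"
proof -
  have eq: "gauss s x = sqrt (2 * pi) * std_normal_density (0 + s * x)" for x :: real
    by (simp add: std_normal_density_def gauss_def power_mult_distrib)
  have "integrable lborel std_normal_density"
    by (rule integrable_normal_density) simp
  hence "integrable lborel (\<lambda>x. std_normal_density (0 + s * x))"
    using assms by (intro lborel_integrable_real_affine) auto
  hence "integrable lborel (\<lambda>x. sqrt (2 * pi) * std_normal_density (0 + s * x))"
    by (rule integrable_mult_right)
  thus "integrable lborel (gauss s :: real \<Rightarrow> real)"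
    by (subst Bochner_Integration.integrable_cong[OF refl eq]) auto
  have "complex_of_real (gauss (1 / s) t) = char std_normal_distribution (- t / s)"
    by (simp add: char_std_normal_distribution gauss_def power_divide power_mult_distrib)
  also have "\<dots> = (LINT x|lborel. std_normal_density x *\<^sub>R iexp (- t / s * x))"
    unfolding char_def by (subst integral_density) auto
  also have "\<dots> = \<bar>s\<bar> *\<^sub>R (LINT x|lborel. std_normal_density (0 + s * x) *\<^sub>R iexp (- t / s * (0 + s * x)))"
    using assms by (intro lborel_integral_real_affine) auto
  also have "(\<lambda>x. std_normal_density (0 + s * x) *\<^sub>R iexp (- t / s * (0 + s * x)))
      = (\<lambda>x. complex_of_real (1 / sqrt (2 * pi)) * (cis (- (x * t)) * complex_of_real (gauss s x)))"
    using assms by (auto simp: fun_eq_iff eq scaleR_conv_of_real cis_conv_exp algebra_simps)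
  finally have "complex_of_real (gauss (1 / s) t) = complex_of_real (s / sqrt (2 * pi)) *
      (LINT x|lborel. cis (- (x * t)) * complex_of_real (gauss s x))"
    using assms by (simp add: scaleR_conv_of_real)
  thus "(LINT x|lborel. cis (- (x * t)) * complex_of_real (gauss s x))
           = complex_of_real (sqrt (2 * pi) / s * gauss (1 / s) t)"
    using assms by (simp add: field_simps)
qed

text \<open>
  Both the Gaussian and the character are products over the coordinates, so the integral factors into
  one-dimensional ones.
\<close>

lemma fourier_gauss:
  fixes z :: "'a::euclidean_space" assumes s: "0 < s"
  shows "integrable lborel (gauss s :: 'a \<Rightarrow> real)"
    and "(LINT x|lborel. cis (- (x \<bullet> z)) * complex_of_real (gauss s x))
           = complex_of_real ((sqrt (2 * pi) / s) ^ DIM('a) * gauss (1 / s) z)"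
proof -
  interpret P: product_sigma_finite "\<lambda>_::'a. lborel :: real measure" ..
  define F where "F b x = cis (- (x * (z \<bullet> b))) * complex_of_real (gauss s x)" for b :: 'a and x :: real
  have [measurable]: "F b \<in> borel_measurable borel" for b
    unfolding F_def by measurable
  have Fint: "integrable lborel (F b)" for b
  proof (rule Bochner_Integration.integrable_bound)
    show "integrable lborel (gauss s :: real \<Rightarrow> real)" by (rule fourier_gauss_real(1)[OF s])
    show "AE x in lborel. norm (F b x) \<le> norm (gauss s x)"
      by (simp add: F_def norm_mult)
  qed simp
  have gauss_prod: "gauss r w = (\<Prod>b\<in>Basis. gauss r (w \<bullet> b))" for r and w :: 'a
  proof -
    have "(norm w)\<^sup>2 = (\<Sum>b\<in>Basis. (w \<bullet> b)\<^sup>2)"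
      unfolding power2_norm_eq_inner by (subst euclidean_inner) (simp add: power2_eq_square)
    thus ?thesis
      by (simp add: gauss_def exp_sum[symmetric] power_mult_distrib sum_distrib_left
          sum_negf sum_divide_distrib)
  qed
  have cis_prod: "cis (- (x \<bullet> z)) = (\<Prod>b\<in>Basis. cis (- ((x \<bullet> b) * (z \<bullet> b))))" for x
    by (subst euclidean_inner) (simp add: cis_conv_exp sum_negf exp_sum[symmetric] sum_distrib_left)
  have prod: "cis (- (x \<bullet> z)) * complex_of_real (gauss s x) = (\<Prod>b\<in>Basis. F b (x \<bullet> b))" for x
    unfolding F_def prod.distrib cis_prod gauss_prod[of s x] by simp
  let ?T = "\<lambda>f::'a \<Rightarrow> real. \<Sum>b\<in>Basis. f b *\<^sub>R b"
  have T: "?T f \<bullet> b = f b" if "b \<in> Basis" for f b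
    using that by (simp add: inner_sum_left inner_Basis if_distrib sum.delta cong: if_cong)
  have meas: "(\<lambda>x. \<Prod>b\<in>Basis. F b (x \<bullet> b)) \<in> borel_measurable (borel :: 'a measure)"
    by measurable
  have prodT: "(\<Prod>b\<in>Basis. F b (?T f \<bullet> b)) = (\<Prod>b\<in>Basis. F b (f b))" for f
    by (intro prod.cong refl) (simp add: T)
  have "integrable (\<Pi>\<^sub>M b\<in>Basis. lborel) (\<lambda>f. \<Prod>b\<in>Basis. F b (f b))"
    by (intro P.product_integrable_prod Fint) auto
  hence "integrable lborel (\<lambda>x::'a. \<Prod>b\<in>Basis. F b (x \<bullet> b))"
    by (subst lborel_eq, subst integrable_distr_eq) (use meas prodT in auto)
  hence "integrable lborel (\<lambda>x::'a. norm (\<Prod>b\<in>Basis. F b (x \<bullet> b)))" by simp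
  also have "(\<lambda>x::'a. norm (\<Prod>b\<in>Basis. F b (x \<bullet> b))) = gauss s"
    unfolding prod[symmetric] by (simp add: norm_mult gauss_def fun_eq_iff)
  finally show "integrable lborel (gauss s :: 'a \<Rightarrow> real)" .
  have "(LINT x|lborel. cis (- (x \<bullet> z)) * complex_of_real (gauss s x))
      = (LINT f|(\<Pi>\<^sub>M b\<in>Basis. lborel). (\<Prod>b\<in>Basis. F b (f b)))"
    unfolding prod by (subst lborel_eq, subst integral_distr) (use meas prodT in auto)
  also have "\<dots> = (\<Prod>b\<in>Basis. LINT x|lborel. F b x)"
    by (intro P.product_integral_prod Fint) auto
  also have "\<dots> = (\<Prod>b\<in>Basis. complex_of_real (sqrt (2 * pi) / s * gauss (1 / s) (z \<bullet> b)))"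
    unfolding F_def using fourier_gauss_real(2)[OF s] by simp
  also have "\<dots> = complex_of_real ((sqrt (2 * pi) / s) ^ DIM('a) * gauss (1 / s) z)"
    unfolding of_real_prod[symmetric] prod.distrib by (simp add: gauss_prod[of "1 / s" z])
  finally show "(LINT x|lborel. cis (- (x \<bullet> z)) * complex_of_real (gauss s x))
           = complex_of_real ((sqrt (2 * pi) / s) ^ DIM('a) * gauss (1 / s) z)" .
qed

section \<open>Two inequalities of Plancherel\<close>

definition fourier :: "('a::euclidean_space \<Rightarrow> complex) \<Rightarrow> 'a \<Rightarrow> complex" where
  "fourier f \<xi> = (LINT x|lborel. cis (- (x \<bullet> \<xi>)) * f x)"

lemma cnj_measurable [measurable]: "cnj \<in> borel_measurable borel"
  by (intro borel_measurable_continuous_onI continuous_on_cnj continuous_on_id)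

lemma integrable_cis_mult:
  assumes "integrable lborel f"
  shows "integrable lborel (\<lambda>x. cis (- (x \<bullet> \<xi>)) * f x)"
proof (rule Bochner_Integration.integrable_bound[OF assms])
  show "(\<lambda>x. cis (- (x \<bullet> \<xi>)) * f x) \<in> borel_measurable lborel"
    using assms by measurable
qed (simp add: norm_mult)

lemma fourier_measurable [measurable]:
  fixes f :: "'a::euclidean_space \<Rightarrow> complex"
  assumes [measurable]: "f \<in> borel_measurable borel"
  shows "fourier f \<in> borel_measurable borel"
proof -
  have "(\<lambda>\<xi>. LINT x|lborel. cis (- (x \<bullet> \<xi>)) * f x) \<in> borel_measurable lborel"
    by (rule lborel.borel_measurable_lebesgue_integral) measurable
  thus ?thesis by (simp add: fourier_def[abs_def])
qed

lemma norm_fourier_le: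
  assumes "integrable lborel f"
  shows "norm (fourier f \<xi>) \<le> (LINT x|lborel. norm (f x))"
proof -
  have "norm (fourier f \<xi>) \<le> (LINT x|lborel. norm (cis (- (x \<bullet> \<xi>)) * f x))"
    unfolding fourier_def by (rule integral_norm_bound)
  thus ?thesis by (simp add: norm_mult)
qed

text \<open>
  The Fourier transform of \<^term>\<open>gauss s\<close>: an approximate identity of total mass \<open>(2\<pi>)\<^sup>d\<close> as \<open>s\<close> tends to \<open>0\<close>.
\<close>

definition heat :: "real \<Rightarrow> 'a::euclidean_space \<Rightarrow> real" where
  "heat s z = (sqrt (2 * pi) / s) ^ DIM('a) * gauss (1 / s) z"

lemma heat_measurable [measurable]: "heat s \<in> borel_measurable borel"
  unfolding heat_def by measurable

lemma heat_nonneg: "0 < s \<Longrightarrow> 0 \<le> heat s z"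
  by (simp add: heat_def gauss_def)

lemma heat_minus: "heat s (x - y) = heat s (y - x)"
  by (simp add: heat_def gauss_def norm_minus_commute)

lemma heat_integral:
  fixes s :: real assumes s: "0 < s"
  shows "integrable lborel (heat s :: 'a::euclidean_space \<Rightarrow> real)"
    and "(LINT z|lborel. heat s (z::'a)) = (2 * pi) ^ DIM('a)"
proof -
  have i: "integrable lborel (gauss (1 / s) :: 'a \<Rightarrow> real)"
    using s by (intro fourier_gauss) auto
  thus "integrable lborel (heat s :: 'a \<Rightarrow> real)"
    unfolding heat_def[abs_def] by simp
  have "complex_of_real (LINT z|lborel. gauss (1 / s) (z::'a))
      = (LINT z|lborel. cis (- (z \<bullet> 0)) * complex_of_real (gauss (1 / s) (z::'a)))"
    by simp
  also have "\<dots> = complex_of_real ((sqrt (2 * pi) / (1 / s)) ^ DIM('a) * gauss (1 / (1 / s)) (0::'a))"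
    using s by (intro fourier_gauss) auto
  also have "\<dots> = complex_of_real ((sqrt (2 * pi) * s) ^ DIM('a))"
    by (simp add: gauss_def)
  finally have eq: "(LINT z|lborel. gauss (1 / s) (z::'a)) = (sqrt (2 * pi) * s) ^ DIM('a)"
    by (simp only: of_real_eq_iff)
  have "(LINT z|lborel. heat s (z::'a)) = (sqrt (2 * pi) / s) ^ DIM('a) * (sqrt (2 * pi) * s) ^ DIM('a)"
    unfolding heat_def by (simp add: eq)
  also have "\<dots> = (sqrt (2 * pi) / s * (sqrt (2 * pi) * s)) ^ DIM('a)"
    by (rule power_mult_distrib[symmetric])
  also have "sqrt (2 * pi) / s * (sqrt (2 * pi) * s) = 2 * pi"
    using s by simp
  finally show "(LINT z|lborel. heat s (z::'a)) = (2 * pi) ^ DIM('a)" .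
qed

text \<open>
  Writing \<open>|h\<^sup>^|\<^sup>2\<close> as a double integral and integrating the Gaussian first replaces the frequency by the
  heat kernel. The Gaussian is what makes the triple integral absolutely convergent.
\<close>

lemma heat_pairing:
  fixes h :: "'a::euclidean_space \<Rightarrow> complex"
  assumes h: "integrable lborel h" and s: "0 < s"
  shows "complex_of_real (LINT \<xi>|lborel. gauss s \<xi> * (norm (fourier h \<xi>))\<^sup>2)
    = (LINT p|(lborel \<Otimes>\<^sub>M lborel). h (fst p) * cnj (h (snd p)) * complex_of_real (heat s (fst p - snd p)))"
proof -
  have [measurable]: "h \<in> borel_measurable borel" using borel_measurable_integrable[OF h] by simp
  define H where "H p = h (fst p) * cnj (h (snd p))" for p
  have [measurable]: "H \<in> borel_measurable (borel \<Otimes>\<^sub>M borel)" unfolding H_def by measurable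
  have Hint: "integrable (lborel \<Otimes>\<^sub>M lborel) H"
    unfolding H_def using h by (intro lborel_pair.integrable_mult_pair) auto
  interpret Q: pair_sigma_finite "lborel :: 'a measure" "lborel \<Otimes>\<^sub>M lborel :: ('a \<times> 'a) measure"
    unfolding lborel_prod by (rule pair_sigma_finite.intro[OF sigma_finite_lborel sigma_finite_lborel])
  have sq: "complex_of_real ((norm (fourier h \<xi>))\<^sup>2)
      = (LINT p|(lborel \<Otimes>\<^sub>M lborel). cis (- ((fst p - snd p) \<bullet> \<xi>)) * H p)" for \<xi>
  proof -
    have "complex_of_real ((norm (fourier h \<xi>))\<^sup>2) = fourier h \<xi> * cnj (fourier h \<xi>)"
      by (rule complex_norm_square)
    also have "\<dots> = (LINT x|lborel. cis (- (x \<bullet> \<xi>)) * h x) * (LINT y|lborel. cnj (cis (- (y \<bullet> \<xi>)) * h y))"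
      by (simp only: fourier_def Bochner_Integration.integral_cnj)
    also have "\<dots> = (LINT p|(lborel \<Otimes>\<^sub>M lborel). (cis (- (fst p \<bullet> \<xi>)) * h (fst p)) * cnj (cis (- (snd p \<bullet> \<xi>)) * h (snd p)))"
      by (intro lborel_pair.integral_mult_pair[symmetric] complex_integrable_cnj[THEN iffD2] integrable_cis_mult h)
    also have "\<dots> = (LINT p|(lborel \<Otimes>\<^sub>M lborel). cis (- ((fst p - snd p) \<bullet> \<xi>)) * H p)"
    proof (intro Bochner_Integration.integral_cong refl)
      fix p :: "'a \<times> 'a"
      have "cis (- ((fst p - snd p) \<bullet> \<xi>)) = cis (- (fst p \<bullet> \<xi>)) * cnj (cis (- (snd p \<bullet> \<xi>)))"
        by (simp add: cis_cnj cis_mult inner_diff_left)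
      thus "(cis (- (fst p \<bullet> \<xi>)) * h (fst p)) * cnj (cis (- (snd p \<bullet> \<xi>)) * h (snd p))
          = cis (- ((fst p - snd p) \<bullet> \<xi>)) * H p"
        unfolding H_def complex_cnj_mult by (simp only: mult_ac)
    qed
    finally show ?thesis .
  qed
  define F where "F \<xi> p = complex_of_real (gauss s \<xi>) * (cis (- ((fst p - snd p) \<bullet> \<xi>)) * H p)" for \<xi> p
  have Fint: "integrable (lborel \<Otimes>\<^sub>M (lborel \<Otimes>\<^sub>M lborel)) (case_prod F)"
  proof (rule Bochner_Integration.integrable_bound)
    show "integrable (lborel \<Otimes>\<^sub>M (lborel \<Otimes>\<^sub>M lborel)) (\<lambda>q. complex_of_real (gauss s (fst q :: 'a)) * H (snd q))"
      by (rule Q.integrable_mult_pair[OF integrable_of_real[OF fourier_gauss(1)[OF s]] Hint])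
    show "case_prod F \<in> borel_measurable (lborel \<Otimes>\<^sub>M (lborel \<Otimes>\<^sub>M lborel))"
      unfolding F_def by measurable
  qed (simp add: F_def norm_mult case_prod_unfold)
  have "complex_of_real (LINT \<xi>|lborel. gauss s \<xi> * (norm (fourier h \<xi>))\<^sup>2)
      = (LINT \<xi>|lborel. LINT p|(lborel \<Otimes>\<^sub>M lborel). F \<xi> p)"
  proof (subst integral_complex_of_real[symmetric], intro Bochner_Integration.integral_cong refl)
    fix \<xi> :: 'a
    show "complex_of_real (gauss s \<xi> * (norm (fourier h \<xi>))\<^sup>2) = (LINT p|(lborel \<Otimes>\<^sub>M lborel). F \<xi> p)"
      unfolding F_def integral_mult_right_zero of_real_mult sq ..
  qed
  also have "\<dots> = (LINT p|(lborel \<Otimes>\<^sub>M lborel). LINT \<xi>|lborel. F \<xi> p)"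
    by (rule Q.Fubini_integral[symmetric, OF Fint])
  also have "\<dots> = (LINT p|(lborel \<Otimes>\<^sub>M lborel). H p * complex_of_real (heat s (fst p - snd p)))"
  proof (intro Bochner_Integration.integral_cong refl)
    fix p :: "'a \<times> 'a"
    have "(LINT \<xi>|lborel. F \<xi> p) = (LINT \<xi>|lborel. H p * (cis (- (\<xi> \<bullet> (fst p - snd p))) * complex_of_real (gauss s \<xi>)))"
      unfolding F_def by (intro Bochner_Integration.integral_cong refl) (simp only: inner_commute mult_ac)
    also have "\<dots> = H p * complex_of_real (heat s (fst p - snd p))"
      unfolding integral_mult_right_zero fourier_gauss(2)[OF s] heat_def ..
    finally show "(LINT \<xi>|lborel. F \<xi> p) = H p * complex_of_real (heat s (fst p - snd p))" .
  qed
  finally show ?thesis by (simp add: H_def)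
qed

lemma heat_weight_integral:
  fixes f :: "'a::euclidean_space \<Rightarrow> complex"
  assumes f: "square_integrable lborel f" and s: "0 < s"
  shows "integrable (lborel \<Otimes>\<^sub>M lborel) (\<lambda>p. (norm (f (fst p)))\<^sup>2 * heat s (fst p - snd p))"
    and "(LINT p|(lborel \<Otimes>\<^sub>M lborel). (norm (f (fst p)))\<^sup>2 * heat s (fst p - snd p)) = (2 * pi) ^ DIM('a) * energy lborel f"
proof -
  have [measurable]: "f \<in> borel_measurable borel" using f by (simp add: square_integrable_def)
  have i: "integrable lborel (\<lambda>y. heat s (x - y))" for x :: 'a
    by (intro integrable_lborel_reflect heat_integral s)
  have e: "(LINT y|lborel. heat s (x - y)) = (2 * pi) ^ DIM('a)" for x :: 'a
    by (simp add: integral_lborel_reflect heat_integral s)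
  show *: "integrable (lborel \<Otimes>\<^sub>M lborel) (\<lambda>p. (norm (f (fst p)))\<^sup>2 * heat s (fst p - snd p))"
  proof (rule lborel_pair.Fubini_integrable)
    show "integrable lborel (\<lambda>x. LINT y|lborel. norm ((norm (f (fst (x, y))))\<^sup>2 * heat s (fst (x, y) - snd (x, y))))"
      using f s by (simp add: heat_nonneg e square_integrable_def abs_mult)
  qed (use i in auto)
  show "(LINT p|(lborel \<Otimes>\<^sub>M lborel). (norm (f (fst p)))\<^sup>2 * heat s (fst p - snd p)) = (2 * pi) ^ DIM('a) * energy lborel f"
    by (subst lborel_pair.integral_fst'[OF *, symmetric]) (simp add: e energy_def)
qed

text \<open>
  By \<open>2|f(x)f(y)| \<le> |f(x)|\<^sup>2 + |f(y)|\<^sup>2\<close> the pairing with the heat kernel is at most its mass times the energy, for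
  every width. The widths then tend to \<open>0\<close>, where the Gaussian increases to \<open>1\<close>, and Fatou's lemma applies.
\<close>

lemma fourier_bounded_energy:
  fixes f :: "'a::euclidean_space \<Rightarrow> complex"
  assumes i: "integrable lborel f" and f: "square_integrable lborel f"
  shows "square_integrable lborel (fourier f)"
    and "energy lborel (fourier f) \<le> (2 * pi) ^ DIM('a) * energy lborel f"
proof -
  have [measurable]: "f \<in> borel_measurable borel" using f by (simp add: square_integrable_def)
  have 1: "(LINT \<xi>|lborel. gauss s \<xi> * (norm (fourier f \<xi>))\<^sup>2) \<le> (2 * pi) ^ DIM('a) * energy lborel f"
    if s: "0 < s" for s
  proof -
    define W where "W p = (norm (f (fst p)))\<^sup>2 * heat s (fst p - snd p)" for p
    have W: "integrable (lborel \<Otimes>\<^sub>M lborel) W" "integral\<^sup>L (lborel \<Otimes>\<^sub>M lborel) W = (2 * pi) ^ DIM('a) * energy lborel f"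
      unfolding W_def using heat_weight_integral[OF f s] by auto
    have [measurable]: "W \<in> borel_measurable (borel \<Otimes>\<^sub>M borel)" unfolding W_def by measurable
    have W': "integrable (lborel \<Otimes>\<^sub>M lborel) (\<lambda>p. W (snd p, fst p))"
      using lborel_pair.integrable_product_swap[OF W(1)] by (simp add: case_prod_unfold)
    have "integral\<^sup>L (lborel \<Otimes>\<^sub>M lborel) (\<lambda>p. W (snd p, fst p)) = integral\<^sup>L (lborel \<Otimes>\<^sub>M lborel) W"
      using lborel_pair.integral_product_swap[of W] by (simp add: case_prod_unfold)
    note W'2 = this
    have "(LINT \<xi>|lborel. gauss s \<xi> * (norm (fourier f \<xi>))\<^sup>2)
       = norm (LINT p|(lborel \<Otimes>\<^sub>M lborel). f (fst p) * cnj (f (snd p)) * complex_of_real (heat s (fst p - snd p)))"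
    proof (subst heat_pairing[OF i s, symmetric])
      have "0 \<le> (LINT \<xi>|lborel. gauss s \<xi> * (norm (fourier f \<xi>))\<^sup>2)"
        by (intro Bochner_Integration.integral_nonneg) (simp add: gauss_def)
      thus "(LINT \<xi>|lborel. gauss s \<xi> * (norm (fourier f \<xi>))\<^sup>2) = norm (complex_of_real (LINT \<xi>|lborel. gauss s \<xi> * (norm (fourier f \<xi>))\<^sup>2))"
        by simp
    qed
    also have "\<dots> \<le> (LINT p|(lborel \<Otimes>\<^sub>M lborel). norm (f (fst p) * cnj (f (snd p)) * complex_of_real (heat s (fst p - snd p))))"
      by (rule integral_norm_bound)
    also have "\<dots> \<le> (LINT p|(lborel \<Otimes>\<^sub>M lborel). (W p + W (snd p, fst p)) / 2)"
    proof (rule integral_mono')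
      show "integrable (lborel \<Otimes>\<^sub>M lborel) (\<lambda>p. (W p + W (snd p, fst p)) / 2)"
        using W W' by simp
      fix p :: "'a \<times> 'a"
      show "0 \<le> (W p + W (snd p, fst p)) / 2"
        unfolding W_def
        by (intro divide_nonneg_pos add_nonneg_nonneg mult_nonneg_nonneg heat_nonneg[OF s]) simp_all
      have "0 \<le> (norm (f (fst p)) - norm (f (snd p)))\<^sup>2 / 2 * heat s (fst p - snd p)"
        by (intro mult_nonneg_nonneg heat_nonneg[OF s]) simp
      also have "\<dots> = (W p + W (snd p, fst p)) / 2 - norm (f (fst p)) * norm (f (snd p)) * heat s (fst p - snd p)"
        unfolding W_def fst_conv snd_conv heat_minus[of s "snd p" "fst p"] power2_diff
        by (simp add: algebra_simps add_divide_distrib diff_divide_distrib)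
      finally show "norm (f (fst p) * cnj (f (snd p)) * complex_of_real (heat s (fst p - snd p))) \<le> (W p + W (snd p, fst p)) / 2"
        using heat_nonneg[OF s, of "fst p - snd p"] by (simp add: norm_mult)
    qed
    also have "\<dots> = (2 * pi) ^ DIM('a) * energy lborel f"
      using W W' W'2 by simp
    finally show ?thesis .
  qed
  have bdd: "integrable lborel (\<lambda>\<xi>. gauss s \<xi> * (norm (fourier f \<xi>))\<^sup>2)" if "0 < s" for s
  proof (rule Bochner_Integration.integrable_bound)
    define B where "B = (LINT x|lborel. norm (f x))"
    show "integrable lborel (\<lambda>\<xi>::'a. B\<^sup>2 * gauss s \<xi>)"
      by (intro integrable_mult_right fourier_gauss(1) that)
    have "gauss s \<xi> * (norm (fourier f \<xi>))\<^sup>2 \<le> B\<^sup>2 * gauss s \<xi>" for \<xi>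
      using power_mono[OF norm_fourier_le[OF i, of \<xi>], of 2] gauss_pos[of s \<xi>]
      by (simp add: B_def mult.commute)
    thus "AE \<xi> in lborel. norm (gauss s \<xi> * (norm (fourier f \<xi>))\<^sup>2) \<le> norm (B\<^sup>2 * gauss s \<xi>)"
      by (simp add: abs_mult gauss_pos less_imp_le)
  qed simp
  define g where "g n \<xi> = gauss (1 / real (Suc n)) \<xi> * (norm (fourier f \<xi>))\<^sup>2" for n \<xi>
  have lim: "(\<lambda>n. g n \<xi>) \<longlonglongrightarrow> (norm (fourier f \<xi>))\<^sup>2" for \<xi>
  proof -
    have s0: "(\<lambda>n. 1 / real (Suc n)) \<longlonglongrightarrow> 0"
      by (rule lim_1_over_n[THEN LIMSEQ_Suc])
    have "(\<lambda>n. exp (- (1 / real (Suc n) * norm \<xi>)\<^sup>2 / 2) * (norm (fourier f \<xi>))\<^sup>2)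
        \<longlonglongrightarrow> exp (- (0 * norm \<xi>)\<^sup>2 / 2) * (norm (fourier f \<xi>))\<^sup>2"
      by (rule tendsto_intros s0 | simp)+
    thus ?thesis unfolding g_def gauss_def by simp
  qed
  have a: "integrable lborel (g n)" "(LINT \<xi>|lborel. g n \<xi>) \<le> (2 * pi) ^ DIM('a) * energy lborel f" for n
    unfolding g_def using bdd 1 by auto
  have b: "0 \<le> g n \<xi>" for n \<xi> by (simp add: g_def gauss_def)
  show "square_integrable lborel (fourier f)"
    and "energy lborel (fourier f) \<le> (2 * pi) ^ DIM('a) * energy lborel f"
  proof -
    have l: "AE \<xi> in lborel. (\<lambda>n. g n \<xi>) \<longlonglongrightarrow> (norm (fourier f \<xi>))\<^sup>2" by (simp add: lim)
    have m: "(\<lambda>\<xi>. (norm (fourier f \<xi>))\<^sup>2) \<in> borel_measurable lborel" by simp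
    note F = Fatou_bounded_integrals[OF a(1) b m l a(2)]
    show "square_integrable lborel (fourier f)" using F(1) by (simp add: square_integrable_def)
    show "energy lborel (fourier f) \<le> (2 * pi) ^ DIM('a) * energy lborel f"
      using F(2) by (simp add: energy_def)
  qed
qed

text \<open>
  For a bounded continuous function the pairing with the heat kernel tends to \<open>(2\<pi>)\<^sup>d\<close> times the energy,
  because the heat kernel concentrates at the origin; each pairing is at most \<open>\<integral> |h\<^sup>^|\<^sup>2\<close>.
  Continuity gives pointwise convergence of the averages \<open>\<integral> h(x - s z) heat(z) dz\<close>.
\<close>

lemma energy_le_fourier:
  fixes h :: "'a::euclidean_space \<Rightarrow> complex"
  assumes i: "integrable lborel h" and c: "continuous_on UNIV h" and B: "\<And>x. norm (h x) \<le> B"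
    and f: "square_integrable lborel (fourier h)"
  shows "(2 * pi) ^ DIM('a) * energy lborel h \<le> energy lborel (fourier h)"
proof -
  have [measurable]: "h \<in> borel_measurable borel" using c by (rule borel_measurable_continuous_onI)
  have B0: "0 \<le> B" using B[of 0] norm_ge_zero order_trans by blast
  define s where "s n = 1 / real (Suc n)" for n
  have s: "0 < s n" for n by (simp add: s_def)
  have s0: "s \<longlonglongrightarrow> 0" unfolding s_def by (rule lim_1_over_n[THEN LIMSEQ_Suc])
  have scale: "complex_of_real (s n ^ DIM('a)) * complex_of_real (heat (s n) (s n *\<^sub>R z)) = complex_of_real (heat 1 z)"
    for n and z :: 'a
  proof -
    have "gauss (1 / s n) (s n *\<^sub>R z) = gauss 1 z"
      using s[of n] by (simp add: gauss_def)
    moreover have "s n ^ DIM('a) * (sqrt (2 * pi) / s n) ^ DIM('a) = (sqrt (2 * pi) / 1) ^ DIM('a)"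
      unfolding power_mult_distrib[symmetric] using s[of n] by simp
    ultimately show ?thesis
      unfolding heat_def of_real_mult[symmetric] mult.assoc[symmetric] by simp
  qed
  have heat1: "integrable lborel (\<lambda>z::'a. complex_of_real (heat 1 z))"
    by (intro integrable_of_real heat_integral) simp
  define G where "G n x = (LINT z|lborel. cnj (h (x - s n *\<^sub>R z)) * complex_of_real (heat 1 z))" for n x
  have [measurable]: "G n \<in> borel_measurable borel" for n
  proof -
    have "G n \<in> borel_measurable lborel" unfolding G_def
      by (rule lborel.borel_measurable_lebesgue_integral) measurable
    thus ?thesis by simp
  qed
  have dom: "integrable lborel (\<lambda>z::'a. B * heat 1 z)"
    by (intro integrable_mult_right heat_integral) simp
  have Gle: "norm (G n x) \<le> B * (2 * pi) ^ DIM('a)" for n x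
  proof -
    have "norm (G n x) \<le> (LINT z|lborel. norm (cnj (h (x - s n *\<^sub>R z)) * complex_of_real (heat 1 z)))"
      unfolding G_def by (rule integral_norm_bound)
    also have "\<dots> \<le> (LINT z|lborel. B * heat 1 (z::'a))"
      by (rule integral_mono'[OF dom]) (auto simp: norm_mult heat_nonneg B intro!: mult_right_mono mult_nonneg_nonneg B0)
    also have "\<dots> = B * (2 * pi) ^ DIM('a)" by (simp add: heat_integral)
    finally show ?thesis .
  qed
  have Glim: "(\<lambda>n. G n x) \<longlonglongrightarrow> cnj (h x) * complex_of_real ((2 * pi) ^ DIM('a))" for x
  proof -
    have "(\<lambda>n. G n x) \<longlonglongrightarrow> (LINT z|lborel. cnj (h x) * complex_of_real (heat 1 (z::'a)))"
      unfolding G_def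
    proof (rule integral_dominated_convergence[OF _ _ dom])
      show "AE z in lborel. (\<lambda>n. cnj (h (x - s n *\<^sub>R z)) * complex_of_real (heat 1 z)) \<longlonglongrightarrow> cnj (h x) * complex_of_real (heat 1 z)"
      proof (intro always_eventually allI)
        fix z
        have "(\<lambda>n. x - s n *\<^sub>R z) \<longlonglongrightarrow> x - 0 *\<^sub>R z" by (intro tendsto_intros s0)
        hence "(\<lambda>n. h (x - s n *\<^sub>R z)) \<longlonglongrightarrow> h x"
          using c continuous_on_tendsto_compose[OF c, of "\<lambda>n. x - s n *\<^sub>R z" x sequentially] by simp
        thus "(\<lambda>n. cnj (h (x - s n *\<^sub>R z)) * complex_of_real (heat 1 z)) \<longlonglongrightarrow> cnj (h x) * complex_of_real (heat 1 z)"
          by (intro tendsto_intros)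
      qed
      show "AE z in lborel. norm (cnj (h (x - s n *\<^sub>R z)) * complex_of_real (heat 1 z)) \<le> B * heat 1 z" for n
        by (auto simp: norm_mult heat_nonneg B intro!: mult_right_mono)
    qed simp_all
    also have "(LINT z|lborel. cnj (h x) * complex_of_real (heat 1 (z::'a))) = cnj (h x) * complex_of_real ((2 * pi) ^ DIM('a))"
      by (simp add: heat_integral)
    finally show ?thesis .
  qed
  have pair: "complex_of_real (LINT \<xi>|lborel. gauss (s n) \<xi> * (norm (fourier h \<xi>))\<^sup>2) = (LINT x|lborel. h x * G n x)" for n
  proof -
    let ?P = "\<lambda>p. h (fst p) * cnj (h (snd p)) * complex_of_real (heat (s n) (fst p - snd p))"
    have "integrable (lborel \<Otimes>\<^sub>M lborel) ?P"
    proof (rule lborel_pair.Fubini_integrable)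
      show "integrable lborel (\<lambda>x. LINT y|lborel. norm (?P (x, y)))"
      proof (rule Bochner_Integration.integrable_bound)
        show "integrable lborel (\<lambda>x. norm (h x) * (B * (2 * pi) ^ DIM('a)))" using i by simp
        have "(\<lambda>x. LINT y|lborel. norm (?P (x, y))) \<in> borel_measurable lborel"
          by (rule lborel.borel_measurable_lebesgue_integral) measurable
        thus "(\<lambda>x. LINT y|lborel. norm (?P (x, y))) \<in> borel_measurable lborel" .
        show "AE x in lborel. norm (LINT y|lborel. norm (?P (x, y))) \<le> norm (norm (h x) * (B * (2 * pi) ^ DIM('a)))"
        proof (intro always_eventually allI)
          fix x
          have "(LINT y|lborel. norm (?P (x, y))) \<le> (LINT y|lborel. norm (h x) * (B * heat (s n) (x - y)))"
            by (rule integral_mono', intro integrable_mult_right integrable_lborel_reflect heat_integral s)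
              (auto simp: norm_mult heat_nonneg s B B0 mult.assoc intro!: mult_mono)
          also have "\<dots> = norm (h x) * (B * (2 * pi) ^ DIM('a))"
            by (simp add: integral_lborel_reflect heat_integral s)
          finally show "norm (LINT y|lborel. norm (?P (x, y))) \<le> norm (norm (h x) * (B * (2 * pi) ^ DIM('a)))"
            using B0 by (simp add: Bochner_Integration.integral_nonneg)
        qed
      qed
      show "AE x in lborel. integrable lborel (\<lambda>y. ?P (x, y))"
      proof (intro always_eventually allI)
        fix x
        show "integrable lborel (\<lambda>y. ?P (x, y))"
        proof (rule Bochner_Integration.integrable_bound)
          show "integrable lborel (\<lambda>y. norm (h x) * (B * heat (s n) (x - y)))"
            by (intro integrable_mult_right integrable_lborel_reflect heat_integral s)
        qed (auto simp: norm_mult heat_nonneg s B B0 abs_mult mult.assoc intro!: mult_mono)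
      qed
    qed measurable
    hence "(LINT p|(lborel \<Otimes>\<^sub>M lborel). ?P p) = (LINT x|lborel. LINT y|lborel. ?P (x, y))"
      by (rule lborel_pair.integral_fst'[symmetric])
    \<comment> \<open>The substitution y = x - s z removes the width from the heat kernel.\<close>
    also have "\<dots> = (LINT x|lborel. h x * G n x)"
    proof (intro Bochner_Integration.integral_cong refl)
      fix x
      have "(LINT y|lborel. ?P (x, y))
         = complex_of_real (s n ^ DIM('a)) * (LINT z|lborel. ?P (x, x - s n *\<^sub>R z))"
        using s by (intro integral_lborel_scale_reflect) simp_all
      also have "\<dots> = (LINT z|lborel. complex_of_real (s n ^ DIM('a)) * ?P (x, x - s n *\<^sub>R z))"
        by simp
      also have "\<dots> = (LINT z|lborel. h x * (cnj (h (x - s n *\<^sub>R z)) * complex_of_real (heat 1 z)))"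
      proof (intro Bochner_Integration.integral_cong refl)
        fix z
        have "x - (x - s n *\<^sub>R z) = s n *\<^sub>R z" by simp
        thus "complex_of_real (s n ^ DIM('a)) * ?P (x, x - s n *\<^sub>R z)
            = h x * (cnj (h (x - s n *\<^sub>R z)) * complex_of_real (heat 1 z))"
          unfolding scale[of n z, symmetric] by (simp only: fst_conv snd_conv mult_ac)
      qed
      also have "\<dots> = h x * G n x" by (simp add: G_def)
      finally show "(LINT y|lborel. ?P (x, y)) = h x * G n x" .
    qed
    finally show ?thesis using heat_pairing[OF i s] by simp
  qed
  have "(\<lambda>n. LINT x|lborel. h x * G n x) \<longlonglongrightarrow> (LINT x|lborel. h x * (cnj (h x) * complex_of_real ((2 * pi) ^ DIM('a))))"
  proof (rule integral_dominated_convergence)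
    show "integrable lborel (\<lambda>x. norm (h x) * (B * (2 * pi) ^ DIM('a)))" using i by simp
    show "AE x in lborel. (\<lambda>n. h x * G n x) \<longlonglongrightarrow> h x * (cnj (h x) * complex_of_real ((2 * pi) ^ DIM('a)))"
      by (intro always_eventually allI tendsto_mult tendsto_const Glim)
    show "AE x in lborel. norm (h x * G n x) \<le> norm (h x) * (B * (2 * pi) ^ DIM('a))" for n
      using Gle by (auto simp: norm_mult intro!: mult_left_mono)
  qed measurable
  also have "(LINT x|lborel. h x * (cnj (h x) * complex_of_real ((2 * pi) ^ DIM('a))))
      = complex_of_real ((2 * pi) ^ DIM('a) * energy lborel h)"
  proof -
    have "(LINT x|lborel. h x * (cnj (h x) * complex_of_real ((2 * pi) ^ DIM('a))))
       = (LINT x|lborel. complex_of_real ((2 * pi) ^ DIM('a) * (norm (h x))\<^sup>2))"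
      by (intro Bochner_Integration.integral_cong refl)
        (simp only: of_real_mult complex_norm_square mult_ac)
    thus ?thesis by (simp only: integral_complex_of_real) (simp add: energy_def)
  qed
  finally have "(\<lambda>n. LINT \<xi>|lborel. gauss (s n) \<xi> * (norm (fourier h \<xi>))\<^sup>2) \<longlonglongrightarrow> (2 * pi) ^ DIM('a) * energy lborel h"
    by (simp only: pair[symmetric] tendsto_of_real_iff)
  moreover have "(LINT \<xi>|lborel. gauss (s n) \<xi> * (norm (fourier h \<xi>))\<^sup>2) \<le> energy lborel (fourier h)" for n
    unfolding energy_def
  proof (rule integral_mono')
    show "integrable lborel (\<lambda>\<xi>. (norm (fourier h \<xi>))\<^sup>2)" using f by (simp add: square_integrable_def)
    show "gauss (s n) \<xi> * (norm (fourier h \<xi>))\<^sup>2 \<le> (norm (fourier h \<xi>))\<^sup>2" for \<xi>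
      by (intro mult_left_le_one_le gauss_le_1 less_imp_le[OF gauss_pos]) simp
  qed simp
  ultimately show ?thesis by (intro LIMSEQ_le_const2) auto
qed

section \<open>Convolutions as Fourier multipliers\<close>

lemma AE_lborel_reflect:
  assumes "AE x in (lborel :: 'a::euclidean_space measure). P x"
  shows "AE y in lborel. P (x - y)"
proof -
  obtain N where N: "{x. \<not> P x} \<subseteq> N" "N \<in> sets (lborel :: 'a measure)" "emeasure lborel N = 0"
    using AE_E[OF assms] by auto
  have "AE x in (lborel :: 'a measure). x \<notin> N"
    using N by (intro AE_not_in) (auto simp: null_sets_def)
  hence "AE x' in distr lborel borel (\<lambda>y. x - y). x' \<notin> N"
    by (subst lborel_distr_reflect)
  hence "AE y in lborel. x - y \<notin> N"
    by (subst (asm) AE_distr_iff) (use N(2) in auto)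
  thus ?thesis by eventually_elim (use N(1) in auto)
qed

abbreviation conv :: "('a::euclidean_space \<Rightarrow> complex) \<Rightarrow> ('a \<Rightarrow> complex) \<Rightarrow> 'a \<Rightarrow> complex" where
  "conv k f \<equiv> \<lambda>x. LINT y|lborel. k (x - y) * f y"

text \<open>
  The properties shared by all truncated kernels. Continuity almost everywhere makes the convolution
  with an integrable function continuous, so that \<open>energy_le_fourier\<close> applies to it.
\<close>

definition nice_kernel :: "('a::euclidean_space \<Rightarrow> complex) \<Rightarrow> bool" where
  "nice_kernel k \<longleftrightarrow> k \<in> borel_measurable borel \<and> (\<exists>B. \<forall>x. norm (k x) \<le> B)
     \<and> (\<exists>R. \<forall>x. R < norm x \<longrightarrow> k x = 0) \<and> (AE x in lborel. isCont k x)"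

lemma nice_kernelE:
  assumes "nice_kernel k"
  obtains B R where "0 \<le> B" "\<And>x. norm (k x) \<le> B" "\<And>x. norm (k x) \<le> B * indicator (cball 0 R) x"
proof -
  from assms obtain B R where B: "\<And>x. norm (k x) \<le> B" and R: "\<And>x. R < norm x \<Longrightarrow> k x = 0"
    unfolding nice_kernel_def by blast
  have "0 \<le> B" using B[of 0] norm_ge_zero order_trans by blast
  moreover have "norm (k x) \<le> B * indicator (cball 0 R) x" for x
    using B[of x] R[of x] by (auto simp: indicator_def not_le)
  ultimately show thesis using B that by blast
qed

lemma nice_kernel_measurable: "nice_kernel k \<Longrightarrow> k \<in> borel_measurable borel"
  by (simp add: nice_kernel_def)

lemma nice_kernel_integrable:
  assumes "nice_kernel k" shows "integrable lborel k"
proof -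
  obtain B R where "0 \<le> B" "\<And>x. norm (k x) \<le> B * indicator (cball 0 R) x"
    by (rule nice_kernelE[OF assms]) blast
  moreover have "integrable lborel (\<lambda>x::'a. B * indicator (cball 0 R) x)"
    using emeasure_bounded_finite[OF bounded_cball, of "0::'a" R]
    by (intro integrable_mult_right integrable_real_indicator) auto
  ultimately show ?thesis
    using nice_kernel_measurable[OF assms]
    by (elim Bochner_Integration.integrable_bound) auto
qed

lemma nice_kernel_diff:
  assumes "nice_kernel k" "nice_kernel l"
  shows "nice_kernel (\<lambda>x. k x - l x)"
proof -
  from assms obtain B R where 1: "\<And>x. norm (k x) \<le> B" "\<And>x. R < norm x \<Longrightarrow> k x = 0"
    unfolding nice_kernel_def by blast
  from assms obtain B' R' where 2: "\<And>x. norm (l x) \<le> B'" "\<And>x. R' < norm x \<Longrightarrow> l x = 0"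
    unfolding nice_kernel_def by blast
  have "norm (k x - l x) \<le> B + B'" for x
    using norm_triangle_ineq4[of "k x" "l x"] 1(1)[of x] 2(1)[of x] by linarith
  moreover have "\<forall>x. max R R' < norm x \<longrightarrow> k x - l x = 0" using 1 2 by auto
  moreover have "AE x in lborel. isCont (\<lambda>x. k x - l x) x"
    using assms unfolding nice_kernel_def by (auto intro: isCont_diff)
  moreover have "(\<lambda>x. k x - l x) \<in> borel_measurable borel"
    using assms by (intro borel_measurable_diff nice_kernel_measurable)
  ultimately show ?thesis unfolding nice_kernel_def by (intro conjI exI[of _ "B + B'"] exI[of _ "max R R'"]) auto
qed

lemma conv_pair_integrable:
  fixes k f :: "'a::euclidean_space \<Rightarrow> complex"
  assumes k: "integrable lborel k" and f: "integrable lborel f"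
  shows "integrable (lborel \<Otimes>\<^sub>M lborel) (\<lambda>(y, x). k (x - y) * f y)"
proof (rule lborel_pair.Fubini_integrable)
  have [measurable]: "k \<in> borel_measurable borel" "f \<in> borel_measurable borel"
    using k f by (auto dest: borel_measurable_integrable)
  show "(\<lambda>(y, x). k (x - y) * f y) \<in> borel_measurable (lborel \<Otimes>\<^sub>M lborel)" by measurable
  have shift: "(LINT x|lborel. norm (k (x - y))) = (LINT x|lborel. norm (k x))" for y
    using integral_lborel_reflect[of "\<lambda>x. norm (k (- x))" y]
      integral_lborel_reflect[of "\<lambda>x. norm (k x)" 0] by simp
  have "integrable lborel (\<lambda>y. norm (f y) * (LINT x|lborel. norm (k x)))" using f by simp
  thus "integrable lborel (\<lambda>y. LINT x|lborel. norm (case (y, x) of (y, x) \<Rightarrow> k (x - y) * f y))"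
    by (simp add: norm_mult shift mult.commute)
  have "integrable lborel (\<lambda>x. k (- (y - x)))" for y
    using integrable_lborel_reflect[OF integrable_lborel_reflect[OF k, of 0], of y] by simp
  thus "AE y in lborel. integrable lborel (\<lambda>x. case (y, x) of (y, x) \<Rightarrow> k (x - y) * f y)"
    by simp
qed

lemma conv_integrable:
  fixes k f :: "'a::euclidean_space \<Rightarrow> complex"
  assumes "integrable lborel k" "integrable lborel f"
  shows "integrable lborel (conv k f)"
  using lborel_pair.integrable_snd[OF conv_pair_integrable[OF assms]] by simp

lemma fourier_conv:
  fixes k f :: "'a::euclidean_space \<Rightarrow> complex"
  assumes k: "integrable lborel k" and f: "integrable lborel f"
  shows "fourier (conv k f) \<xi> = fourier k \<xi> * fourier f \<xi>"
proof -
  have [measurable]: "k \<in> borel_measurable borel" "f \<in> borel_measurable borel"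
    using k f by (auto dest: borel_measurable_integrable)
  have int: "integrable (lborel \<Otimes>\<^sub>M lborel) (\<lambda>(y, x). cis (- (x \<bullet> \<xi>)) * (k (x - y) * f y))"
    by (rule Bochner_Integration.integrable_bound[OF conv_pair_integrable[OF k f]])
      (auto simp: norm_mult)
  have "fourier (conv k f) \<xi> = (LINT x|lborel. LINT y|lborel. cis (- (x \<bullet> \<xi>)) * (k (x - y) * f y))"
    unfolding fourier_def integral_mult_right_zero ..
  also have "\<dots> = (LINT y|lborel. LINT x|lborel. cis (- (x \<bullet> \<xi>)) * (k (x - y) * f y))"
    by (rule lborel_pair.Fubini_integral[OF int])
  also have "\<dots> = (LINT y|lborel. fourier k \<xi> * (cis (- (y \<bullet> \<xi>)) * f y))"
  proof (intro Bochner_Integration.integral_cong refl)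
    fix y
    have "(LINT x|lborel. cis (- (x \<bullet> \<xi>)) * (k (x - y) * f y))
       = (LINT x|distr lborel borel ((+) y). cis (- (x \<bullet> \<xi>)) * (k (x - y) * f y))"
      by (simp add: lborel_distr_plus)
    also have "\<dots> = (LINT x|lborel. cis (- ((y + x) \<bullet> \<xi>)) * (k (y + x - y) * f y))"
      by (subst integral_distr) auto
    also have "\<dots> = (LINT x|lborel. (cis (- (x \<bullet> \<xi>)) * k x) * (cis (- (y \<bullet> \<xi>)) * f y))"
    proof (intro Bochner_Integration.integral_cong refl)
      fix x
      have "cis (- ((y + x) \<bullet> \<xi>)) = cis (- (x \<bullet> \<xi>)) * cis (- (y \<bullet> \<xi>))"
        by (simp add: cis_mult inner_add_left add.commute)
      thus "cis (- ((y + x) \<bullet> \<xi>)) * (k (y + x - y) * f y) = (cis (- (x \<bullet> \<xi>)) * k x) * (cis (- (y \<bullet> \<xi>)) * f y)"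
        by simp
    qed
    also have "\<dots> = fourier k \<xi> * (cis (- (y \<bullet> \<xi>)) * f y)"
      unfolding fourier_def by (rule integral_mult_left_zero)
    finally show "(LINT x|lborel. cis (- (x \<bullet> \<xi>)) * (k (x - y) * f y)) = fourier k \<xi> * (cis (- (y \<bullet> \<xi>)) * f y)" .
  qed
  also have "\<dots> = fourier k \<xi> * fourier f \<xi>"
    unfolding fourier_def by (rule integral_mult_right_zero)
  finally show ?thesis .
qed

lemma conv_continuous:
  fixes k f :: "'a::euclidean_space \<Rightarrow> complex"
  assumes k: "nice_kernel k" and f: "integrable lborel f"
  shows "continuous_on UNIV (conv k f)"
proof -
  have [measurable]: "k \<in> borel_measurable borel" "f \<in> borel_measurable borel"
    using nice_kernel_measurable[OF k] f by (auto dest: borel_measurable_integrable)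
  obtain B where B: "0 \<le> B" "\<And>x. norm (k x) \<le> B"
    by (rule nice_kernelE[OF k]) blast
  note B' = B(2)
  have "isCont (conv k f) x" for x
    unfolding continuous_at_sequentially comp_def
  proof (intro allI impI)
    fix u :: "nat \<Rightarrow> 'a" assume u: "u \<longlonglongrightarrow> x"
    show "(\<lambda>n. conv k f (u n)) \<longlonglongrightarrow> conv k f x"
    proof (rule integral_dominated_convergence)
      show "integrable lborel (\<lambda>y. B * norm (f y))" using f by simp
      have "AE y in lborel. isCont k (x - y)"
        using k by (intro AE_lborel_reflect) (simp add: nice_kernel_def)
      thus "AE y in lborel. (\<lambda>n. k (u n - y) * f y) \<longlonglongrightarrow> k (x - y) * f y"
      proof eventually_elim
        fix y assume "isCont k (x - y)"
        moreover have "(\<lambda>n. u n - y) \<longlonglongrightarrow> x - y" using u by (intro tendsto_intros)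
        ultimately have "(\<lambda>n. k (u n - y)) \<longlonglongrightarrow> k (x - y)" by (rule isCont_tendsto_compose)
        thus "(\<lambda>n. k (u n - y) * f y) \<longlonglongrightarrow> k (x - y) * f y" by (intro tendsto_intros)
      qed
      show "AE y in lborel. norm (k (u n - y) * f y) \<le> B * norm (f y)" for n
        using B' by (auto simp: norm_mult intro!: mult_right_mono)
    qed measurable
  qed
  thus ?thesis by (simp add: continuous_at_imp_continuous_on)
qed

lemma conv_energy_fourier:
  fixes f :: "'a::euclidean_space \<Rightarrow> complex"
  assumes k: "nice_kernel k" and i: "integrable lborel f" and f: "square_integrable lborel f"
  shows "square_integrable lborel (conv k f)"
    and "integrable lborel (\<lambda>\<xi>. (norm (fourier k \<xi>))\<^sup>2 * (norm (fourier f \<xi>))\<^sup>2)"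
    and "(2 * pi) ^ DIM('a) * energy lborel (conv k f)
           \<le> (LINT \<xi>|lborel. (norm (fourier k \<xi>))\<^sup>2 * (norm (fourier f \<xi>))\<^sup>2)"
proof -
  have [measurable]: "k \<in> borel_measurable borel" "f \<in> borel_measurable borel"
    using nice_kernel_measurable[OF k] i by (auto dest: borel_measurable_integrable)
  have ki: "integrable lborel k" by (rule nice_kernel_integrable[OF k])
  have ci: "integrable lborel (conv k f)" by (rule conv_integrable[OF ki i])
  obtain B where B: "0 \<le> B" "\<And>x. norm (k x) \<le> B"
    by (rule nice_kernelE[OF k]) blast
  note B' = B(2)
  define D where "D = B * (LINT y|lborel. norm (f y))"
  have D: "norm (conv k f x) \<le> D" for x
  proof -
    have "norm (conv k f x) \<le> (LINT y|lborel. norm (k (x - y) * f y))" by (rule integral_norm_bound)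
    also have "\<dots> \<le> (LINT y|lborel. B * norm (f y))"
      using i B(1) B' by (intro integral_mono') (auto simp: norm_mult intro!: mult_right_mono)
    finally show ?thesis by (simp add: D_def)
  qed
  show 1: "square_integrable lborel (conv k f)"
    unfolding square_integrable_def
  proof
    show "integrable lborel (\<lambda>x. (norm (conv k f x))\<^sup>2)"
    proof (rule Bochner_Integration.integrable_bound)
      show "integrable lborel (\<lambda>x. D * norm (conv k f x))" using ci by simp
      show "AE x in lborel. norm ((norm (conv k f x))\<^sup>2) \<le> norm (D * norm (conv k f x))"
      proof (intro always_eventually allI)
        fix x
        have "norm (conv k f x) * norm (conv k f x) \<le> D * norm (conv k f x)"
          using D[of x] by (rule mult_right_mono) simp
        thus "norm ((norm (conv k f x))\<^sup>2) \<le> norm (D * norm (conv k f x))"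
          by (simp add: power2_eq_square)
      qed
    qed measurable
  qed simp
  define M where "M = (LINT x|lborel. norm (k x))"
  show 2: "integrable lborel (\<lambda>\<xi>. (norm (fourier k \<xi>))\<^sup>2 * (norm (fourier f \<xi>))\<^sup>2)"
  proof (rule Bochner_Integration.integrable_bound)
    show "integrable lborel (\<lambda>\<xi>. M\<^sup>2 * (norm (fourier f \<xi>))\<^sup>2)"
      using fourier_bounded_energy(1)[OF i f] by (simp add: square_integrable_def)
    show "AE \<xi> in lborel. norm ((norm (fourier k \<xi>))\<^sup>2 * (norm (fourier f \<xi>))\<^sup>2) \<le> norm (M\<^sup>2 * (norm (fourier f \<xi>))\<^sup>2)"
      using norm_fourier_le[OF ki] by (auto simp: M_def intro!: mult_right_mono power_mono)
  qed measurable
  have eq: "(norm (fourier (conv k f) \<xi>))\<^sup>2 = (norm (fourier k \<xi>))\<^sup>2 * (norm (fourier f \<xi>))\<^sup>2" for \<xi>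
    by (simp add: fourier_conv[OF ki i] norm_mult power_mult_distrib)
  have "square_integrable lborel (fourier (conv k f))"
    unfolding square_integrable_def using 2 by (simp add: eq)
  from energy_le_fourier[OF ci conv_continuous[OF k i] D this]
  show "(2 * pi) ^ DIM('a) * energy lborel (conv k f)
           \<le> (LINT \<xi>|lborel. (norm (fourier k \<xi>))\<^sup>2 * (norm (fourier f \<xi>))\<^sup>2)"
    by (simp add: energy_def eq)
qed

lemma conv_energy_bounded_L1:
  fixes f :: "'a::euclidean_space \<Rightarrow> complex"
  assumes k: "nice_kernel k" and i: "integrable lborel f" and f: "square_integrable lborel f"
    and A: "AE \<xi> in lborel. norm (fourier k \<xi>) \<le> A"
  shows "energy lborel (conv k f) \<le> A\<^sup>2 * energy lborel f"
proof -
  have fi: "integrable lborel (\<lambda>\<xi>. (norm (fourier f \<xi>))\<^sup>2)"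
    using fourier_bounded_energy(1)[OF i f] by (simp add: square_integrable_def)
  have "(2 * pi) ^ DIM('a) * energy lborel (conv k f)
      \<le> (LINT \<xi>|lborel. (norm (fourier k \<xi>))\<^sup>2 * (norm (fourier f \<xi>))\<^sup>2)"
    by (rule conv_energy_fourier(3)[OF k i f])
  also have "\<dots> \<le> (LINT \<xi>|lborel. A\<^sup>2 * (norm (fourier f \<xi>))\<^sup>2)"
  proof (rule integral_mono_AE)
    show "AE \<xi> in lborel. (norm (fourier k \<xi>))\<^sup>2 * (norm (fourier f \<xi>))\<^sup>2 \<le> A\<^sup>2 * (norm (fourier f \<xi>))\<^sup>2"
      using A by eventually_elim (auto intro!: mult_right_mono power_mono)
  qed (use conv_energy_fourier(2)[OF k i f] fi in auto)
  also have "\<dots> = A\<^sup>2 * energy lborel (fourier f)" by (simp add: energy_def)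
  also have "\<dots> \<le> A\<^sup>2 * ((2 * pi) ^ DIM('a) * energy lborel f)"
    by (intro mult_left_mono fourier_bounded_energy(2)[OF i f]) simp
  finally have "(2 * pi) ^ DIM('a) * energy lborel (conv k f) \<le> (2 * pi) ^ DIM('a) * (A\<^sup>2 * energy lborel f)"
    by (simp only: mult_ac)
  thus ?thesis by (rule mult_left_le_imp_le) simp
qed

definition cutoff :: "real \<Rightarrow> ('a::euclidean_space \<Rightarrow> complex) \<Rightarrow> 'a \<Rightarrow> complex" where
  "cutoff R f x = indicator (cball 0 R) x * f x"

lemma cutoff_measurable [measurable]:
  "f \<in> borel_measurable borel \<Longrightarrow> cutoff R f \<in> borel_measurable borel"
  unfolding cutoff_def[abs_def] by (intro borel_measurable_times borel_measurable_indicator) auto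

lemma norm_le_one_plus_sq: "t \<le> 1 + t\<^sup>2" for t :: real
  using sum_squares_bound[of t 1] zero_le_power2[of t] by (simp; smt (verit))

lemma cutoff_integrable:
  fixes f :: "'a::euclidean_space \<Rightarrow> complex"
  assumes "square_integrable lborel f"
  shows "square_integrable lborel (cutoff R f)" and "integrable lborel (cutoff R f)"
    and "energy lborel (cutoff R f) \<le> energy lborel f"
proof -
  have [measurable]: "f \<in> borel_measurable borel" and fi: "integrable lborel (\<lambda>x. (norm (f x))\<^sup>2)"
    using assms by (auto simp: square_integrable_def)
  have le: "(norm (cutoff R f x))\<^sup>2 \<le> (norm (f x))\<^sup>2" for x
    by (auto simp: cutoff_def indicator_def)
  have i2: "integrable lborel (\<lambda>x. (norm (cutoff R f x))\<^sup>2)"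
    by (rule Bochner_Integration.integrable_bound[OF fi]) (auto simp: le)
  thus "square_integrable lborel (cutoff R f)" by (simp add: square_integrable_def)
  show "energy lborel (cutoff R f) \<le> energy lborel f"
    unfolding energy_def using i2 fi le by (intro integral_mono) auto
  show "integrable lborel (cutoff R f)"
  proof (rule Bochner_Integration.integrable_bound)
    show "integrable lborel (\<lambda>x::'a. indicator (cball 0 R) x + (norm (f x))\<^sup>2)"
      using emeasure_bounded_finite[OF bounded_cball, of "0::'a" R] fi
      by (intro Bochner_Integration.integrable_add integrable_real_indicator) auto
    show "AE x in lborel. norm (cutoff R f x) \<le> norm (indicator (cball 0 R) x + (norm (f x))\<^sup>2)"
      using norm_le_one_plus_sq[of "norm (f _)"] by (auto simp: cutoff_def indicator_def)
  qed measurable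
qed

lemma cutoff_tendsto:
  fixes f :: "'a::euclidean_space \<Rightarrow> complex"
  assumes "square_integrable lborel f"
  shows "(\<lambda>n. energy lborel (\<lambda>x. f x - cutoff (real n) f x)) \<longlonglongrightarrow> 0"
proof -
  have [measurable]: "f \<in> borel_measurable borel" and fi: "integrable lborel (\<lambda>x. (norm (f x))\<^sup>2)"
    using assms by (auto simp: square_integrable_def)
  have "(\<lambda>n. energy lborel (\<lambda>x. f x - cutoff (real n) f x)) \<longlonglongrightarrow> (LINT x|(lborel :: 'a measure). 0)"
    unfolding energy_def
  proof (rule integral_dominated_convergence[OF _ _ fi])
    show "AE x in lborel. (\<lambda>n. (norm (f x - cutoff (real n) f x))\<^sup>2) \<longlonglongrightarrow> 0"
    proof (intro always_eventually allI)
      fix x :: 'a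
      obtain N where "norm x \<le> real N" using real_arch_simple by blast
      hence "(norm (f x - cutoff (real n) f x))\<^sup>2 = 0" if "n \<ge> N" for n
        using that by (auto simp: cutoff_def indicator_def)
      hence "\<forall>\<^sub>F n in sequentially. (norm (f x - cutoff (real n) f x))\<^sup>2 = 0"
        unfolding eventually_sequentially by blast
      thus "(\<lambda>n. (norm (f x - cutoff (real n) f x))\<^sup>2) \<longlonglongrightarrow> 0"
        by (rule tendsto_eventually)
    qed
    show "AE x in lborel. norm ((norm (f x - cutoff (real n) f x))\<^sup>2) \<le> (norm (f x))\<^sup>2" for n
      by (auto simp: cutoff_def indicator_def)
  qed measurable
  thus ?thesis by simp
qed

lemma conv_integrand_integrable:
  fixes f :: "'a::euclidean_space \<Rightarrow> complex"
  assumes k: "nice_kernel k" and f: "square_integrable lborel f"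
  shows "integrable lborel (\<lambda>y. k (x - y) * f y)"
proof -
  have [measurable]: "k \<in> borel_measurable borel" "f \<in> borel_measurable borel"
    and fi: "integrable lborel (\<lambda>x. (norm (f x))\<^sup>2)"
    using nice_kernel_measurable[OF k] f by (auto simp: square_integrable_def)
  obtain B R where B: "0 \<le> B" "\<And>x. norm (k x) \<le> B * indicator (cball 0 R) x"
    by (rule nice_kernelE[OF k]) blast
  have "integrable lborel (\<lambda>y::'a. indicator (cball 0 R) (x - y) :: real)"
    using emeasure_bounded_finite[OF bounded_cball, of "0::'a" R]
    by (intro integrable_lborel_reflect integrable_real_indicator) auto
  hence "integrable lborel (\<lambda>y. B * (indicator (cball 0 R) (x - y) + (norm (f y))\<^sup>2))"
    using fi by simp
  thus ?thesis
  proof (rule Bochner_Integration.integrable_bound)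
    show "AE y in lborel. norm (k (x - y) * f y) \<le> norm (B * (indicator (cball 0 R) (x - y) + (norm (f y))\<^sup>2))"
    proof (intro always_eventually allI)
      fix y
      have "norm (k (x - y) * f y) \<le> (B * indicator (cball 0 R) (x - y)) * norm (f y)"
        unfolding norm_mult by (intro mult_right_mono B) simp
      also have "\<dots> = B * (indicator (cball 0 R) (x - y) * norm (f y))" by simp
      also have "\<dots> \<le> B * (indicator (cball 0 R) (x - y) + (norm (f y))\<^sup>2)"
        using norm_le_one_plus_sq[of "norm (f y)"] B(1)
        by (intro mult_left_mono) (auto simp: indicator_def)
      also have "\<dots> \<le> norm (B * (indicator (cball 0 R) (x - y) + (norm (f y))\<^sup>2))" by simp
      finally show "norm (k (x - y) * f y) \<le> norm (B * (indicator (cball 0 R) (x - y) + (norm (f y))\<^sup>2))" .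
    qed
  qed measurable
qed

text \<open>
  A kernel of bounded support sees only a bounded part of \<open>f\<close> near any point, so the convolutions with the
  cut off functions are eventually constant at each point and Fatou's lemma applies.
\<close>

lemma conv_energy_bounded:
  fixes f :: "'a::euclidean_space \<Rightarrow> complex"
  assumes k: "nice_kernel k" and f: "square_integrable lborel f"
    and A: "AE \<xi> in lborel. norm (fourier k \<xi>) \<le> A"
  shows "square_integrable lborel (conv k f)" and "energy lborel (conv k f) \<le> A\<^sup>2 * energy lborel f"
proof -
  have [measurable]: "k \<in> borel_measurable borel" "f \<in> borel_measurable borel"
    using nice_kernel_measurable[OF k] f by (auto simp: square_integrable_def)
  obtain B R where B: "0 \<le> B" "\<And>x. norm (k x) \<le> B * indicator (cball 0 R) x"
    by (rule nice_kernelE[OF k]) blast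
  define g where "g n x = (norm (conv k (cutoff (real n) f) x))\<^sup>2" for n x
  have gi: "integrable lborel (g n)" for n
    using conv_energy_fourier(1)[OF k cutoff_integrable(2,1)[OF f]]
    by (simp add: square_integrable_def g_def[abs_def])
  have gb: "(LINT x|lborel. g n x) \<le> A\<^sup>2 * energy lborel f" for n
  proof -
    have "(LINT x|lborel. g n x) = energy lborel (conv k (cutoff (real n) f))"
      by (simp add: g_def energy_def)
    also have "\<dots> \<le> A\<^sup>2 * energy lborel (cutoff (real n) f)"
      by (rule conv_energy_bounded_L1[OF k cutoff_integrable(2,1)[OF f] A])
    also have "\<dots> \<le> A\<^sup>2 * energy lborel f"
      by (intro mult_left_mono cutoff_integrable(3) f) simp
    finally show ?thesis .
  qed
  have eq: "conv k (cutoff (real n) f) x = conv k f x" if n: "real n \<ge> norm x + R" for n x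
  proof (intro Bochner_Integration.integral_cong refl)
    fix y
    show "k (x - y) * cutoff (real n) f y = k (x - y) * f y"
    proof (cases "norm (x - y) \<le> R")
      case True
      hence "norm y \<le> real n" using n norm_triangle_ineq3[of x y] by linarith
      thus ?thesis by (simp add: cutoff_def)
    next
      case False
      hence "k (x - y) = 0" using B(2)[of "x - y"] by (simp add: indicator_def)
      thus ?thesis by simp
    qed
  qed
  have lim: "AE x in lborel. (\<lambda>n. g n x) \<longlonglongrightarrow> (norm (conv k f x))\<^sup>2"
  proof (intro always_eventually allI)
    fix x :: 'a
    obtain N where N: "norm x + R \<le> real N" using real_arch_simple by blast
    have "\<forall>\<^sub>F n in sequentially. g n x = (norm (conv k f x))\<^sup>2"
      unfolding eventually_sequentially
    proof (intro exI[of _ N] allI impI)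
      fix n assume "N \<le> n"
      hence "norm x + R \<le> real n" using N by linarith
      thus "g n x = (norm (conv k f x))\<^sup>2" unfolding g_def by (simp only: eq)
    qed
    thus "(\<lambda>n. g n x) \<longlonglongrightarrow> (norm (conv k f x))\<^sup>2" by (rule tendsto_eventually)
  qed
  have g0: "0 \<le> g n x" for n x by (simp add: g_def)
  have m: "(\<lambda>x. (norm (conv k f x))\<^sup>2) \<in> borel_measurable lborel" by simp
  note F = Fatou_bounded_integrals[OF gi g0 m lim gb]
  show "square_integrable lborel (conv k f)" using F(1) by (simp add: square_integrable_def)
  show "energy lborel (conv k f) \<le> A\<^sup>2 * energy lborel f" using F(2) by (simp add: energy_def)
qed

text \<open>
  Up to an error that the common bound on the multipliers controls, \<open>f\<close> may be replaced by a cut off \<open>c\<close>,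
  which is integrable and hence has a Fourier transform. For \<open>c\<close> the difference of two convolutions has energy at
  most \<open>\<integral> |k\<^sub>i\<^sup>^ - k\<^sub>j\<^sup>^|\<^sup>2 |c\<^sup>^|\<^sup>2\<close>, which tends to \<open>0\<close> by dominated convergence.
\<close>

theorem convolution_sequence_converges:
  fixes f :: "'a::euclidean_space \<Rightarrow> complex"
  assumes k: "\<And>n. nice_kernel (K n)"
    and A: "\<And>n. AE \<xi> in lborel. norm (fourier (K n) \<xi>) \<le> A"
    and lim: "AE \<xi> in lborel. convergent (\<lambda>n. fourier (K n) \<xi>)"
    and f: "square_integrable lborel f"
  obtains g where "square_integrable lborel g"
    "(\<lambda>n. energy lborel (\<lambda>x. conv (K n) f x - g x)) \<longlonglongrightarrow> 0"
    "energy lborel g \<le> A\<^sup>2 * energy lborel f"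
proof -
  have [measurable]: "K n \<in> borel_measurable borel" "f \<in> borel_measurable borel" for n
    using nice_kernel_measurable[OF k] f by (auto simp: square_integrable_def)
  define m where "m \<xi> = Topological_Spaces.lim (\<lambda>n. fourier (K n) \<xi>)" for \<xi>
  have [measurable]: "m \<in> borel_measurable borel" unfolding m_def by measurable
  have mlim: "AE \<xi> in lborel. (\<lambda>n. fourier (K n) \<xi>) \<longlonglongrightarrow> m \<xi>"
    using lim by eventually_elim (simp add: m_def convergent_LIMSEQ_iff)
  have all: "AE \<xi> in lborel. \<forall>n. norm (fourier (K n) \<xi>) \<le> A"
    using A by (simp add: AE_all_countable)
  have mA: "AE \<xi> in lborel. norm (m \<xi>) \<le> A"
    using mlim all
  proof eventually_elim
    fix \<xi> assume l: "(\<lambda>n. fourier (K n) \<xi>) \<longlonglongrightarrow> m \<xi>" and a: "\<forall>n. norm (fourier (K n) \<xi>) \<le> A"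
    show "norm (m \<xi>) \<le> A" by (rule LIMSEQ_le_const2[OF tendsto_norm[OF l]]) (use a in auto)
  qed
  have sq: "square_integrable lborel (conv (K n) f)" for n by (rule conv_energy_bounded(1)[OF k f A])
  have Cauchy: "\<exists>N. \<forall>i\<ge>N. \<forall>j\<ge>N. energy lborel (\<lambda>x. conv (K i) f x - conv (K j) f x) < e" if e: "0 < e" for e
  proof -
    \<comment> \<open>The two remainders enter with total weight 8 and the factor A^2; adding 1 covers A = 0.\<close>
    define \<delta> where "\<delta> = e / (16 * (A\<^sup>2 + 1))"
    have A1: "0 < A\<^sup>2 + 1" by (simp add: add_nonneg_pos)
    have \<delta>: "0 < \<delta>" unfolding \<delta>_def using e A1 by simp
    obtain R where R: "energy lborel (\<lambda>x. f x - cutoff (real R) f x) < \<delta>"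
      using LIMSEQ_D[OF cutoff_tendsto[OF f] \<delta>] by auto
    define c where "c = cutoff (real R) f"
    define r where "r x = f x - c x" for x
    have c: "square_integrable lborel c" "integrable lborel c"
      unfolding c_def by (rule cutoff_integrable[OF f])+
    have r: "square_integrable lborel r" unfolding r_def by (rule square_integrable_diff[OF f c(1)])
    have rs: "energy lborel r < \<delta>" using R by (simp add: r_def[abs_def] c_def)
    have fc: "integrable lborel (\<lambda>\<xi>. (norm (fourier c \<xi>))\<^sup>2)"
      using fourier_bounded_energy(1)[OF c(2,1)] by (simp add: square_integrable_def)
    have [measurable]: "c \<in> borel_measurable borel" "r \<in> borel_measurable borel"
      using c r by (auto simp: square_integrable_def)
    have dom: "integrable lborel (\<lambda>\<xi>. (2 * A)\<^sup>2 * (norm (fourier c \<xi>))\<^sup>2)" using fc by simp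
    have diffA: "AE \<xi> in lborel. norm ((norm (fourier (K n) \<xi> - m \<xi>))\<^sup>2 * (norm (fourier c \<xi>))\<^sup>2)
        \<le> (2 * A)\<^sup>2 * (norm (fourier c \<xi>))\<^sup>2" for n
      using mA A[of n]
    proof eventually_elim
      fix \<xi> assume "norm (m \<xi>) \<le> A" "norm (fourier (K n) \<xi>) \<le> A"
      hence "norm (fourier (K n) \<xi> - m \<xi>) \<le> 2 * A"
        using norm_triangle_ineq4[of "fourier (K n) \<xi>" "m \<xi>"] by linarith
      hence "(norm (fourier (K n) \<xi> - m \<xi>))\<^sup>2 \<le> (2 * A)\<^sup>2" by (rule power_mono) simp
      thus "norm ((norm (fourier (K n) \<xi> - m \<xi>))\<^sup>2 * (norm (fourier c \<xi>))\<^sup>2)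
        \<le> (2 * A)\<^sup>2 * (norm (fourier c \<xi>))\<^sup>2" by (simp add: mult_right_mono)
    qed
    define a where "a n = (LINT \<xi>|lborel. (norm (fourier (K n) \<xi> - m \<xi>))\<^sup>2 * (norm (fourier c \<xi>))\<^sup>2)" for n
    have ai: "integrable lborel (\<lambda>\<xi>. (norm (fourier (K n) \<xi> - m \<xi>))\<^sup>2 * (norm (fourier c \<xi>))\<^sup>2)" for n
      by (rule Bochner_Integration.integrable_bound[OF dom]) (use diffA[of n] in \<open>auto simp: abs_mult\<close>)
    have "a \<longlonglongrightarrow> (LINT \<xi>|(lborel :: 'a measure). 0)"
      unfolding a_def[abs_def]
    proof (rule integral_dominated_convergence[OF _ _ dom _ diffA])
      show "AE \<xi> in lborel. (\<lambda>n. (norm (fourier (K n) \<xi> - m \<xi>))\<^sup>2 * (norm (fourier c \<xi>))\<^sup>2) \<longlonglongrightarrow> 0"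
        using mlim
      proof eventually_elim
        fix \<xi> :: 'a assume "(\<lambda>n. fourier (K n) \<xi>) \<longlonglongrightarrow> m \<xi>"
        hence "(\<lambda>n. (norm (fourier (K n) \<xi> - m \<xi>))\<^sup>2 * (norm (fourier c \<xi>))\<^sup>2)
            \<longlonglongrightarrow> (norm (m \<xi> - m \<xi>))\<^sup>2 * (norm (fourier c \<xi>))\<^sup>2"
          by (intro tendsto_intros)
        thus "(\<lambda>n. (norm (fourier (K n) \<xi> - m \<xi>))\<^sup>2 * (norm (fourier c \<xi>))\<^sup>2) \<longlonglongrightarrow> 0" by simp
      qed
    qed measurable
    hence "a \<longlonglongrightarrow> 0" by simp
    then obtain N where N: "\<And>n. n \<ge> N \<Longrightarrow> norm (a n - 0) < e / 16"
      using LIMSEQ_D[of a 0 "e / 16"] e by auto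
    define C0 where "C0 = (2 * pi) ^ DIM('a)"
    have C0: "1 \<le> C0" unfolding C0_def using pi_gt3 by (intro one_le_power) linarith
    have "energy lborel (\<lambda>x. conv (K i) f x - conv (K j) f x) < e" if "i \<ge> N" "j \<ge> N" for i j
    proof -
      define d where "d = (\<lambda>x. K i x - K j x)"
      have d: "nice_kernel d" unfolding d_def by (rule nice_kernel_diff[OF k k])
      have fd: "fourier d \<xi> = fourier (K i) \<xi> - fourier (K j) \<xi>" for \<xi>
        unfolding fourier_def d_def right_diff_distrib
        by (intro Bochner_Integration.integral_diff integrable_cis_mult nice_kernel_integrable k)
      have dec: "conv (K i) f x - conv (K j) f x = conv d c x + (conv (K i) r x - conv (K j) r x)" for x
      proof -
        have *: "conv (K n) f x = conv (K n) c x + conv (K n) r x" for n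
        proof -
          have "conv (K n) f x = (LINT y|lborel. K n (x - y) * c y + K n (x - y) * r y)"
            by (simp add: r_def algebra_simps)
          also have "\<dots> = conv (K n) c x + conv (K n) r x"
            by (intro Bochner_Integration.integral_add conv_integrand_integrable k c r)
          finally show ?thesis .
        qed
        have "conv d c x = conv (K i) c x - conv (K j) c x"
          unfolding d_def left_diff_distrib
          by (intro Bochner_Integration.integral_diff conv_integrand_integrable k c)
        thus ?thesis by (simp add: *)
      qed
      have s1: "square_integrable lborel (conv d c)" by (rule conv_energy_fourier(1)[OF d c(2,1)])
      have s2: "square_integrable lborel (conv (K n) r)" for n by (rule conv_energy_bounded(1)[OF k r A])
      have "C0 * energy lborel (conv d c) \<le> (LINT \<xi>|lborel. (norm (fourier d \<xi>))\<^sup>2 * (norm (fourier c \<xi>))\<^sup>2)"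
        unfolding C0_def by (rule conv_energy_fourier(3)[OF d c(2,1)])
      also have "\<dots> \<le> (LINT \<xi>|lborel. 2 * ((norm (fourier (K i) \<xi> - m \<xi>))\<^sup>2 * (norm (fourier c \<xi>))\<^sup>2)
          + 2 * ((norm (fourier (K j) \<xi> - m \<xi>))\<^sup>2 * (norm (fourier c \<xi>))\<^sup>2))"
      proof (rule integral_mono)
        show "integrable lborel (\<lambda>\<xi>. (norm (fourier d \<xi>))\<^sup>2 * (norm (fourier c \<xi>))\<^sup>2)"
          by (rule conv_energy_fourier(2)[OF d c(2,1)])
        show "(norm (fourier d \<xi>))\<^sup>2 * (norm (fourier c \<xi>))\<^sup>2
            \<le> 2 * ((norm (fourier (K i) \<xi> - m \<xi>))\<^sup>2 * (norm (fourier c \<xi>))\<^sup>2)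
              + 2 * ((norm (fourier (K j) \<xi> - m \<xi>))\<^sup>2 * (norm (fourier c \<xi>))\<^sup>2)" for \<xi>
        proof -
          have "(norm (fourier d \<xi>))\<^sup>2 \<le> 2 * (norm (fourier (K i) \<xi> - m \<xi>))\<^sup>2 + 2 * (norm (fourier (K j) \<xi> - m \<xi>))\<^sup>2"
            using norm_add_sq_le[of 1 "fourier (K i) \<xi> - m \<xi>" "m \<xi> - fourier (K j) \<xi>"]
            by (simp add: fd norm_minus_commute)
          from mult_right_mono[OF this, of "(norm (fourier c \<xi>))\<^sup>2"]
          show ?thesis by (simp add: algebra_simps)
        qed
      qed (use ai in simp)
      also have "\<dots> = 2 * a i + 2 * a j" using ai by (simp add: a_def)
      also have "\<dots> < e / 4" using N[OF that(1)] N[OF that(2)] by simp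
      finally have "C0 * energy lborel (conv d c) < e / 4" .
      moreover have "energy lborel (conv d c) \<le> C0 * energy lborel (conv d c)"
        using mult_right_mono[OF C0 energy_nonneg[of lborel "conv d c"]] by simp
      ultimately have e1: "energy lborel (conv d c) < e / 4" by linarith
      have rn: "energy lborel (conv (K n) r) \<le> e / 16" for n
      proof -
        have "energy lborel (conv (K n) r) \<le> A\<^sup>2 * energy lborel r" by (rule conv_energy_bounded(2)[OF k r A])
        also have "\<dots> \<le> (A\<^sup>2 + 1) * \<delta>" using rs by (intro mult_mono) auto
        also have "\<dots> = e / 16"
        proof -
          have "b * (e / (16 * b)) = e / 16" if "0 < b" for b :: real using that by simp
          from this[OF A1] show ?thesis unfolding \<delta>_def .
        qed
        finally show ?thesis .
      qed
      have s2': "square_integrable lborel (\<lambda>x. - 1 * conv (K j) r x)" by (rule square_integrable_scale[OF s2])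
      have "energy lborel (\<lambda>x. conv (K i) r x - conv (K j) r x) \<le> 2 * energy lborel (conv (K i) r) + 2 * energy lborel (conv (K j) r)"
        using energy_add_le[OF s2[of i] s2', of 1] by (simp add: energy_def)
      hence e2: "energy lborel (\<lambda>x. conv (K i) r x - conv (K j) r x) \<le> e / 4" using rn[of i] rn[of j] by linarith
      have "energy lborel (\<lambda>x. conv (K i) f x - conv (K j) f x)
          \<le> (1 + 1) * energy lborel (conv d c) + (1 + 1 / 1) * energy lborel (\<lambda>x. conv (K i) r x - conv (K j) r x)"
        unfolding dec by (rule energy_add_le[OF s1 square_integrable_diff[OF s2 s2]]) simp
      thus ?thesis using e1 e2 by simp
    qed
    thus ?thesis by blast
  qed
  obtain g \<rho> where g: "square_integrable lborel g" "(\<lambda>n. energy lborel (\<lambda>x. conv (K n) f x - g x)) \<longlonglongrightarrow> 0"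
    and ae: "AE x in lborel. (\<lambda>i. conv (K (\<rho> i)) f x) \<longlonglongrightarrow> g x"
    by (rule lborel.L2_complete[OF sq Cauchy]) blast+
  have "energy lborel g \<le> A\<^sup>2 * energy lborel f"
    unfolding energy_def
  proof (rule Fatou_bounded_integrals(2)[where f = "\<lambda>i x. (norm (conv (K (\<rho> i)) f x))\<^sup>2"])
    show "AE x in lborel. (\<lambda>i. (norm (conv (K (\<rho> i)) f x))\<^sup>2) \<longlonglongrightarrow> (norm (g x))\<^sup>2"
      using ae by eventually_elim (intro tendsto_intros)
    show "(LINT x|lborel. (norm (conv (K (\<rho> i)) f x))\<^sup>2) \<le> A\<^sup>2 * (LINT x|lborel. (norm (f x))\<^sup>2)" for i
      using conv_energy_bounded(2)[OF k f A] by (simp add: energy_def)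
  qed (use sq g(1) in \<open>auto simp: square_integrable_def\<close>)
  with g show thesis by (rule that)
qed

section \<open>Oscillatory integrals in one variable\<close>

lemma norm_cis_minus_1_le: "norm (cis t - 1) \<le> \<bar>t\<bar>"
  using iexp_approx1[of t 0] by (simp add: cis_conv_exp mult.commute)

lemma AE_lborel_shift:
  assumes "AE x in (lborel :: 'a::euclidean_space measure). P x"
  shows "AE x in lborel. P (x + h)"
  using AE_lborel_reflect[OF AE_lborel_reflect[OF assms, of 0], of "- h"] by (simp add: add.commute)

text \<open>
  An integral that does not exist is \<open>0\<close>, so an integrable majorant is all that this takes.
\<close>

lemma set_integral_norm_bound_le:
  fixes f :: "'a \<Rightarrow> complex" and g :: "'a \<Rightarrow> real"
  assumes g: "set_integrable M A g" and le: "\<And>x. x \<in> A \<Longrightarrow> norm (f x) \<le> g x"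
  shows "norm (LINT x:A|M. f x) \<le> (LINT x:A|M. g x)"
proof -
  have "norm (LINT x:A|M. f x) \<le> (LINT x|M. norm (indicator A x *\<^sub>R f x))"
    unfolding set_lebesgue_integral_def by (rule integral_norm_bound)
  also have "\<dots> \<le> (LINT x|M. indicator A x *\<^sub>R g x)"
  proof (rule integral_mono')
    show "integrable M (\<lambda>x. indicator A x *\<^sub>R g x)" using g by (simp add: set_integrable_def)
    show "norm (indicator A x *\<^sub>R f x) \<le> indicator A x *\<^sub>R g x" for x
      using le by (auto simp: indicator_def)
    show "0 \<le> indicator A x *\<^sub>R g x" for x
      using order_trans[OF norm_ge_zero le] by (auto simp: indicator_def)
  qed
  finally show ?thesis by (simp add: set_lebesgue_integral_def)
qed

lemma set_integral_interval_bound: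
  fixes f :: "real \<Rightarrow> complex"
  assumes "b \<le> c" "0 \<le> D" "\<And>x. b \<le> x \<Longrightarrow> x \<le> c \<Longrightarrow> norm (f x) \<le> D"
  shows "norm (LINT x:{b..c}|lborel. f x) \<le> D * (c - b)"
proof -
  have "norm (LINT x:{b..c}|lborel. f x) \<le> (LINT x:{b..c}|lborel. D)"
    using assms by (intro set_integral_norm_bound_le) (auto simp: set_integrable_def)
  also have "\<dots> = D * (c - b)"
    using assms by (simp add: set_lebesgue_integral_def)
  finally show ?thesis .
qed

lemma set_integrable_bounded_on:
  fixes f :: "'a::euclidean_space \<Rightarrow> complex"
  assumes [measurable]: "f \<in> borel_measurable borel" and S[measurable]: "S \<in> sets borel" and bS: "bounded S"
    and D: "\<And>x. x \<in> S \<Longrightarrow> norm (f x) \<le> D"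
  shows "set_integrable lborel S f"
  unfolding set_integrable_def
proof (rule Bochner_Integration.integrable_bound)
  show "integrable lborel (\<lambda>x. D * indicator S x)"
    using emeasure_bounded_finite[OF bS] by (intro integrable_mult_right integrable_real_indicator) auto
  show "AE x in lborel. norm (indicator S x *\<^sub>R f x) \<le> norm (D * indicator S x)"
  proof (intro always_eventually allI)
    fix x show "norm (indicator S x *\<^sub>R f x) \<le> norm (D * indicator S x)"
      using D[of x] by (cases "x \<in> S") auto
  qed
qed measurable

lemma set_integral_interval_split:
  fixes f :: "real \<Rightarrow> complex"
  assumes f: "set_integrable lborel {b..n} f" and bc: "b \<le> c" "c \<le> n"
  shows "(LINT x:{b..n}|lborel. f x) = (LINT x:{b..c}|lborel. f x) + (LINT x:{c..n}|lborel. f x)"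
proof -
  have "(LINT x:{b..n}|lborel. f x) = (LINT x:{b..c} \<union> {c..n}|lborel. f x)"
    using bc by (simp add: ivl_disj_un_two_touch)
  also have "\<dots> = (LINT x:{b..c}|lborel. f x) + (LINT x:{c..n}|lborel. f x)"
  proof (rule set_integral_Un_AE)
    show "AE x in lborel. \<not> (x \<in> {b..c} \<and> x \<in> {c..n})"
      using AE_lborel_singleton[of c] by eventually_elim auto
    show "set_integrable lborel {b..c} f" "set_integrable lborel {c..n} f"
      by (rule set_integrable_subset[OF f]; use bc in auto)+
  qed simp_all
  finally show ?thesis .
qed

lemma integrable_powr_tail:
  fixes b \<theta> :: real assumes "0 < b" "0 < \<theta>"
  shows "set_integrable lborel {b..} (\<lambda>x. x powr (- \<theta> - 1))"
    and "(LINT x:{b..}|lborel. x powr (- \<theta> - 1)) = b powr (- \<theta>) / \<theta>"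
proof -
  have hi: "((\<lambda>x. x powr (- \<theta> - 1)) has_integral b powr (- \<theta>) / \<theta>) {b..}"
    using has_integral_powr_to_inf[of "- \<theta> - 1" b] assms by simp
  have "(\<lambda>x. x powr (- \<theta> - 1)) absolutely_integrable_on {b..}"
    using hi by (intro nonnegative_absolutely_integrable_1) (auto simp: integrable_on_def)
  hence "integrable lebesgue (\<lambda>x. indicator {b..} x *\<^sub>R x powr (- \<theta> - 1))"
    by (simp add: set_integrable_def)
  thus i: "set_integrable lborel {b..} (\<lambda>x. x powr (- \<theta> - 1))"
    unfolding set_integrable_def by (subst (asm) integrable_completion) auto
  show "(LINT x:{b..}|lborel. x powr (- \<theta> - 1)) = b powr (- \<theta>) / \<theta>"
    using set_borel_integral_eq_integral(2)[OF i] hi by (simp add: integral_unique)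
qed

lemma integrable_powr_origin:
  fixes c \<theta> :: real assumes "0 \<le> c" "0 < \<theta>"
  shows "set_integrable lborel {0..c} (\<lambda>x. x powr (\<theta> - 1))"
    and "(LINT x:{0..c}|lborel. x powr (\<theta> - 1)) = c powr \<theta> / \<theta>"
proof -
  have hi: "((\<lambda>x. x powr (\<theta> - 1)) has_integral c powr \<theta> / \<theta>) {0..c}"
    using has_integral_powr_from_0[of "\<theta> - 1" c] assms by simp
  have "(\<lambda>x. x powr (\<theta> - 1)) absolutely_integrable_on {0..c}"
    using hi by (intro nonnegative_absolutely_integrable_1) (auto simp: integrable_on_def)
  hence "integrable lebesgue (\<lambda>x. indicator {0..c} x *\<^sub>R x powr (\<theta> - 1))"
    by (simp add: set_integrable_def)
  thus i: "set_integrable lborel {0..c} (\<lambda>x. x powr (\<theta> - 1))"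
    unfolding set_integrable_def by (subst (asm) integrable_completion) auto
  show "(LINT x:{0..c}|lborel. x powr (\<theta> - 1)) = c powr \<theta> / \<theta>"
    using set_borel_integral_eq_integral(2)[OF i] hi by (simp add: integral_unique)
qed

text \<open>
  The size and Hoelder conditions of a Calderon-Zygmund kernel on the line, without cancellation.
\<close>

definition cz_kernel :: "real \<Rightarrow> real \<Rightarrow> (real \<Rightarrow> complex) \<Rightarrow> bool" where
  "cz_kernel \<theta> B \<phi> \<longleftrightarrow> \<phi> \<in> borel_measurable borel \<and> (\<forall>x. x \<noteq> 0 \<longrightarrow> norm (\<phi> x) \<le> B / \<bar>x\<bar>) \<and>
     (\<forall>x h. 2 * \<bar>h\<bar> \<le> \<bar>x\<bar> \<and> 0 < \<bar>h\<bar> \<longrightarrow> norm (\<phi> (x + h) - \<phi> x) \<le> B * \<bar>h\<bar> powr \<theta> / \<bar>x\<bar> powr (\<theta> + 1))"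

lemma cz_kernelD:
  assumes "cz_kernel \<theta> B \<phi>"
  shows cz_kernel_measurable: "\<phi> \<in> borel_measurable borel"
    and cz_kernel_size: "x \<noteq> 0 \<Longrightarrow> norm (\<phi> x) \<le> B / \<bar>x\<bar>"
    and cz_kernel_smooth: "2 * \<bar>h\<bar> \<le> \<bar>x\<bar> \<Longrightarrow> 0 < \<bar>h\<bar> \<Longrightarrow> norm (\<phi> (x + h) - \<phi> x) \<le> B * \<bar>h\<bar> powr \<theta> / \<bar>x\<bar> powr (\<theta> + 1)"
    and cz_kernel_nonneg: "0 \<le> B"
  using assms unfolding cz_kernel_def
proof -
  assume a: "\<phi> \<in> borel_measurable borel \<and> (\<forall>x. x \<noteq> 0 \<longrightarrow> norm (\<phi> x) \<le> B / \<bar>x\<bar>) \<and>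
     (\<forall>x h. 2 * \<bar>h\<bar> \<le> \<bar>x\<bar> \<and> 0 < \<bar>h\<bar> \<longrightarrow> norm (\<phi> (x + h) - \<phi> x) \<le> B * \<bar>h\<bar> powr \<theta> / \<bar>x\<bar> powr (\<theta> + 1))"
  have "norm (\<phi> 1) \<le> B / \<bar>1\<bar>"
    by (rule a[THEN conjunct2, THEN conjunct1, rule_format]) simp
  thus "0 \<le> B" using norm_ge_zero[of "\<phi> 1"] by linarith
qed auto

lemma cz_kernel_reflect:
  assumes "cz_kernel \<theta> B \<phi>" shows "cz_kernel \<theta> B (\<lambda>x. \<phi> (- x))"
  unfolding cz_kernel_def
proof (intro conjI allI impI)
  show "(\<lambda>x. \<phi> (- x)) \<in> borel_measurable borel"
    using cz_kernel_measurable[OF assms] by measurable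
  show "x \<noteq> 0 \<Longrightarrow> norm (\<phi> (- x)) \<le> B / \<bar>x\<bar>" for x
    using cz_kernel_size[OF assms, of "- x"] by simp
  fix x h :: real assume "2 * \<bar>h\<bar> \<le> \<bar>x\<bar> \<and> 0 < \<bar>h\<bar>"
  thus "norm (\<phi> (- (x + h)) - \<phi> (- x)) \<le> B * \<bar>h\<bar> powr \<theta> / \<bar>x\<bar> powr (\<theta> + 1)"
    using cz_kernel_smooth[OF assms, of "- h" "- x"] by simp
qed

text \<open>
  The character minus its low-frequency part: small near the origin, where the character is close to \<open>1\<close>,
  and equal to the character outside the radius \<open>r\<close>.
\<close>

definition osc :: "real \<Rightarrow> real \<Rightarrow> real \<Rightarrow> complex" where
  "osc \<xi> r x = cis (- (\<xi> * x)) - of_bool (\<bar>x\<bar> \<le> r)"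

abbreviation osc_integral :: "real \<Rightarrow> real \<Rightarrow> real \<Rightarrow> real \<Rightarrow> (real \<Rightarrow> complex) \<Rightarrow> complex" where
  "osc_integral \<xi> r e n \<phi> \<equiv> LINT x:annulus e n|lborel. osc \<xi> r x * \<phi> x"

lemma osc_measurable [measurable]: "osc \<xi> r \<in> borel_measurable borel"
  unfolding osc_def[abs_def] by measurable

lemma norm_osc_le: "norm (osc \<xi> r x) \<le> 2"
  using norm_triangle_ineq4[of "cis (- (\<xi> * x))" "of_bool (\<bar>x\<bar> \<le> r)"] by (auto simp: osc_def)

text \<open>
  The first summand bounds the part below the larger of the period and the radius, where the size
  condition suffices; the rest comes from the half-period shift. Only its value at \<open>r = 2\<pi>/|\<xi>|\<close> has to be independent of \<open>\<xi>\<close>.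
\<close>

definition osc_bound :: "real \<Rightarrow> real \<Rightarrow> real \<Rightarrow> real" where
  "osc_bound \<theta> \<xi> r = (\<bar>\<xi>\<bar> + 1 / min (2 * pi / \<bar>\<xi>\<bar>) r) * max (2 * pi / \<bar>\<xi>\<bar>) r + 1 / \<theta> + 1"

lemma osc_bound_resonant:
  "\<xi> \<noteq> 0 \<Longrightarrow> osc_bound \<theta> \<xi> (2 * pi / \<bar>\<xi>\<bar>) = 2 * pi + 2 + 1 / \<theta>"
  by (simp add: osc_bound_def field_simps)

text \<open>
  The part of \<^const>\<open>osc\<close> on the positive half-line that no oscillation is needed for: the character is kept below the
  period \<open>2\<pi>/|\<xi>|\<close>, while the indicator is kept with its own radius.
\<close>

definition osc_low :: "real \<Rightarrow> real \<Rightarrow> real \<Rightarrow> complex" where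
  "osc_low \<xi> r x = of_bool (x < 2 * pi / \<bar>\<xi>\<bar>) * cis (- (\<xi> * x)) - of_bool (x \<le> r)"

lemma osc_low_measurable [measurable]: "osc_low \<xi> r \<in> borel_measurable borel"
  unfolding osc_low_def[abs_def] by measurable

text \<open>
  Where the character and the indicator are both present they cancel to first order. Where just one of them is,
  \<open>x\<close> is at least the smaller of the two radii and a multiple of \<open>x\<close> dominates \<open>1\<close>.
\<close>

lemma norm_osc_low_le:
  assumes \<xi>: "\<xi> \<noteq> 0" and r: "0 < r" and x: "0 < x"
  shows "norm (osc_low \<xi> r x) \<le> (\<bar>\<xi>\<bar> + 1 / min (2 * pi / \<bar>\<xi>\<bar>) r) * x * indicator {0..max (2 * pi / \<bar>\<xi>\<bar>) r} x"
proof -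
  define a where "a = 2 * pi / \<bar>\<xi>\<bar>"
  have a: "0 < a" using \<xi> by (simp add: a_def)
  have m: "0 < min a r" using a r by simp
  have one: "1 \<le> (\<bar>\<xi>\<bar> + 1 / min a r) * x" if "min a r \<le> x"
  proof -
    have "1 \<le> 1 / min a r * x" using that m by (simp add: field_simps)
    also have "\<dots> \<le> (\<bar>\<xi>\<bar> + 1 / min a r) * x" using x by (intro mult_right_mono) auto
    finally show ?thesis .
  qed
  consider "x < a" "x \<le> r" | "x < a" "r < x" | "a \<le> x" "x \<le> r" | "a \<le> x" "r < x" by linarith
  hence "norm (osc_low \<xi> r x) \<le> (\<bar>\<xi>\<bar> + 1 / min a r) * x * indicator {0..max a r} x"
  proof cases
    case 1
    have "norm (cis (- (\<xi> * x)) - 1) \<le> \<bar>- (\<xi> * x)\<bar>" by (rule norm_cis_minus_1_le)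
    also have "\<dots> = \<bar>\<xi>\<bar> * x" using x by (simp add: abs_mult)
    also have "\<dots> \<le> (\<bar>\<xi>\<bar> + 1 / min a r) * x" using x m by (intro mult_right_mono) auto
    finally show ?thesis using 1 x by (simp add: osc_low_def a_def[symmetric])
  next
    case 2 thus ?thesis using one x by (simp add: osc_low_def a_def[symmetric])
  next
    case 3 thus ?thesis using one x by (simp add: osc_low_def a_def[symmetric])
  next
    case 4
    hence "norm (osc_low \<xi> r x) = 0" by (simp add: osc_low_def a_def[symmetric])
    also have "\<dots> \<le> (\<bar>\<xi>\<bar> + 1 / min a r) * x * indicator {0..max a r} x"
      using x m by (intro mult_nonneg_nonneg add_nonneg_nonneg) auto
    finally show ?thesis .
  qed
  thus ?thesis by (simp add: a_def)
qed

lemma osc_low_dominated: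
  assumes \<phi>: "cz_kernel \<theta> B \<phi>" and \<xi>: "\<xi> \<noteq> 0" and r: "0 < r" and x: "0 < x"
  shows "norm (osc_low \<xi> r x * \<phi> x) \<le> (\<bar>\<xi>\<bar> + 1 / min (2 * pi / \<bar>\<xi>\<bar>) r) * B * indicator {0..max (2 * pi / \<bar>\<xi>\<bar>) r} x"
proof -
  let ?I = "indicator {0..max (2 * pi / \<bar>\<xi>\<bar>) r} x :: real"
  let ?c = "\<bar>\<xi>\<bar> + 1 / min (2 * pi / \<bar>\<xi>\<bar>) r"
  have c: "0 \<le> ?c" using \<xi> r by simp
  have "norm (osc_low \<xi> r x * \<phi> x) \<le> (?c * x * ?I) * (B / \<bar>x\<bar>)"
    unfolding norm_mult using norm_osc_low_le[OF \<xi> r x] cz_kernel_size[OF \<phi>, of x] x c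
    by (intro mult_mono) auto
  also have "\<dots> = ?c * B * ?I" using x by simp
  finally show ?thesis .
qed

lemma osc_split:
  assumes \<phi>: "cz_kernel \<theta> B \<phi>" and \<xi>: "\<xi> \<noteq> 0" and r: "0 < r" and e: "0 < e"
  shows "(LINT x:{e..n}|lborel. osc \<xi> r x * \<phi> x) = (LINT x:{e..n}|lborel. osc_low \<xi> r x * \<phi> x)
       + (LINT x:{max e (2 * pi / \<bar>\<xi>\<bar>)..n}|lborel. cis (- (\<xi> * x)) * \<phi> x)"
proof -
  have [measurable]: "\<phi> \<in> borel_measurable borel" by (rule cz_kernel_measurable[OF \<phi>])
  let ?b = "max e (2 * pi / \<bar>\<xi>\<bar>)"
  have bd: "norm (\<phi> x) \<le> B / e" if "e \<le> x" for x
    using cz_kernel_size[OF \<phi>, of x] that e cz_kernel_nonneg[OF \<phi>]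
    by (smt (verit) frac_le)
  have 1: "set_integrable lborel {e..n} (\<lambda>x. osc_low \<xi> r x * \<phi> x)"
  proof (rule set_integrable_bounded_on)
    have "norm (osc_low \<xi> r x) \<le> 2" for x
      using norm_triangle_ineq4[of "of_bool (x < 2 * pi / \<bar>\<xi>\<bar>) * cis (- (\<xi> * x))" "of_bool (x \<le> r)"]
      by (auto simp: osc_low_def norm_mult)
    thus "x \<in> {e..n} \<Longrightarrow> norm (osc_low \<xi> r x * \<phi> x) \<le> 2 * (B / e)" for x
      unfolding norm_mult using bd[of x] by (intro mult_mono) auto
  qed (use e in auto)
  have 2: "set_integrable lborel {?b..n} (\<lambda>x. cis (- (\<xi> * x)) * \<phi> x)"
    by (rule set_integrable_bounded_on[where D = "B / e"])
      (use e bd in \<open>auto simp: norm_mult\<close>)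
  have "(LINT x:{e..n}|lborel. osc \<xi> r x * \<phi> x) = (LINT x|lborel. indicator {e..n} x *\<^sub>R (osc_low \<xi> r x * \<phi> x)
       + indicator {?b..n} x *\<^sub>R (cis (- (\<xi> * x)) * \<phi> x))"
    unfolding set_lebesgue_integral_def
    by (intro Bochner_Integration.integral_cong refl)
      (use e in \<open>auto simp: osc_def osc_low_def indicator_def algebra_simps\<close>)
  also have "\<dots> = (LINT x:{e..n}|lborel. osc_low \<xi> r x * \<phi> x) + (LINT x:{?b..n}|lborel. cis (- (\<xi> * x)) * \<phi> x)"
    unfolding set_lebesgue_integral_def
    using 1 2 by (intro Bochner_Integration.integral_add) (auto simp: set_integrable_def)
  finally show ?thesis .
qed

text \<open>
  Shifting by half a period \<open>h\<close> changes the sign of the character. Averaging the integral with its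
  shifted form replaces \<open>\<phi>\<close> by its difference, at the price of two boundary pieces of length \<open>h\<close>. All arguments
  stay inside the interval of integration.
\<close>

lemma half_period_shift:
  assumes \<phi>: "cz_kernel \<theta> B \<phi>" and b: "0 < b" and h: "0 < h" "b + h \<le> n" and \<xi>: "\<bar>\<xi>\<bar> * h = pi"
  shows "2 * (LINT x:{b..n}|lborel. cis (- (\<xi> * x)) * \<phi> x)
    = (LINT x:{b..n-h}|lborel. cis (- (\<xi> * x)) * (\<phi> x - \<phi> (x + h)))
      + (LINT x:{n-h..n}|lborel. cis (- (\<xi> * x)) * \<phi> x)
      + (LINT x:{b..b+h}|lborel. cis (- (\<xi> * x)) * \<phi> x)"
proof -
  have [measurable]: "\<phi> \<in> borel_measurable borel" by (rule cz_kernel_measurable[OF \<phi>])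
  define G where "G x = cis (- (\<xi> * x)) * \<phi> x" for x
  have [measurable]: "G \<in> borel_measurable borel" unfolding G_def by measurable
  have bd: "norm (\<phi> x) \<le> B / b" if "b \<le> x" for x
    using cz_kernel_size[OF \<phi>, of x] that b cz_kernel_nonneg[OF \<phi>] by (smt (verit) frac_le)
  have Gbd: "norm (G x) \<le> B / b" if "b \<le> x" for x using bd[OF that] by (simp add: G_def norm_mult)
  have Gi: "set_integrable lborel {b..n} G"
    by (rule set_integrable_bounded_on[where D = "B / b"]) (use b Gbd in auto)
  have Gi1: "set_integrable lborel {b..n-h} G"
    by (rule set_integrable_subset[OF Gi]) (use h in auto)
  have Gi2: "set_integrable lborel {b..n-h} (\<lambda>x. G (x + h))"
    by (rule set_integrable_bounded_on[where D = "B / b"]) (use b h Gbd in auto)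
  have half: "cis (- (\<xi> * (x + h))) = - cis (- (\<xi> * x))" for x
  proof -
    have "\<xi> * h = pi \<or> \<xi> * h = - pi" using \<xi> h by (cases "0 \<le> \<xi>") auto
    hence "cis (- (\<xi> * h)) = -1" by (auto simp: complex_eq_iff)
    moreover have "cis (- (\<xi> * (x + h))) = cis (- (\<xi> * x)) * cis (- (\<xi> * h))"
      by (simp add: cis_mult algebra_simps)
    ultimately show ?thesis by simp
  qed
  have shift: "(LINT x:{b+h..n}|lborel. G x) = (LINT x:{b..n-h}|lborel. G (x + h))"
  proof -
    have "(LINT x:{b+h..n}|lborel. G x) = (LINT x|lborel. indicator {b+h..n} (h + 1 * x) *\<^sub>R G (h + 1 * x))"
      unfolding set_lebesgue_integral_def by (subst lborel_integral_real_affine[of 1 _ h]) auto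
    also have "\<dots> = (LINT x:{b..n-h}|lborel. G (x + h))"
      unfolding set_lebesgue_integral_def
      by (intro Bochner_Integration.integral_cong refl) (auto simp: indicator_def add.commute)
    finally show ?thesis .
  qed
  have "(LINT x:{b..n-h}|lborel. cis (- (\<xi> * x)) * (\<phi> x - \<phi> (x + h))) = (LINT x:{b..n-h}|lborel. G x + G (x + h))"
    by (intro set_lebesgue_integral_cong) (auto simp: G_def half right_diff_distrib)
  also have "\<dots> = (LINT x:{b..n-h}|lborel. G x) + (LINT x:{b..n-h}|lborel. G (x + h))"
    using Gi1 Gi2 by (rule set_integral_add(2))
  finally have J: "(LINT x:{b..n-h}|lborel. cis (- (\<xi> * x)) * (\<phi> x - \<phi> (x + h)))
      = (LINT x:{b..n-h}|lborel. G x) + (LINT x:{b+h..n}|lborel. G x)" by (simp only: shift)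
  have "(LINT x:{b..n}|lborel. G x) = (LINT x:{b..n-h}|lborel. G x) + (LINT x:{n-h..n}|lborel. G x)"
    by (rule set_integral_interval_split[OF Gi]) (use h in auto)
  moreover have "(LINT x:{b..n}|lborel. G x) = (LINT x:{b..b+h}|lborel. G x) + (LINT x:{b+h..n}|lborel. G x)"
    by (rule set_integral_interval_split[OF Gi]) (use h in auto)
  ultimately show ?thesis unfolding J G_def[symmetric] by algebra
qed

lemma cz_difference_dominated:
  assumes \<phi>: "cz_kernel \<theta> B \<phi>" and h: "0 < h" and x: "2 * h \<le> x"
  shows "norm (cis t * (\<phi> x - \<phi> (x + h))) \<le> B * h powr \<theta> * x powr (- \<theta> - 1)"
proof -
  have "norm (\<phi> (x + h) - \<phi> x) \<le> B * \<bar>h\<bar> powr \<theta> / \<bar>x\<bar> powr (\<theta> + 1)"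
    using cz_kernel_smooth[OF \<phi>, of h x] h x by simp
  also have "\<dots> = B * h powr \<theta> * x powr (- (\<theta> + 1))"
    using h x unfolding powr_minus_divide by simp
  finally show ?thesis by (simp add: norm_mult norm_minus_commute)
qed

text \<open>
  The difference term is integrable at infinity, and a boundary piece of length \<open>h\<close> beyond \<open>2h\<close> has integral at
  most \<open>1/2\<close> against \<open>1/x\<close>. An interval shorter than \<open>h\<close> is itself such a piece.
\<close>

lemma osc_high_bound:
  assumes \<phi>: "cz_kernel \<theta> B \<phi>" and \<theta>: "0 < \<theta>" and \<xi>: "\<xi> \<noteq> 0" and b: "2 * pi / \<bar>\<xi>\<bar> \<le> b"
  shows "norm (LINT x:{b..n}|lborel. cis (- (\<xi> * x)) * \<phi> x) \<le> B * (1 / \<theta> + 1)"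
proof -
  define h where "h = pi / \<bar>\<xi>\<bar>"
  have h: "0 < h" "\<bar>\<xi>\<bar> * h = pi" "2 * h \<le> b" using \<xi> b by (auto simp: h_def)
  have b0: "0 < b" using h by linarith
  have B: "0 \<le> B" by (rule cz_kernel_nonneg[OF \<phi>])
  have piece: "norm (LINT x:{c..d}|lborel. cis (- (\<xi> * x)) * \<phi> x) \<le> B / 2"
    if "2 * h \<le> c" "c \<le> d" "d \<le> c + h" for c d
  proof -
    have "norm (LINT x:{c..d}|lborel. cis (- (\<xi> * x)) * \<phi> x) \<le> B / (2 * h) * (d - c)"
    proof (rule set_integral_interval_bound)
      fix x assume "c \<le> x"
      hence "norm (\<phi> x) \<le> B / \<bar>x\<bar>" using cz_kernel_size[OF \<phi>, of x] that h by simp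
      also have "\<dots> \<le> B / (2 * h)" using B that h \<open>c \<le> x\<close> by (intro divide_left_mono) auto
      finally show "norm (cis (- (\<xi> * x)) * \<phi> x) \<le> B / (2 * h)" by (simp add: norm_mult)
    qed (use that B h in auto)
    also have "\<dots> \<le> B / (2 * h) * h" using that B h by (intro mult_left_mono) auto
    also have "\<dots> = B / 2" using h by simp
    finally show ?thesis .
  qed
  have t0: "0 \<le> B / \<theta>" using B \<theta> by simp
  consider "n < b" | "b \<le> n" "n \<le> b + h" | "b + h < n" by linarith
  thus ?thesis
  proof cases
    case 1
    thus ?thesis using B \<theta> by (simp add: set_lebesgue_integral_def)
  next
    case 2
    thus ?thesis using piece[of b n] h t0 B by (simp add: distrib_left)
  next
    case 3
    let ?J = "LINT x:{b..n-h}|lborel. cis (- (\<xi> * x)) * (\<phi> x - \<phi> (x + h))"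
    have i: "set_integrable lborel {b..} (\<lambda>x. B * h powr \<theta> * x powr (- \<theta> - 1))"
      by (intro set_integrable_mult_right integrable_powr_tail b0 \<theta>)
    have i': "set_integrable lborel {b..n-h} (\<lambda>x. B * h powr \<theta> * x powr (- \<theta> - 1))"
      by (rule set_integrable_subset[OF i]) auto
    have "norm ?J \<le> (LINT x:{b..n-h}|lborel. B * h powr \<theta> * x powr (- \<theta> - 1))"
      by (rule set_integral_norm_bound_le[OF i'])
        (use h in \<open>auto intro!: cz_difference_dominated[OF \<phi>]\<close>)
    also have "\<dots> \<le> (LINT x:{b..}|lborel. B * h powr \<theta> * x powr (- \<theta> - 1))"
      unfolding set_lebesgue_integral_def
      using i i' B by (intro integral_mono) (auto simp: set_integrable_def indicator_def)
    also have "\<dots> = B * h powr \<theta> * (b powr (- \<theta>) / \<theta>)"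
      by (simp add: integrable_powr_tail(2)[OF b0 \<theta>])
    also have "\<dots> = B / \<theta> * (h / b) powr \<theta>"
      using h b0 by (simp add: powr_minus_divide powr_divide)
    also have "\<dots> \<le> B / \<theta> * 1"
      using h b0 \<theta> t0 by (intro mult_left_mono powr_le1) auto
    finally have J: "norm ?J \<le> B / \<theta>" by simp
    have "norm (2 * (LINT x:{b..n}|lborel. cis (- (\<xi> * x)) * \<phi> x)) \<le> B / \<theta> + B / 2 + B / 2"
      unfolding half_period_shift[OF \<phi> b0 h(1) less_imp_le[OF 3] h(2)]
      by (intro norm_triangle_mono J piece) (use 3 h in auto)
    thus ?thesis using t0 B by (simp add: norm_mult distrib_left)
  qed
qed

lemma osc_halfline_bound:
  assumes \<phi>: "cz_kernel \<theta> B \<phi>" and \<theta>: "0 < \<theta>" and \<xi>: "\<xi> \<noteq> 0" and r: "0 < r" and e: "0 < e"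
  shows "norm (LINT x:{e..n}|lborel. osc \<xi> r x * \<phi> x) \<le> B * osc_bound \<theta> \<xi> r"
proof -
  define a where "a = 2 * pi / \<bar>\<xi>\<bar>"
  have a: "0 < a" using \<xi> by (simp add: a_def)
  define c where "c = \<bar>\<xi>\<bar> + 1 / min a r"
  have c: "0 \<le> c" using a r by (simp add: c_def)
  have B: "0 \<le> B" by (rule cz_kernel_nonneg[OF \<phi>])
  have i: "set_integrable lborel {e..n} (\<lambda>x. c * B * indicator {0..max a r} x)"
    unfolding set_integrable_def
    by (intro integrable_mult_indicator integrable_mult_right integrable_real_indicator)
      (auto simp: emeasure_lborel_Icc_eq)
  have "norm (LINT x:{e..n}|lborel. osc_low \<xi> r x * \<phi> x) \<le> (LINT x:{e..n}|lborel. c * B * indicator {0..max a r} x)"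
    by (rule set_integral_norm_bound_le[OF i])
      (use osc_low_dominated[OF \<phi> \<xi> r] e in \<open>auto simp: c_def a_def\<close>)
  also have "\<dots> \<le> (LINT x|lborel. c * B * indicator {0..max a r} x)"
    unfolding set_lebesgue_integral_def
    by (rule integral_mono', intro integrable_mult_right integrable_real_indicator)
      (use c B in \<open>auto simp: emeasure_lborel_Icc_eq indicator_def\<close>)
  also have "\<dots> = c * B * max a r" using a by simp
  finally have 1: "norm (LINT x:{e..n}|lborel. osc_low \<xi> r x * \<phi> x) \<le> c * B * max a r" .
  have 2: "norm (LINT x:{max e a..n}|lborel. cis (- (\<xi> * x)) * \<phi> x) \<le> B * (1 / \<theta> + 1)"
    by (rule osc_high_bound[OF \<phi> \<theta> \<xi>]) (simp add: a_def)
  have "norm (LINT x:{e..n}|lborel. osc \<xi> r x * \<phi> x) \<le> c * B * max a r + B * (1 / \<theta> + 1)"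
    unfolding osc_split[OF \<phi> \<xi> r e] a_def[symmetric] by (intro norm_triangle_mono 1 2)
  also have "\<dots> = B * osc_bound \<theta> \<xi> r"
  proof -
    have "osc_bound \<theta> \<xi> r = c * max a r + 1 / \<theta> + 1" by (simp add: osc_bound_def a_def c_def)
    thus ?thesis by (simp add: algebra_simps)
  qed
  finally show ?thesis .
qed

lemma set_integral_dominated_convergence:
  fixes f :: "nat \<Rightarrow> 'a \<Rightarrow> complex" and w :: "'a \<Rightarrow> real"
  assumes [measurable]: "\<And>k. f k \<in> borel_measurable M" "g \<in> borel_measurable M" "\<And>k. S k \<in> sets M" "T \<in> sets M"
    and w: "integrable M w" and dom: "\<And>k x. x \<in> S k \<Longrightarrow> norm (f k x) \<le> w x" and w0: "\<And>x. 0 \<le> w x"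
    and lim: "AE x in M. (\<forall>\<^sub>F k in sequentially. x \<in> S k \<longleftrightarrow> x \<in> T) \<and> (x \<in> T \<longrightarrow> (\<lambda>k. f k x) \<longlonglongrightarrow> g x)"
  shows "(\<lambda>k. LINT x:S k|M. f k x) \<longlonglongrightarrow> (LINT x:T|M. g x)"
  unfolding set_lebesgue_integral_def
proof (rule integral_dominated_convergence[OF _ _ w])
  show "AE x in M. (\<lambda>k. indicator (S k) x *\<^sub>R f k x) \<longlonglongrightarrow> indicator T x *\<^sub>R g x"
    using lim
  proof eventually_elim
    fix x assume a: "(\<forall>\<^sub>F k in sequentially. x \<in> S k \<longleftrightarrow> x \<in> T) \<and> (x \<in> T \<longrightarrow> (\<lambda>k. f k x) \<longlonglongrightarrow> g x)"
    show "(\<lambda>k. indicator (S k) x *\<^sub>R f k x) \<longlonglongrightarrow> indicator T x *\<^sub>R g x"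
    proof (cases "x \<in> T")
      case True
      have "(\<lambda>k. f k x) \<longlonglongrightarrow> g x" using a True by blast
      moreover have "\<forall>\<^sub>F k in sequentially. f k x = indicator (S k) x *\<^sub>R f k x"
        using a True by (auto elim!: eventually_mono)
      ultimately have "(\<lambda>k. indicator (S k) x *\<^sub>R f k x) \<longlonglongrightarrow> g x"
        by (rule Lim_transform_eventually)
      thus ?thesis using True by simp
    next
      case False
      have "\<forall>\<^sub>F k in sequentially. indicator (S k) x *\<^sub>R f k x = 0"
        using a False by (auto elim!: eventually_mono)
      thus ?thesis using False by (simp add: tendsto_eventually)
    qed
  qed
  show "AE x in M. norm (indicator (S k) x *\<^sub>R f k x) \<le> w x" for k
    using dom w0 by (auto simp: indicator_def)
qed measurable

text \<open>
  Every part of the bound above has an integrable majorant that does not depend on the truncation, except the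
  piece next to the outer radius, which tends to \<open>0\<close>. So dominated convergence applies.
\<close>

lemma osc_halfline_convergent:
  assumes \<phi>: "\<And>k. cz_kernel \<theta> B (\<phi> k)" and \<theta>: "0 < \<theta>" and \<xi>: "\<xi> \<noteq> 0" and r: "0 < r"
    and e: "\<And>k. 0 < e k" "e \<longlonglongrightarrow> 0" and n: "filterlim n at_top sequentially"
    and conv: "AE x in lborel. convergent (\<lambda>k. \<phi> k x)"
  shows "convergent (\<lambda>k. LINT x:{e k..n k}|lborel. osc \<xi> r x * \<phi> k x)"
proof -
  have m[measurable]: "\<phi> k \<in> borel_measurable borel" for k by (rule cz_kernel_measurable[OF \<phi>])
  define \<Phi> where "\<Phi> x = lim (\<lambda>k. \<phi> k x)" for x
  have [measurable]: "\<Phi> \<in> borel_measurable borel" unfolding \<Phi>_def by measurable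
  have lim: "AE x in lborel. (\<lambda>k. \<phi> k x) \<longlonglongrightarrow> \<Phi> x"
    using conv by eventually_elim (simp add: \<Phi>_def convergent_LIMSEQ_iff)
  define a where "a = 2 * pi / \<bar>\<xi>\<bar>"
  define h where "h = pi / \<bar>\<xi>\<bar>"
  have h: "0 < h" "\<bar>\<xi>\<bar> * h = pi" "a = 2 * h" and a: "0 < a" using \<xi> by (auto simp: h_def a_def)
  have B: "0 \<le> B" by (rule cz_kernel_nonneg[OF \<phi>])
  have ek: "\<forall>\<^sub>F k in sequentially. e k < x" if "0 < x" for x
    using order_tendstoD(2)[OF e(2) that] .
  have nk: "\<forall>\<^sub>F k in sequentially. x < n k" for x
    using n by (simp add: filterlim_at_top_dense)
  define c where "c = \<bar>\<xi>\<bar> + 1 / min a r"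
  have c: "0 \<le> c" using a r by (simp add: c_def)
  have "(\<lambda>k. LINT x:{e k..n k}|lborel. osc_low \<xi> r x * \<phi> k x) \<longlonglongrightarrow> (LINT x:{0<..}|lborel. osc_low \<xi> r x * \<Phi> x)"
  proof (rule set_integral_dominated_convergence)
    show "integrable lborel (\<lambda>x. c * B * indicator {0..max a r} x)"
      by (intro integrable_mult_right integrable_real_indicator) (auto simp: emeasure_lborel_Icc_eq)
    show "norm (osc_low \<xi> r x * \<phi> k x) \<le> c * B * indicator {0..max a r} x" if "x \<in> {e k..n k}" for k x
      using osc_low_dominated[OF \<phi>[of k] \<xi> r, of x] that e(1)[of k] unfolding c_def a_def by force
    show "0 \<le> c * B * indicator {0..max a r} x" for x using c B by simp
    show "AE x in lborel. (\<forall>\<^sub>F k in sequentially. x \<in> {e k..n k} \<longleftrightarrow> x \<in> {0<..}) \<and>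
        (x \<in> {0<..} \<longrightarrow> (\<lambda>k. osc_low \<xi> r x * \<phi> k x) \<longlonglongrightarrow> osc_low \<xi> r x * \<Phi> x)"
      using lim
    proof eventually_elim
      fix x assume l: "(\<lambda>k. \<phi> k x) \<longlonglongrightarrow> \<Phi> x"
      have "\<forall>\<^sub>F k in sequentially. x \<in> {e k..n k} \<longleftrightarrow> x \<in> {0<..}"
      proof (cases "0 < x")
        case True
        show ?thesis using ek[OF True] nk[of x] by eventually_elim (use True in auto)
      next
        case False
        have "\<not> e k \<le> x" for k using e(1)[of k] False by linarith
        thus ?thesis using False by simp
      qed
      thus "(\<forall>\<^sub>F k in sequentially. x \<in> {e k..n k} \<longleftrightarrow> x \<in> {0<..}) \<and>
        (x \<in> {0<..} \<longrightarrow> (\<lambda>k. osc_low \<xi> r x * \<phi> k x) \<longlonglongrightarrow> osc_low \<xi> r x * \<Phi> x)"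
        using l by (auto intro!: tendsto_intros)
    qed
  qed measurable
  note low = this
  define J where "J k = (LINT x:{a..n k-h}|lborel. cis (- (\<xi> * x)) * (\<phi> k x - \<phi> k (x + h)))" for k
  define L where "L k = (LINT x:{n k-h..n k}|lborel. cis (- (\<xi> * x)) * \<phi> k x)" for k
  define T where "T k = (LINT x:{a..a+h}|lborel. cis (- (\<xi> * x)) * \<phi> k x)" for k
  have "J \<longlonglongrightarrow> (LINT x:{a..}|lborel. cis (- (\<xi> * x)) * (\<Phi> x - \<Phi> (x + h)))"
    unfolding J_def[abs_def]
  proof (rule set_integral_dominated_convergence)
    have "integrable lborel (\<lambda>x. B * h powr \<theta> * (indicator {a..} x *\<^sub>R x powr (- \<theta> - 1)))"
      using integrable_powr_tail(1)[OF a \<theta>] unfolding set_integrable_def by (rule integrable_mult_right)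
    thus "integrable lborel (\<lambda>x. B * h powr \<theta> * (indicator {a..} x *\<^sub>R x powr (- \<theta> - 1)))" .
    show "norm (cis (- (\<xi> * x)) * (\<phi> k x - \<phi> k (x + h))) \<le> B * h powr \<theta> * (indicator {a..} x *\<^sub>R x powr (- \<theta> - 1))"
      if "x \<in> {a..n k-h}" for k x
      using cz_difference_dominated[OF \<phi>[of k] h(1), of x] that h(3) by simp
    show "0 \<le> B * h powr \<theta> * (indicator {a..} x *\<^sub>R x powr (- \<theta> - 1))" for x using B by simp
    show "AE x in lborel. (\<forall>\<^sub>F k in sequentially. x \<in> {a..n k-h} \<longleftrightarrow> x \<in> {a..}) \<and>
        (x \<in> {a..} \<longrightarrow> (\<lambda>k. cis (- (\<xi> * x)) * (\<phi> k x - \<phi> k (x + h))) \<longlonglongrightarrow> cis (- (\<xi> * x)) * (\<Phi> x - \<Phi> (x + h)))"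
      using lim AE_lborel_shift[OF lim, of h]
    proof eventually_elim
      fix x assume l: "(\<lambda>k. \<phi> k x) \<longlonglongrightarrow> \<Phi> x" "(\<lambda>k. \<phi> k (x + h)) \<longlonglongrightarrow> \<Phi> (x + h)"
      have "\<forall>\<^sub>F k in sequentially. x \<in> {a..n k-h} \<longleftrightarrow> x \<in> {a..}"
        using nk[of "x + h"] by eventually_elim auto
      thus "(\<forall>\<^sub>F k in sequentially. x \<in> {a..n k-h} \<longleftrightarrow> x \<in> {a..}) \<and>
        (x \<in> {a..} \<longrightarrow> (\<lambda>k. cis (- (\<xi> * x)) * (\<phi> k x - \<phi> k (x + h))) \<longlonglongrightarrow> cis (- (\<xi> * x)) * (\<Phi> x - \<Phi> (x + h)))"
        using l by (auto intro!: tendsto_intros)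
    qed
  qed measurable
  moreover have "T \<longlonglongrightarrow> (LINT x:{a..a+h}|lborel. cis (- (\<xi> * x)) * \<Phi> x)"
    unfolding T_def[abs_def]
  proof (rule set_integral_dominated_convergence)
    show "integrable lborel (\<lambda>x. B / a * indicator {a..a+h} x)"
      by (intro integrable_mult_right integrable_real_indicator) (auto simp: emeasure_lborel_Icc_eq)
    show "norm (cis (- (\<xi> * x)) * \<phi> k x) \<le> B / a * indicator {a..a+h} x" if "x \<in> {a..a+h}" for k x
    proof -
      have "norm (\<phi> k x) \<le> B / \<bar>x\<bar>" using cz_kernel_size[OF \<phi>, of x] that a by simp
      also have "\<dots> \<le> B / a" using B that a by (intro divide_left_mono) auto
      finally show ?thesis using that by (simp add: norm_mult)
    qed
    show "0 \<le> B / a * indicator {a..a+h} x" for x using a B by simp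
    show "AE x in lborel. (\<forall>\<^sub>F k in sequentially. x \<in> {a..a+h} \<longleftrightarrow> x \<in> {a..a+h}) \<and>
        (x \<in> {a..a+h} \<longrightarrow> (\<lambda>k. cis (- (\<xi> * x)) * \<phi> k x) \<longlonglongrightarrow> cis (- (\<xi> * x)) * \<Phi> x)"
      using lim by eventually_elim (auto intro!: tendsto_intros)
  qed measurable
  moreover have "L \<longlonglongrightarrow> 0"
  proof (rule Lim_null_comparison)
    show "\<forall>\<^sub>F k in sequentially. norm (L k) \<le> B * h * inverse (n k - h)"
      using nk[of h]
    proof eventually_elim
      fix k assume k: "h < n k"
      have "norm (L k) \<le> B / (n k - h) * (n k - (n k - h))"
        unfolding L_def
      proof (rule set_integral_interval_bound)
        fix x assume x: "n k - h \<le> x"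
        have "norm (\<phi> k x) \<le> B / \<bar>x\<bar>" using cz_kernel_size[OF \<phi>, of x] x k by simp
        also have "\<dots> \<le> B / (n k - h)" using B x k by (intro divide_left_mono) auto
        finally show "norm (cis (- (\<xi> * x)) * \<phi> k x) \<le> B / (n k - h)" by (simp add: norm_mult)
      qed (use B h k in auto)
      thus "norm (L k) \<le> B * h * inverse (n k - h)" by (simp add: divide_inverse mult_ac)
    qed
    have "filterlim (\<lambda>k. - h + n k) at_top sequentially"
      by (rule filterlim_tendsto_add_at_top[OF tendsto_const n])
    hence "(\<lambda>k. inverse (n k - h)) \<longlonglongrightarrow> 0"
      by (intro tendsto_inverse_0_at_top) simp
    from tendsto_mult_right_zero[OF this, of "B * h"]
    show "(\<lambda>k. B * h * inverse (n k - h)) \<longlonglongrightarrow> 0" .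
  qed
  ultimately have "(\<lambda>k. (J k + L k + T k) / 2) \<longlonglongrightarrow>
      ((LINT x:{a..}|lborel. cis (- (\<xi> * x)) * (\<Phi> x - \<Phi> (x + h))) + 0 + (LINT x:{a..a+h}|lborel. cis (- (\<xi> * x)) * \<Phi> x)) / 2"
    by (intro tendsto_intros) auto
  from tendsto_add[OF low this] have lim_sum:
    "convergent (\<lambda>k. (LINT x:{e k..n k}|lborel. osc_low \<xi> r x * \<phi> k x) + (J k + L k + T k) / 2)"
    by (rule convergentI)
  have "\<forall>\<^sub>F k in sequentially. (LINT x:{e k..n k}|lborel. osc \<xi> r x * \<phi> k x)
      = (LINT x:{e k..n k}|lborel. osc_low \<xi> r x * \<phi> k x) + (J k + L k + T k) / 2"
    using ek[OF a] nk[of "a + h"]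
  proof eventually_elim
    fix k assume k: "e k < a" "a + h < n k"
    have "2 * (LINT x:{a..n k}|lborel. cis (- (\<xi> * x)) * \<phi> k x) = J k + L k + T k"
      unfolding J_def L_def T_def
      by (rule half_period_shift[OF \<phi> a h(1) less_imp_le[OF k(2)] h(2)])
    from arg_cong[OF this, of "\<lambda>z. z / 2"]
    have "(LINT x:{a..n k}|lborel. cis (- (\<xi> * x)) * \<phi> k x) = (J k + L k + T k) / 2" by simp
    moreover have "max (e k) (2 * pi / \<bar>\<xi>\<bar>) = a" using k by (simp add: a_def)
    ultimately show "(LINT x:{e k..n k}|lborel. osc \<xi> r x * \<phi> k x)
      = (LINT x:{e k..n k}|lborel. osc_low \<xi> r x * \<phi> k x) + (J k + L k + T k) / 2"
      using osc_split[OF \<phi> \<xi> r e(1), of k "n k" k] by simp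
  qed
  from convergent_cong[OF this] lim_sum show ?thesis by simp
qed

lemma annulus_measurable [measurable]: "annulus e n \<in> sets borel"
  unfolding annulus_def by measurable

lemma bounded_annulus: "bounded (annulus e n)"
  by (rule bounded_subset[of "{-n..n}"]) (auto simp: annulus_def)

lemma annulusD: "0 < e \<Longrightarrow> x \<in> annulus e n \<Longrightarrow> e \<le> \<bar>x\<bar> \<and> x \<noteq> 0 \<and> \<bar>x\<bar> \<le> n"
  by (auto simp: annulus_def)

text \<open>
  The half-line results extend to annuli by reflection, which changes the sign of the frequency.
\<close>

lemma annulus_integral_fold:
  fixes f :: "real \<Rightarrow> complex"
  assumes f: "set_integrable lborel (annulus e n) f" and e: "0 < e"
  shows "(LINT x:annulus e n|lborel. f x) = (LINT x:{e..n}|lborel. f x) + (LINT x:{e..n}|lborel. f (- x))"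
proof -
  have A: "annulus e n = {e..n} \<union> {-n..-e}" using e by (auto simp: annulus_def)
  have "(LINT x:annulus e n|lborel. f x) = (LINT x:{e..n}|lborel. f x) + (LINT x:{-n..-e}|lborel. f x)"
    unfolding A
    by (rule set_integral_Un; (rule set_integrable_subset[OF f])?) (use e in \<open>auto simp: annulus_def\<close>)
  also have "(LINT x:{-n..-e}|lborel. f x) = (LINT x:{e..n}|lborel. f (- x))"
    unfolding set_lebesgue_integral_def
    by (subst lborel_integral_real_affine[of "-1" _ 0])
      (auto intro!: Bochner_Integration.integral_cong simp: indicator_def)
  finally show ?thesis .
qed

lemma osc_annulus_integrable:
  assumes \<phi>: "cz_kernel \<theta> B \<phi>" and e: "0 < e"
  shows "set_integrable lborel (annulus e n) (\<lambda>x. osc \<xi> r x * \<phi> x)"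
proof (rule set_integrable_bounded_on[OF _ annulus_measurable bounded_annulus])
  have [measurable]: "\<phi> \<in> borel_measurable borel" by (rule cz_kernel_measurable[OF \<phi>])
  show "(\<lambda>x. osc \<xi> r x * \<phi> x) \<in> borel_measurable borel" by measurable
  fix x assume "x \<in> annulus e n"
  hence x: "e \<le> \<bar>x\<bar>" "x \<noteq> 0" using annulusD[OF e] by auto
  have "norm (\<phi> x) \<le> B / \<bar>x\<bar>" using cz_kernel_size[OF \<phi>] x by simp
  also have "\<dots> \<le> B / e" using x e cz_kernel_nonneg[OF \<phi>] by (intro divide_left_mono) auto
  finally show "norm (osc \<xi> r x * \<phi> x) \<le> 2 * (B / e)"
    unfolding norm_mult using norm_osc_le by (intro mult_mono) auto
qed

lemma osc_annulus_fold:
  assumes \<phi>: "cz_kernel \<theta> B \<phi>" and e: "0 < e"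
  shows "(osc_integral \<xi> r e n \<phi>)
    = (LINT x:{e..n}|lborel. osc \<xi> r x * \<phi> x) + (LINT x:{e..n}|lborel. osc (- \<xi>) r x * \<phi> (- x))"
  using annulus_integral_fold[OF osc_annulus_integrable[OF \<phi> e, of n \<xi> r] e] by (simp add: osc_def)

lemma osc_annulus_bound:
  assumes \<phi>: "cz_kernel \<theta> B \<phi>" and \<theta>: "0 < \<theta>" and \<xi>: "\<xi> \<noteq> 0" and r: "0 < r" and e: "0 < e"
  shows "norm (osc_integral \<xi> r e n \<phi>) \<le> 2 * B * osc_bound \<theta> \<xi> r"
proof -
  have "norm (osc_integral \<xi> r e n \<phi>) \<le> B * osc_bound \<theta> \<xi> r + B * osc_bound \<theta> (- \<xi>) r"
    unfolding osc_annulus_fold[OF \<phi> e]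
    by (intro norm_triangle_mono osc_halfline_bound[OF \<phi> \<theta> \<xi> r e]
        osc_halfline_bound[OF cz_kernel_reflect[OF \<phi>] \<theta> _ r e]) (use \<xi> in simp)
  thus ?thesis by (simp add: osc_bound_def)
qed

lemma osc_annulus_convergent:
  assumes \<phi>: "\<And>k. cz_kernel \<theta> B (\<phi> k)" and \<theta>: "0 < \<theta>" and \<xi>: "\<xi> \<noteq> 0" and r: "0 < r"
    and e: "\<And>k. 0 < e k" "e \<longlonglongrightarrow> 0" and n: "filterlim n at_top sequentially"
    and conv: "AE x in lborel. convergent (\<lambda>k. \<phi> k x)"
  shows "convergent (\<lambda>k. osc_integral \<xi> r (e k) (n k) (\<phi> k))"
proof -
  have "AE x in lborel. convergent (\<lambda>k. \<phi> k (- x))"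
    using AE_lborel_reflect[OF conv, of 0] by simp
  thus ?thesis
    unfolding osc_annulus_fold[OF \<phi> e(1)]
    by (intro convergent_add osc_halfline_convergent[OF \<phi> \<theta> \<xi> r e n conv]
        osc_halfline_convergent[OF cz_kernel_reflect[OF \<phi>] \<theta> _ r e n]) (use \<xi> in simp_all)
qed

text \<open>
  The product version in two variables, arranged so that integrating out the first variable with the
  one-variable bound leaves a \<^const>\<open>cz_kernel\<close> in the second.
\<close>

definition cz_kernel2 :: "real \<Rightarrow> real \<Rightarrow> (real \<Rightarrow> real \<Rightarrow> complex) \<Rightarrow> bool" where
  "cz_kernel2 \<theta> B \<psi> \<longleftrightarrow> case_prod \<psi> \<in> borel_measurable borel \<and>
     (\<forall>y. y \<noteq> 0 \<longrightarrow> cz_kernel \<theta> (B / \<bar>y\<bar>) (\<lambda>x. \<psi> x y)) \<and>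
     (\<forall>y k. 2 * \<bar>k\<bar> \<le> \<bar>y\<bar> \<and> 0 < \<bar>k\<bar> \<longrightarrow>
        cz_kernel \<theta> (B * \<bar>k\<bar> powr \<theta> / \<bar>y\<bar> powr (\<theta> + 1)) (\<lambda>x. \<psi> x (y + k) - \<psi> x y))"

lemma osc_partial_cz_kernel:
  assumes \<psi>: "cz_kernel2 \<theta> B \<psi>" and \<theta>: "0 < \<theta>" and \<xi>: "\<xi> \<noteq> 0" and r: "0 < r" and e: "0 < e"
  shows "cz_kernel \<theta> (2 * B * osc_bound \<theta> \<xi> r) (\<lambda>y. osc_integral \<xi> r e n (\<lambda>x. \<psi> x y))"
  unfolding cz_kernel_def
proof (intro conjI allI impI)
  have [measurable]: "case_prod \<psi> \<in> borel_measurable (borel \<Otimes>\<^sub>M borel)"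
    using \<psi> by (simp add: cz_kernel2_def borel_prod)
  have "(\<lambda>y. LINT x|lborel. indicator (annulus e n) x *\<^sub>R (osc \<xi> r x * \<psi> x y)) \<in> borel_measurable lborel"
    by (rule lborel.borel_measurable_lebesgue_integral) measurable
  thus "(\<lambda>y. osc_integral \<xi> r e n (\<lambda>x. \<psi> x y)) \<in> borel_measurable borel"
    by (simp add: set_lebesgue_integral_def)
next
  fix y :: real assume "y \<noteq> 0"
  hence "cz_kernel \<theta> (B / \<bar>y\<bar>) (\<lambda>x. \<psi> x y)" using \<psi> by (simp add: cz_kernel2_def)
  from osc_annulus_bound[OF this \<theta> \<xi> r e, of n]
  show "norm (osc_integral \<xi> r e n (\<lambda>x. \<psi> x y)) \<le> 2 * B * osc_bound \<theta> \<xi> r / \<bar>y\<bar>" by simp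
next
  fix y k :: real assume yk: "2 * \<bar>k\<bar> \<le> \<bar>y\<bar> \<and> 0 < \<bar>k\<bar>"
  hence nz: "y \<noteq> 0" "y + k \<noteq> 0" by auto
  have D: "cz_kernel \<theta> (B * \<bar>k\<bar> powr \<theta> / \<bar>y\<bar> powr (\<theta> + 1)) (\<lambda>x. \<psi> x (y + k) - \<psi> x y)"
    and S: "cz_kernel \<theta> (B / \<bar>z\<bar>) (\<lambda>x. \<psi> x z)" if "z \<noteq> 0" for z
    using \<psi> yk that unfolding cz_kernel2_def by blast+
  have "(osc_integral \<xi> r e n (\<lambda>x. \<psi> x (y + k))) - (osc_integral \<xi> r e n (\<lambda>x. \<psi> x y))
    = (LINT x:annulus e n|lborel. osc \<xi> r x * \<psi> x (y + k) - osc \<xi> r x * \<psi> x y)"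
    by (rule set_integral_diff(2)[symmetric]; rule osc_annulus_integrable[OF S e]; rule nz)
  also have "\<dots> = (osc_integral \<xi> r e n (\<lambda>x. \<psi> x (y + k) - \<psi> x y))"
    by (simp add: right_diff_distrib)
  finally show "norm ((osc_integral \<xi> r e n (\<lambda>x. \<psi> x (y + k))) - (osc_integral \<xi> r e n (\<lambda>x. \<psi> x y)))
      \<le> 2 * B * osc_bound \<theta> \<xi> r * \<bar>k\<bar> powr \<theta> / \<bar>y\<bar> powr (\<theta> + 1)"
    using osc_annulus_bound[OF D[OF nz(1)] \<theta> \<xi> r e, of n] by (simp add: mult_ac)
qed

lemma osc_double_bound:
  assumes \<psi>: "cz_kernel2 \<theta> B \<psi>" and \<theta>: "0 < \<theta>"
    and 1: "\<xi> \<noteq> 0" "0 < r" "0 < e" and 2: "\<eta> \<noteq> 0" "0 < s" "0 < d"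
  shows "norm (osc_integral \<eta> s d m (\<lambda>y. osc_integral \<xi> r e n (\<lambda>x. \<psi> x y)))
    \<le> 4 * B * osc_bound \<theta> \<xi> r * osc_bound \<theta> \<eta> s"
  using osc_annulus_bound[OF osc_partial_cz_kernel[OF \<psi> \<theta> 1] \<theta> 2, where n = m] by (simp add: mult.assoc)

lemma osc_double_convergent:
  assumes \<psi>: "\<And>k. cz_kernel2 \<theta> B (\<psi> k)" and \<theta>: "0 < \<theta>"
    and 1: "\<xi> \<noteq> 0" "0 < r" "\<And>k. 0 < e k" "e \<longlonglongrightarrow> 0" "filterlim n at_top sequentially"
    and 2: "\<eta> \<noteq> 0" "0 < s" "\<And>k. 0 < d k" "d \<longlonglongrightarrow> 0" "filterlim m at_top sequentially"
    and conv: "\<And>x y. x \<noteq> 0 \<Longrightarrow> y \<noteq> 0 \<Longrightarrow> convergent (\<lambda>k. \<psi> k x y)"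
  shows "convergent (\<lambda>k. osc_integral \<eta> s (d k) (m k) (\<lambda>y. osc_integral \<xi> r (e k) (n k) (\<lambda>x. \<psi> k x y)))"
proof (rule osc_annulus_convergent[OF osc_partial_cz_kernel[OF \<psi> \<theta> 1(1-3)] \<theta> 2])
  have "convergent (\<lambda>k. osc_integral \<xi> r (e k) (n k) (\<lambda>x. \<psi> k x y))" if y: "y \<noteq> 0" for y
  proof (rule osc_annulus_convergent[OF _ \<theta> 1])
    show "cz_kernel \<theta> (B / \<bar>y\<bar>) (\<lambda>x. \<psi> k x y)" for k using \<psi>[of k] y by (simp add: cz_kernel2_def)
    show "AE x in lborel. convergent (\<lambda>k. \<psi> k x y)"
      using AE_lborel_singleton[of 0] by eventually_elim (rule conv[OF _ y])
  qed
  thus "AE y in lborel. convergent (\<lambda>k. osc_integral \<xi> r (e k) (n k) (\<lambda>x. \<psi> k x y))"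
    using AE_lborel_singleton[of 0] by (auto elim!: eventually_mono)
qed

section \<open>Integrating out one variable\<close>

lemma set_integral_Fubini:
  fixes f :: "'a::euclidean_space \<times> 'b::euclidean_space \<Rightarrow> complex"
  assumes f: "set_integrable lborel (A \<times> B) f"
  shows "(LINT p:A \<times> B|lborel. f p) = (LINT x:A|lborel. LINT y:B|lborel. f (x, y))"
    and "(LINT p:A \<times> B|lborel. f p) = (LINT y:B|lborel. LINT x:A|lborel. f (x, y))"
proof -
  define g where "g p = indicator (A \<times> B) p *\<^sub>R f p" for p
  have g: "integrable (lborel \<Otimes>\<^sub>M lborel) g"
    using f unfolding g_def[abs_def] set_integrable_def lborel_prod .
  have g': "integrable (lborel \<Otimes>\<^sub>M lborel) (case_prod (\<lambda>x y. g (x, y)))" using g by simp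
  have e: "(LINT p:A \<times> B|lborel. f p) = integral\<^sup>L (lborel \<Otimes>\<^sub>M lborel) g"
    unfolding set_lebesgue_integral_def g_def[symmetric] lborel_prod ..
  have 1: "(LINT y|lborel. g (x, y)) = indicator A x *\<^sub>R (LINT y:B|lborel. f (x, y))" for x
    unfolding set_lebesgue_integral_def g_def indicator_times scaleR_scaleR[symmetric] fst_conv snd_conv
    by (rule integral_scaleR_right)
  have 2: "(LINT x|lborel. g (x, y)) = indicator B y *\<^sub>R (LINT x:A|lborel. f (x, y))" for y
    unfolding set_lebesgue_integral_def g_def indicator_times fst_conv snd_conv
      mult.commute[of "indicator A _"] scaleR_scaleR[symmetric]
    by (rule integral_scaleR_right)
  show "(LINT p:A \<times> B|lborel. f p) = (LINT x:A|lborel. LINT y:B|lborel. f (x, y))"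
    unfolding e lborel_pair.integral_fst'[OF g, symmetric] 1 by (simp add: set_lebesgue_integral_def)
  show "(LINT p:A \<times> B|lborel. f p) = (LINT y:B|lborel. LINT x:A|lborel. f (x, y))"
    using lborel_pair.integral_snd[OF g'] unfolding e 2 by (simp add: set_lebesgue_integral_def)
qed

lemma set_integral_measurable [measurable]:
  fixes f :: "'b::euclidean_space \<Rightarrow> 'a::euclidean_space \<Rightarrow> complex"
  assumes [measurable]: "case_prod f \<in> borel_measurable (borel \<Otimes>\<^sub>M borel)" "A \<in> sets borel"
  shows "(\<lambda>y. LINT x:A|lborel. f y x) \<in> borel_measurable borel"
proof -
  have "(\<lambda>y. LINT x|lborel. indicator A x *\<^sub>R f y x) \<in> borel_measurable lborel"
    by (rule lborel.borel_measurable_lebesgue_integral) measurable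
  thus ?thesis by (simp add: set_lebesgue_integral_def)
qed

lemma set_integral_norm_le_measure:
  fixes f :: "'a::euclidean_space \<Rightarrow> complex"
  assumes "S \<in> sets borel" "bounded S" "\<And>x. x \<in> S \<Longrightarrow> norm (f x) \<le> D"
  shows "norm (LINT x:S|lborel. f x) \<le> D * measure lborel S"
proof -
  have fin: "emeasure lborel S < \<infinity>" using assms(2) by (rule emeasure_bounded_finite)
  have "norm (LINT x:S|lborel. f x) \<le> (LINT x:S|lborel. D)"
    using assms fin by (intro set_integral_norm_bound_le) (auto simp: set_integrable_def)
  also have "\<dots> = D * measure lborel S"
    using assms fin by (simp add: set_lebesgue_integral_def)
  finally show ?thesis .
qed

text \<open>
  The iterated integrals that the seven terms of the multiplier require. Boundedness on a bounded
  product set makes every section integrable, so the sections need no exceptional null sets.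
\<close>

lemma triple_integral_Fubini:
  fixes f :: "R3 \<Rightarrow> complex"
  assumes f: "f \<in> borel_measurable borel"
    and A: "A1 \<in> sets borel" "A2 \<in> sets borel" "A3 \<in> sets borel" "bounded A1" "bounded A2" "bounded A3"
    and D: "\<forall>x1\<in>A1. \<forall>x2\<in>A2. \<forall>x3\<in>A3. norm (f (x1, x2, x3)) \<le> D"
  shows "(LINT x:A1 \<times> A2 \<times> A3|lborel. f x) = (LINT x1:A1|lborel. LINT (x2, x3):A2 \<times> A3|lborel. f (x1, x2, x3))"
    and "(LINT x:A1 \<times> A2 \<times> A3|lborel. f x) = (LINT x2:A2|lborel. LINT (x1, x3):A1 \<times> A3|lborel. f (x1, x2, x3))"
    and "(LINT x:A1 \<times> A2 \<times> A3|lborel. f x) = (LINT x3:A3|lborel. LINT (x1, x2):A1 \<times> A2|lborel. f (x1, x2, x3))"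
    and "(LINT x:A1 \<times> A2 \<times> A3|lborel. f x) = (LINT x2:A2|lborel. LINT x1:A1|lborel. LINT x3:A3|lborel. f (x1, x2, x3))"
    and "(LINT x:A1 \<times> A2 \<times> A3|lborel. f x) = (LINT x3:A3|lborel. LINT x1:A1|lborel. LINT x2:A2|lborel. f (x1, x2, x3))"
    and "(LINT x:A1 \<times> A2 \<times> A3|lborel. f x) = (LINT x3:A3|lborel. LINT x2:A2|lborel. LINT x1:A1|lborel. f (x1, x2, x3))"
proof -
  have fm[measurable]: "f \<in> borel_measurable (borel \<Otimes>\<^sub>M borel \<Otimes>\<^sub>M borel)"
    using f by (simp add: borel_prod)
  note [measurable] = A(1-3)
  have pm: "A \<times> B \<in> sets borel" if "A \<in> sets borel" "B \<in> sets borel" for A :: "'x::euclidean_space set" and B :: "'y::euclidean_space set"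
    using that by (simp add: borel_prod[symmetric])
  have i123: "set_integrable lborel (A1 \<times> A2 \<times> A3) f"
    by (rule set_integrable_bounded_on[OF f, where D = D]) (use A D in \<open>auto intro!: pm bounded_Times\<close>)
  have i23: "set_integrable lborel (A2 \<times> A3) (\<lambda>(x2, x3). f (x1, x2, x3))" if "x1 \<in> A1" for x1
    by (rule set_integrable_bounded_on[where D = D])
      (use A D that in \<open>auto intro!: pm bounded_Times simp: borel_prod[symmetric]\<close>)
  have i13: "set_integrable lborel (A1 \<times> A3) (\<lambda>(x1, x3). f (x1, x2, x3))" if "x2 \<in> A2" for x2
    by (rule set_integrable_bounded_on[where D = D])
      (use A D that in \<open>auto intro!: pm bounded_Times simp: borel_prod[symmetric]\<close>)
  have i12: "set_integrable lborel (A1 \<times> A2) (\<lambda>(x1, x2). f (x1, x2, x3))" if "x3 \<in> A3" for x3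
    by (rule set_integrable_bounded_on[where D = D])
      (use A D that in \<open>auto intro!: pm bounded_Times simp: borel_prod[symmetric]\<close>)
  have j12: "set_integrable lborel (A1 \<times> A2) (\<lambda>(x1, x2). LINT x3:A3|lborel. f (x1, x2, x3))"
  proof (rule set_integrable_bounded_on[where D = "D * measure lborel A3"])
    have "(\<lambda>q. f (fst (fst q), snd (fst q), snd q)) \<in> borel_measurable (borel :: ((real \<times> real) \<times> real) measure)"
      by (rule measurable_compose[OF borel_measurable_continuous_onI f]) (intro continuous_intros)
    hence "(\<lambda>p. LINT t:A3|lborel. f (fst p, snd p, t)) \<in> borel_measurable (borel :: (real \<times> real) measure)"
      by (intro set_integral_measurable) (auto simp: borel_prod case_prod_beta' A)
    thus "(\<lambda>(x1, x2). LINT x3:A3|lborel. f (x1, x2, x3)) \<in> borel_measurable borel"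
      by (simp add: case_prod_beta')
  qed (use A D in \<open>auto intro!: pm bounded_Times set_integral_norm_le_measure\<close>)
  have j13: "set_integrable lborel (A1 \<times> A3) (\<lambda>(x1, x3). LINT x2:A2|lborel. f (x1, x2, x3))"
  proof (rule set_integrable_bounded_on[where D = "D * measure lborel A2"])
    have "(\<lambda>q. f (fst (fst q), snd q, snd (fst q))) \<in> borel_measurable (borel :: ((real \<times> real) \<times> real) measure)"
      by (rule measurable_compose[OF borel_measurable_continuous_onI f]) (intro continuous_intros)
    hence "(\<lambda>p. LINT t:A2|lborel. f (fst p, t, snd p)) \<in> borel_measurable (borel :: (real \<times> real) measure)"
      by (intro set_integral_measurable) (auto simp: borel_prod case_prod_beta' A)
    thus "(\<lambda>(x1, x3). LINT x2:A2|lborel. f (x1, x2, x3)) \<in> borel_measurable borel"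
      by (simp add: case_prod_beta')
  qed (use A D in \<open>auto intro!: pm bounded_Times set_integral_norm_le_measure\<close>)
  show 1: "(LINT x:A1 \<times> A2 \<times> A3|lborel. f x) = (LINT x1:A1|lborel. LINT (x2, x3):A2 \<times> A3|lborel. f (x1, x2, x3))"
    using set_integral_Fubini(1)[OF i123] by (simp add: case_prod_beta')
  have a: "(LINT x:A1 \<times> A2 \<times> A3|lborel. f x) = (LINT x1:A1|lborel. LINT x2:A2|lborel. LINT x3:A3|lborel. f (x1, x2, x3))"
    unfolding 1 using set_integral_Fubini(1)[OF i23] A by (intro set_lebesgue_integral_cong) (auto simp: case_prod_beta')
  show 4: "(LINT x:A1 \<times> A2 \<times> A3|lborel. f x) = (LINT x2:A2|lborel. LINT x1:A1|lborel. LINT x3:A3|lborel. f (x1, x2, x3))"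
    unfolding a using set_integral_Fubini(1)[OF j12] set_integral_Fubini(2)[OF j12] by simp
  show 2: "(LINT x:A1 \<times> A2 \<times> A3|lborel. f x) = (LINT x2:A2|lborel. LINT (x1, x3):A1 \<times> A3|lborel. f (x1, x2, x3))"
    unfolding 4 using set_integral_Fubini(1)[OF i13] A by (intro set_lebesgue_integral_cong) auto
  have b: "(LINT x:A1 \<times> A2 \<times> A3|lborel. f x) = (LINT x1:A1|lborel. LINT x3:A3|lborel. LINT x2:A2|lborel. f (x1, x2, x3))"
    unfolding 1 using set_integral_Fubini(2)[OF i23] A by (intro set_lebesgue_integral_cong) (auto simp: case_prod_beta')
  show 5: "(LINT x:A1 \<times> A2 \<times> A3|lborel. f x) = (LINT x3:A3|lborel. LINT x1:A1|lborel. LINT x2:A2|lborel. f (x1, x2, x3))"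
    unfolding b using set_integral_Fubini(1)[OF j13] set_integral_Fubini(2)[OF j13] by simp
  show 3: "(LINT x:A1 \<times> A2 \<times> A3|lborel. f x) = (LINT x3:A3|lborel. LINT (x1, x2):A1 \<times> A2|lborel. f (x1, x2, x3))"
    unfolding 5 using set_integral_Fubini(1)[OF i12] A by (intro set_lebesgue_integral_cong) auto
  show "(LINT x:A1 \<times> A2 \<times> A3|lborel. f x) = (LINT x3:A3|lborel. LINT x2:A2|lborel. LINT x1:A1|lborel. f (x1, x2, x3))"
    unfolding 3 using set_integral_Fubini(2)[OF i12] A by (intro set_lebesgue_integral_cong) auto
qed

lemma integrable_even_extension:
  fixes g :: "real \<Rightarrow> real"
  assumes g: "integrable lborel g" and 0: "\<And>x. x \<le> 0 \<Longrightarrow> g x = 0"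
  shows "integrable lborel (\<lambda>x. g \<bar>x\<bar>)" and "(LINT x|lborel. g \<bar>x\<bar>) = 2 * (LINT x|lborel. g x)"
proof -
  have eq: "g \<bar>x\<bar> = g x + g (0 + (-1) * x)" for x using 0 by (cases "0 < x") auto
  have g': "integrable lborel (\<lambda>x. g (0 + (-1) * x))"
    by (rule lborel_integrable_real_affine[OF g]) simp
  show "integrable lborel (\<lambda>x. g \<bar>x\<bar>)" unfolding eq using g g' by simp
  have "(LINT x|lborel. g (0 + (-1) * x)) = (LINT x|lborel. g x)"
    using lborel_integral_real_affine[of "-1" g 0] by simp
  thus "(LINT x|lborel. g \<bar>x\<bar>) = 2 * (LINT x|lborel. g x)" unfolding eq using g g' by simp
qed

text \<open>
  The decay factor in the regularity condition, seen as a function of any one of the three variables: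
  with \<open>s\<close> formed from the other two, it is symmetric in \<open>t/s\<close> and \<open>s/t\<close>.
\<close>

definition ratio_decay :: "real \<Rightarrow> real \<Rightarrow> real \<Rightarrow> real" where
  "ratio_decay \<theta> s t = (\<bar>t / s\<bar> + \<bar>s / t\<bar>) powr (- \<theta>)"

lemma ratio_decay_measurable [measurable]: "ratio_decay \<theta> s \<in> borel_measurable borel"
  unfolding ratio_decay_def[abs_def] by measurable

lemma ratio_decay_nonneg: "0 \<le> ratio_decay \<theta> s t"
  by (simp add: ratio_decay_def)

lemma ratio_decay_commute: "ratio_decay \<theta> s t = ratio_decay \<theta> t s"
  by (simp add: ratio_decay_def add.commute)

lemma ratio_decay_le:
  assumes "0 < \<theta>" "s \<noteq> 0" "t \<noteq> 0"
  shows "ratio_decay \<theta> s t \<le> \<bar>t / s\<bar> powr \<theta>"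
proof -
  have "ratio_decay \<theta> s t \<le> \<bar>s / t\<bar> powr (- \<theta>)"
    unfolding ratio_decay_def using assms by (intro powr_mono2') auto
  also have "\<dots> = \<bar>t / s\<bar> powr \<theta>"
    using assms by (simp add: powr_minus_divide powr_divide)
  finally show ?thesis .
qed

lemma ratio_decay_le_1:
  assumes "0 < \<theta>" "s \<noteq> 0" "t \<noteq> 0"
  shows "ratio_decay \<theta> s t \<le> 1"
proof (cases "\<bar>t\<bar> \<le> \<bar>s\<bar>")
  case True
  have "ratio_decay \<theta> s t \<le> \<bar>t / s\<bar> powr \<theta>" by (rule ratio_decay_le[OF assms])
  also have "\<dots> \<le> 1" using True assms by (intro powr_le1) auto
  finally show ?thesis .
next
  case False
  have "ratio_decay \<theta> s t \<le> \<bar>s / t\<bar> powr \<theta>"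
    using ratio_decay_le[OF assms(1,3,2)] by (simp add: ratio_decay_commute)
  also have "\<dots> \<le> 1" using False assms by (intro powr_le1) auto
  finally show ?thesis .
qed

lemma integrable_powr_origin_even:
  fixes c \<theta> :: real
  assumes c: "0 \<le> c" and \<theta>: "0 < \<theta>"
  shows "integrable lborel (\<lambda>t. indicator {0..c} \<bar>t\<bar> * \<bar>t\<bar> powr (\<theta> - 1))"
    and "(LINT t|lborel. indicator {0..c} \<bar>t\<bar> * \<bar>t\<bar> powr (\<theta> - 1)) = 2 * (c powr \<theta> / \<theta>)"
proof -
  have i: "integrable lborel (\<lambda>t. indicator {0..c} t * t powr (\<theta> - 1))"
    using integrable_powr_origin(1)[OF c \<theta>] by (simp add: set_integrable_def)
  have z: "indicator {0..c} x * x powr (\<theta> - 1) = 0" if "x \<le> 0" for x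
    using that by (cases "x = 0") auto
  note E = integrable_even_extension[of "\<lambda>t. indicator {0..c} t * t powr (\<theta> - 1)", OF i z]
  show "integrable lborel (\<lambda>t. indicator {0..c} \<bar>t\<bar> * \<bar>t\<bar> powr (\<theta> - 1))" by (rule E(1))
  show "(LINT t|lborel. indicator {0..c} \<bar>t\<bar> * \<bar>t\<bar> powr (\<theta> - 1)) = 2 * (c powr \<theta> / \<theta>)"
    using E(2) integrable_powr_origin(2)[OF c \<theta>] by (simp add: set_lebesgue_integral_def)
qed

lemma integrable_powr_tail_even:
  fixes c \<theta> :: real
  assumes c: "0 < c" and \<theta>: "0 < \<theta>"
  shows "integrable lborel (\<lambda>t. indicator {c..} \<bar>t\<bar> * \<bar>t\<bar> powr (- \<theta> - 1))"
    and "(LINT t|lborel. indicator {c..} \<bar>t\<bar> * \<bar>t\<bar> powr (- \<theta> - 1)) = 2 * (c powr (- \<theta>) / \<theta>)"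
proof -
  have i: "integrable lborel (\<lambda>t. indicator {c..} t * t powr (- \<theta> - 1))"
    using integrable_powr_tail(1)[OF c \<theta>] by (simp add: set_integrable_def)
  have z: "indicator {c..} x * x powr (- \<theta> - 1) = 0" if "x \<le> 0" for x
    using that c by auto
  note E = integrable_even_extension[of "\<lambda>t. indicator {c..} t * t powr (- \<theta> - 1)", OF i z]
  show "integrable lborel (\<lambda>t. indicator {c..} \<bar>t\<bar> * \<bar>t\<bar> powr (- \<theta> - 1))" by (rule E(1))
  show "(LINT t|lborel. indicator {c..} \<bar>t\<bar> * \<bar>t\<bar> powr (- \<theta> - 1)) = 2 * (c powr (- \<theta>) / \<theta>)"
    using E(2) integrable_powr_tail(2)[OF c \<theta>] by (simp add: set_lebesgue_integral_def)
qed

text \<open>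
  With respect to the dilation invariant measure \<open>dt/|t|\<close> the value of \<open>s\<close> is irrelevant, and the powers
  \<open>|t/s|\<^sup>\<theta>\<close> for \<open>|t| \<le> |s|\<close> and \<open>|s/t|\<^sup>\<theta>\<close> beyond contribute \<open>2/\<theta>\<close> each.
\<close>

lemma ratio_decay_integral:
  assumes \<theta>: "0 < \<theta>" and s: "s \<noteq> 0"
  shows "integrable lborel (\<lambda>t. ratio_decay \<theta> s t / \<bar>t\<bar>)"
    and "(LINT t|lborel. ratio_decay \<theta> s t / \<bar>t\<bar>) \<le> 4 / \<theta>"
proof -
  define c where "c = \<bar>s\<bar>"
  have c: "0 < c" using s by (simp add: c_def)
  define g where "g t = c powr (- \<theta>) * (indicator {0..c} \<bar>t\<bar> * \<bar>t\<bar> powr (\<theta> - 1))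
     + c powr \<theta> * (indicator {c..} \<bar>t\<bar> * \<bar>t\<bar> powr (- \<theta> - 1))" for t :: real
  have gi: "integrable lborel g"
    unfolding g_def[abs_def]
    by (intro Bochner_Integration.integrable_add integrable_mult_right
        integrable_powr_origin_even(1) integrable_powr_tail_even(1) c less_imp_le[OF c] \<theta>)
  have g0: "0 \<le> g t" for t by (simp add: g_def)
  have le: "ratio_decay \<theta> s t / \<bar>t\<bar> \<le> g t" for t
  proof (cases "t = 0")
    case False
    show ?thesis
    proof (cases "\<bar>t\<bar> \<le> c")
      case True
      have "ratio_decay \<theta> s t / \<bar>t\<bar> \<le> \<bar>t / s\<bar> powr \<theta> / \<bar>t\<bar>"
        by (intro divide_right_mono ratio_decay_le \<theta> s False) simp
      also have "\<dots> = c powr (- \<theta>) * \<bar>t\<bar> powr (\<theta> - 1)"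
        using False s by (simp add: c_def powr_divide powr_minus_divide powr_diff)
      also have "\<dots> \<le> g t" using True by (simp add: g_def)
      finally show ?thesis .
    next
      case ge: False
      have "ratio_decay \<theta> s t / \<bar>t\<bar> \<le> \<bar>s / t\<bar> powr \<theta> / \<bar>t\<bar>"
        unfolding ratio_decay_commute[of \<theta> s t] by (intro divide_right_mono ratio_decay_le \<theta> s False) simp
      also have "\<dots> = c powr \<theta> * \<bar>t\<bar> powr (- \<theta> - 1)"
        using False s by (simp add: c_def powr_divide powr_minus_divide powr_diff)
      also have "\<dots> \<le> g t" using ge by (simp add: g_def)
      finally show ?thesis .
    qed
  qed (simp add: g0)
  show "integrable lborel (\<lambda>t. ratio_decay \<theta> s t / \<bar>t\<bar>)"
    by (rule Bochner_Integration.integrable_bound[OF gi])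
      (use le g0 in \<open>auto simp: ratio_decay_nonneg\<close>)
  have "(LINT t|lborel. ratio_decay \<theta> s t / \<bar>t\<bar>) \<le> (LINT t|lborel. g t)"
    by (rule integral_mono'[OF gi le g0])
  also have "\<dots> = c powr (- \<theta>) * (2 * (c powr \<theta> / \<theta>)) + c powr \<theta> * (2 * (c powr (- \<theta>) / \<theta>))"
    unfolding g_def using c \<theta>
    by (subst Bochner_Integration.integral_add)
      (auto intro!: integrable_mult_right integrable_powr_origin_even(1) integrable_powr_tail_even(1)
        simp: integrable_powr_origin_even(2) integrable_powr_tail_even(2))
  also have "\<dots> = 4 / \<theta>"
    using c by (simp add: powr_minus field_simps)
  finally show "(LINT t|lborel. ratio_decay \<theta> s t / \<bar>t\<bar>) \<le> 4 / \<theta>" .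
qed

lemma decay_weighted_integral:
  fixes f w :: "real \<Rightarrow> complex"
  assumes [measurable]: "f \<in> borel_measurable borel" "w \<in> borel_measurable borel"
    and w: "\<And>t. norm (w t) \<le> 1" and \<theta>: "0 < \<theta>" and s: "s \<noteq> 0" and D: "0 \<le> D"
    and f: "\<And>t. t \<noteq> 0 \<Longrightarrow> norm (f t) \<le> D * (ratio_decay \<theta> s t / \<bar>t\<bar>)"
    and e: "0 < e"
  shows "set_integrable lborel (annulus e n) (\<lambda>t. w t * f t)"
    and "norm (LINT t:annulus e n|lborel. w t * f t) \<le> 4 * D / \<theta>"
proof -
  note r = ratio_decay_integral[OF \<theta> s]
  have le: "norm (w t * f t) \<le> D * (ratio_decay \<theta> s t / \<bar>t\<bar>)" if "t \<in> annulus e n" for t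
  proof -
    have "norm (w t * f t) \<le> 1 * (D * (ratio_decay \<theta> s t / \<bar>t\<bar>))"
      unfolding norm_mult using annulusD[OF e that] by (intro mult_mono w f) auto
    thus ?thesis by simp
  qed
  have i: "integrable lborel (\<lambda>t. D * (ratio_decay \<theta> s t / \<bar>t\<bar>))" using r(1) by (rule integrable_mult_right)
  have i': "set_integrable lborel (annulus e n) (\<lambda>t. D * (ratio_decay \<theta> s t / \<bar>t\<bar>))"
    unfolding set_integrable_def by (rule integrable_mult_indicator[OF _ i]) simp
  show "set_integrable lborel (annulus e n) (\<lambda>t. w t * f t)"
    unfolding set_integrable_def
    by (rule Bochner_Integration.integrable_bound[OF i])
      (use le D in \<open>auto simp: indicator_def ratio_decay_nonneg\<close>)
  have "norm (LINT t:annulus e n|lborel. w t * f t) \<le> (LINT t:annulus e n|lborel. D * (ratio_decay \<theta> s t / \<bar>t\<bar>))"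
    by (rule set_integral_norm_bound_le[OF i' le])
  also have "\<dots> \<le> (LINT t|lborel. D * (ratio_decay \<theta> s t / \<bar>t\<bar>))"
    unfolding set_lebesgue_integral_def
    by (rule integral_mono'[OF i]) (use D in \<open>auto simp: indicator_def ratio_decay_nonneg\<close>)
  also have "\<dots> \<le> D * (4 / \<theta>)"
    unfolding integral_mult_right_zero using r(2) D by (rule mult_left_mono)
  finally show "norm (LINT t:annulus e n|lborel. w t * f t) \<le> 4 * D / \<theta>" by (simp add: mult.commute)
qed

text \<open>
  Integrating out \<open>t\<close> absolutely costs a constant factor in each of the four bounds. The variables
  \<open>x, y, t\<close> will be \<open>x\<^sub>1, x\<^sub>2, x\<^sub>3\<close> in three different orders.
\<close>

lemma slice_cz_kernel2:
  fixes L :: "real \<Rightarrow> real \<Rightarrow> real \<Rightarrow> complex" and s :: "real \<Rightarrow> real \<Rightarrow> real" and w :: "real \<Rightarrow> complex"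
  assumes Lm: "(\<lambda>(x, y, t). L x y t) \<in> borel_measurable borel"
    and [measurable]: "w \<in> borel_measurable borel" and w: "\<And>t. norm (w t) \<le> 1"
    and \<theta>2: "0 < \<theta>2" and C: "0 \<le> C" and e: "0 < e"
    and s: "\<And>x y. x \<noteq> 0 \<Longrightarrow> y \<noteq> 0 \<Longrightarrow> s x y \<noteq> 0"
    and L00: "\<And>x y t. x \<noteq> 0 \<Longrightarrow> y \<noteq> 0 \<Longrightarrow> t \<noteq> 0 \<Longrightarrow>
      norm (L x y t) \<le> C / (\<bar>x\<bar> * \<bar>y\<bar>) * (ratio_decay \<theta>2 (s x y) t / \<bar>t\<bar>)"
    and L10: "\<And>x y t h. 2 * \<bar>h\<bar> \<le> \<bar>x\<bar> \<Longrightarrow> 0 < \<bar>h\<bar> \<Longrightarrow> y \<noteq> 0 \<Longrightarrow> t \<noteq> 0 \<Longrightarrow>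
      norm (L (x + h) y t - L x y t) \<le> C * \<bar>h\<bar> powr \<theta> / (\<bar>x\<bar> powr (\<theta> + 1) * \<bar>y\<bar>) * (ratio_decay \<theta>2 (s x y) t / \<bar>t\<bar>)"
    and L01: "\<And>x y t k. x \<noteq> 0 \<Longrightarrow> 2 * \<bar>k\<bar> \<le> \<bar>y\<bar> \<Longrightarrow> 0 < \<bar>k\<bar> \<Longrightarrow> t \<noteq> 0 \<Longrightarrow>
      norm (L x (y + k) t - L x y t) \<le> C * \<bar>k\<bar> powr \<theta> / (\<bar>x\<bar> * \<bar>y\<bar> powr (\<theta> + 1)) * (ratio_decay \<theta>2 (s x y) t / \<bar>t\<bar>)"
    and L11: "\<And>x y t h k. 2 * \<bar>h\<bar> \<le> \<bar>x\<bar> \<Longrightarrow> 0 < \<bar>h\<bar> \<Longrightarrow> 2 * \<bar>k\<bar> \<le> \<bar>y\<bar> \<Longrightarrow> 0 < \<bar>k\<bar> \<Longrightarrow> t \<noteq> 0 \<Longrightarrow>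
      norm ((L (x + h) (y + k) t - L (x + h) y t) - (L x (y + k) t - L x y t))
        \<le> C * \<bar>h\<bar> powr \<theta> * \<bar>k\<bar> powr \<theta> / (\<bar>x\<bar> powr (\<theta> + 1) * \<bar>y\<bar> powr (\<theta> + 1)) * (ratio_decay \<theta>2 (s x y) t / \<bar>t\<bar>)"
  shows "cz_kernel2 \<theta> (4 * C / \<theta>2) (\<lambda>x y. LINT t:annulus e n|lborel. w t * L x y t)"
proof -
  define \<psi> where "\<psi> x y = (LINT t:annulus e n|lborel. w t * L x y t)" for x y
  have Lm'[measurable]: "(\<lambda>(x, y, t). L x y t) \<in> borel_measurable (borel \<Otimes>\<^sub>M borel \<Otimes>\<^sub>M borel)"
    using Lm by (simp add: borel_prod)
  have Lp: "(\<lambda>p. L (f p) (g p) (h p)) \<in> borel_measurable M"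
    if "f \<in> borel_measurable M" "g \<in> borel_measurable M" "h \<in> borel_measurable M"
    for f g h and M :: "'z measure"
  proof -
    have "(\<lambda>p. (f p, g p, h p)) \<in> M \<rightarrow>\<^sub>M borel \<Otimes>\<^sub>M borel \<Otimes>\<^sub>M borel" using that by measurable
    from measurable_compose[OF this Lm'] show ?thesis by simp
  qed
  have Lt[measurable]: "(\<lambda>t. L x y t) \<in> borel_measurable borel" for x y by (rule Lp) auto
  have \<psi>m[measurable]: "case_prod \<psi> \<in> borel_measurable (borel \<Otimes>\<^sub>M borel)"
  proof -
    have "(\<lambda>p. LINT t:annulus e n|lborel. w t * L (fst p) (snd p) t) \<in> borel_measurable (borel :: (real \<times> real) measure)"
    proof (rule set_integral_measurable)
      have "(\<lambda>q. L (fst (fst q)) (snd (fst q)) (snd q)) \<in> borel_measurable ((borel :: (real \<times> real) measure) \<Otimes>\<^sub>M (borel :: real measure))"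
        by (rule Lp) (auto simp: borel_prod[symmetric])
      thus "(\<lambda>(p, t). w t * L (fst p) (snd p) t) \<in> borel_measurable ((borel :: (real \<times> real) measure) \<Otimes>\<^sub>M (borel :: real measure))"
        unfolding case_prod_beta' by measurable
    qed simp
    thus ?thesis by (simp add: \<psi>_def case_prod_beta' borel_prod)
  qed
  have \<psi>x[measurable]: "(\<lambda>x. \<psi> x y) \<in> borel_measurable borel" for y
    using measurable_compose[OF _ \<psi>m, of "\<lambda>x. (x, y)" borel] by simp
  have i: "set_integrable lborel (annulus e n) (\<lambda>t. w t * L x y t)" if "x \<noteq> 0" "y \<noteq> 0" for x y
    using that C
    by (intro decay_weighted_integral(1)[OF _ _ w \<theta>2 s[OF that] _ _ e, where D = "C / (\<bar>x\<bar> * \<bar>y\<bar>)"] L00) auto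
  have \<psi>00: "norm (\<psi> x y) \<le> 4 * C / \<theta>2 / \<bar>y\<bar> / \<bar>x\<bar>" if "x \<noteq> 0" "y \<noteq> 0" for x y
  proof -
    have "norm (\<psi> x y) \<le> 4 * (C / (\<bar>x\<bar> * \<bar>y\<bar>)) / \<theta>2"
      unfolding \<psi>_def using that C by (intro decay_weighted_integral(2)[OF _ _ w \<theta>2 s[OF that] _ _ e] L00) auto
    thus ?thesis by (simp add: field_simps)
  qed
  have d1: "\<psi> (x + h) y - \<psi> x y = (LINT t:annulus e n|lborel. w t * (L (x + h) y t - L x y t))"
    if "2 * \<bar>h\<bar> \<le> \<bar>x\<bar>" "0 < \<bar>h\<bar>" "y \<noteq> 0" for x y h
  proof -
    have "x \<noteq> 0" "x + h \<noteq> 0" using that by auto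
    thus ?thesis unfolding \<psi>_def right_diff_distrib
      by (intro set_integral_diff(2)[symmetric] i that)
  qed
  have d2: "\<psi> x (y + k) - \<psi> x y = (LINT t:annulus e n|lborel. w t * (L x (y + k) t - L x y t))"
    and i2: "set_integrable lborel (annulus e n) (\<lambda>t. w t * (L x (y + k) t - L x y t))"
    if "x \<noteq> 0" "2 * \<bar>k\<bar> \<le> \<bar>y\<bar>" "0 < \<bar>k\<bar>" for x y k
  proof -
    have y: "y \<noteq> 0" "y + k \<noteq> 0" using that by auto
    thus "\<psi> x (y + k) - \<psi> x y = (LINT t:annulus e n|lborel. w t * (L x (y + k) t - L x y t))"
      unfolding \<psi>_def right_diff_distrib by (intro set_integral_diff(2)[symmetric] i that)
    show "set_integrable lborel (annulus e n) (\<lambda>t. w t * (L x (y + k) t - L x y t))"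
      unfolding right_diff_distrib using y by (intro set_integral_diff(1) i that)
  qed
  have "cz_kernel2 \<theta> (4 * C / \<theta>2) \<psi>"
    unfolding cz_kernel2_def
  proof (intro conjI allI impI)
    show "case_prod \<psi> \<in> borel_measurable borel" using \<psi>m by (simp add: borel_prod)
  next
    fix y :: real assume y: "y \<noteq> 0"
    show "cz_kernel \<theta> (4 * C / \<theta>2 / \<bar>y\<bar>) (\<lambda>x. \<psi> x y)"
      unfolding cz_kernel_def
    proof (intro conjI allI impI)
      show "(\<lambda>x. \<psi> x y) \<in> borel_measurable borel" by (rule \<psi>x)
      show "norm (\<psi> x y) \<le> 4 * C / \<theta>2 / \<bar>y\<bar> / \<bar>x\<bar>" if "x \<noteq> 0" for x by (rule \<psi>00[OF that y])
      fix x h :: real assume "2 * \<bar>h\<bar> \<le> \<bar>x\<bar> \<and> 0 < \<bar>h\<bar>"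
      hence h: "2 * \<bar>h\<bar> \<le> \<bar>x\<bar>" "0 < \<bar>h\<bar>" "x \<noteq> 0" by auto
      have "norm (\<psi> (x + h) y - \<psi> x y) \<le> 4 * (C * \<bar>h\<bar> powr \<theta> / (\<bar>x\<bar> powr (\<theta> + 1) * \<bar>y\<bar>)) / \<theta>2"
        unfolding d1[OF h(1,2) y] using h y C
        by (intro decay_weighted_integral(2)[OF _ _ w \<theta>2 s[OF h(3) y] _ _ e] L10) auto
      thus "norm (\<psi> (x + h) y - \<psi> x y) \<le> 4 * C / \<theta>2 / \<bar>y\<bar> * \<bar>h\<bar> powr \<theta> / \<bar>x\<bar> powr (\<theta> + 1)"
        by (simp add: field_simps)
    qed
  next
    fix y k :: real assume "2 * \<bar>k\<bar> \<le> \<bar>y\<bar> \<and> 0 < \<bar>k\<bar>"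
    hence k: "2 * \<bar>k\<bar> \<le> \<bar>y\<bar>" "0 < \<bar>k\<bar>" "y \<noteq> 0" by auto
    show "cz_kernel \<theta> (4 * C / \<theta>2 * \<bar>k\<bar> powr \<theta> / \<bar>y\<bar> powr (\<theta> + 1)) (\<lambda>x. \<psi> x (y + k) - \<psi> x y)"
      unfolding cz_kernel_def
    proof (intro conjI allI impI)
      show "(\<lambda>x. \<psi> x (y + k) - \<psi> x y) \<in> borel_measurable borel" by measurable
    next
      fix x :: real assume x: "x \<noteq> 0"
      have "norm (\<psi> x (y + k) - \<psi> x y) \<le> 4 * (C * \<bar>k\<bar> powr \<theta> / (\<bar>x\<bar> * \<bar>y\<bar> powr (\<theta> + 1))) / \<theta>2"
        unfolding d2[OF x k(1,2)] using x k C
        by (intro decay_weighted_integral(2)[OF _ _ w \<theta>2 s[OF x k(3)] _ _ e] L01) auto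
      thus "norm (\<psi> x (y + k) - \<psi> x y) \<le> 4 * C / \<theta>2 * \<bar>k\<bar> powr \<theta> / \<bar>y\<bar> powr (\<theta> + 1) / \<bar>x\<bar>"
        by (simp add: field_simps)
    next
      fix x h :: real assume "2 * \<bar>h\<bar> \<le> \<bar>x\<bar> \<and> 0 < \<bar>h\<bar>"
      hence h: "2 * \<bar>h\<bar> \<le> \<bar>x\<bar>" "0 < \<bar>h\<bar>" "x \<noteq> 0" "x + h \<noteq> 0" by auto
      have eq: "(\<psi> (x + h) (y + k) - \<psi> (x + h) y) - (\<psi> x (y + k) - \<psi> x y)
          = (LINT t:annulus e n|lborel. w t * ((L (x + h) (y + k) t - L (x + h) y t) - (L x (y + k) t - L x y t)))"
        unfolding d2[OF h(3) k(1,2)] d2[OF h(4) k(1,2)]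
          right_diff_distrib[of "w _" "L (x + h) (y + k) _ - L (x + h) y _"]
        by (intro set_integral_diff(2)[symmetric] i2 h k)
      have "norm ((\<psi> (x + h) (y + k) - \<psi> (x + h) y) - (\<psi> x (y + k) - \<psi> x y))
          \<le> 4 * (C * \<bar>h\<bar> powr \<theta> * \<bar>k\<bar> powr \<theta> / (\<bar>x\<bar> powr (\<theta> + 1) * \<bar>y\<bar> powr (\<theta> + 1))) / \<theta>2"
        unfolding eq using h k C
        by (intro decay_weighted_integral(2)[OF _ _ w \<theta>2 s[OF h(3) k(3)] _ _ e] L11) auto
      thus "norm ((\<psi> (x + h) (y + k) - \<psi> (x + h) y) - (\<psi> x (y + k) - \<psi> x y))
          \<le> 4 * C / \<theta>2 * \<bar>k\<bar> powr \<theta> / \<bar>y\<bar> powr (\<theta> + 1) * \<bar>h\<bar> powr \<theta> / \<bar>x\<bar> powr (\<theta> + 1)"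
        by (simp add: field_simps)
    qed
  qed
  thus ?thesis by (simp add: \<psi>_def[abs_def])
qed

lemma annulus_exhausts:
  assumes e: "\<And>k. 0 < e k" "e \<longlonglongrightarrow> 0" and n: "filterlim n at_top sequentially"
  shows "\<forall>\<^sub>F k in sequentially. x \<in> annulus (e k) (n k) \<longleftrightarrow> x \<in> - {0 :: real}"
proof (cases "x = 0")
  case True
  have "x \<notin> annulus (e k) (n k)" for k using True e(1)[of k] by (auto simp: annulus_def)
  thus ?thesis using True by simp
next
  case False
  hence "0 < \<bar>x\<bar>" by simp
  have nk: "\<forall>\<^sub>F k in sequentially. \<bar>x\<bar> < n k" using n by (simp add: filterlim_at_top_dense)
  show ?thesis using order_tendstoD(2)[OF e(2) \<open>0 < \<bar>x\<bar>\<close>] nk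
    by eventually_elim (use False in \<open>auto simp: annulus_def\<close>)
qed

lemma slice_convergent:
  fixes f w :: "real \<Rightarrow> complex"
  assumes [measurable]: "f \<in> borel_measurable borel" "w \<in> borel_measurable borel"
    and w: "\<And>t. norm (w t) \<le> 1" and \<theta>: "0 < \<theta>" and s: "s \<noteq> 0" and D: "0 \<le> D"
    and f: "\<And>t. t \<noteq> 0 \<Longrightarrow> norm (f t) \<le> D * (ratio_decay \<theta> s t / \<bar>t\<bar>)"
    and e: "\<And>k. 0 < e k" "e \<longlonglongrightarrow> 0" and n: "filterlim n at_top sequentially"
  shows "convergent (\<lambda>k. LINT t:annulus (e k) (n k)|lborel. w t * f t)"
proof (rule convergentI, rule set_integral_dominated_convergence)
  show "integrable lborel (\<lambda>t. D * (ratio_decay \<theta> s t / \<bar>t\<bar>))"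
    by (intro integrable_mult_right ratio_decay_integral \<theta> s)
  show "norm (w t * f t) \<le> D * (ratio_decay \<theta> s t / \<bar>t\<bar>)" if "t \<in> annulus (e k) (n k)" for k t
  proof -
    have "norm (w t * f t) \<le> 1 * (D * (ratio_decay \<theta> s t / \<bar>t\<bar>))"
      unfolding norm_mult using annulusD[OF e(1) that] by (intro mult_mono w f) auto
    thus ?thesis by simp
  qed
  show "0 \<le> D * (ratio_decay \<theta> s t / \<bar>t\<bar>)" for t using D by (simp add: ratio_decay_nonneg)
  show "AE t in lborel. (\<forall>\<^sub>F k in sequentially. t \<in> annulus (e k) (n k) \<longleftrightarrow> t \<in> - {0}) \<and>
      (t \<in> - {0} \<longrightarrow> (\<lambda>k. w t * f t) \<longlonglongrightarrow> w t * f t)"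
    using annulus_exhausts[OF e n] by simp
qed measurable

section \<open>Kernels adapted to Zygmund dilations\<close>

text \<open>
  The cancellation conditions bound the integral of a difference; this passes to the difference of
  integrals.
\<close>

lemma integral_cz_kernel:
  fixes G :: "real \<Rightarrow> real \<times> real \<Rightarrow> complex"
  assumes Gm: "case_prod G \<in> borel_measurable (borel \<Otimes>\<^sub>M borel)" and S: "S \<in> sets borel" "bounded S"
    and bounded: "\<And>t. t \<noteq> 0 \<Longrightarrow> \<exists>D. \<forall>p\<in>S. norm (G t p) \<le> D"
    and size: "\<And>t. t \<noteq> 0 \<Longrightarrow> norm (LINT p:S|lborel. G t p) \<le> B / \<bar>t\<bar>"
    and smooth: "\<And>t h. 2 * \<bar>h\<bar> \<le> \<bar>t\<bar> \<Longrightarrow> 0 < \<bar>h\<bar> \<Longrightarrow>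
      norm (LINT p:S|lborel. G (t + h) p - G t p) \<le> B * \<bar>h\<bar> powr \<theta> / \<bar>t\<bar> powr (\<theta> + 1)"
  shows "cz_kernel \<theta> B (\<lambda>t. LINT p:S|lborel. G t p)"
  unfolding cz_kernel_def
proof (intro conjI allI impI)
  show "(\<lambda>t. LINT p:S|lborel. G t p) \<in> borel_measurable borel"
    by (rule set_integral_measurable[OF Gm S(1)])
  show "norm (LINT p:S|lborel. G t p) \<le> B / \<bar>t\<bar>" if "t \<noteq> 0" for t by (rule size[OF that])
  have i: "set_integrable lborel S (G t)" if "t \<noteq> 0" for t
  proof -
    have "G t \<in> borel_measurable borel" using measurable_compose[OF _ Gm, of "Pair t" borel] by simp
    thus ?thesis using bounded[OF that] set_integrable_bounded_on[OF _ S] by blast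
  qed
  fix t h :: real assume h: "2 * \<bar>h\<bar> \<le> \<bar>t\<bar> \<and> 0 < \<bar>h\<bar>"
  hence "t \<noteq> 0" "t + h \<noteq> 0" by auto
  from set_integral_diff(2)[OF i[OF this(2)] i[OF this(1)]] smooth[of h t] h
  show "norm ((LINT p:S|lborel. G (t + h) p) - (LINT p:S|lborel. G t p)) \<le> B * \<bar>h\<bar> powr \<theta> / \<bar>t\<bar> powr (\<theta> + 1)"
    by simp
qed

text \<open>
  The kernel vanishes on the coordinate planes, so that its continuity elsewhere makes it Borel
  measurable on the whole space. A general kernel is replaced by one of this kind at the end.
\<close>

locale zygmund_kernel =
  fixes \<theta> \<theta>2 C :: real and K :: "R3 \<Rightarrow> complex"
  assumes theta: "0 < \<theta>" "0 < \<theta>2"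
    and regular: "regularity \<theta> \<theta>2 C K"
    and planes: "\<And>x1 x2 x3. x1 = 0 \<or> x2 = 0 \<or> x3 = 0 \<Longrightarrow> K (x1, x2, x3) = 0"
    and cancel_a: "cancellation_a C K"
    and cancel_b: "cancellation_b \<theta> C K"
    and cancel_c: "cancellation_c \<theta> C K"
    and cancel_d: "cancellation_d \<theta> C K"
begin

abbreviation decay :: "real \<Rightarrow> real \<Rightarrow> real \<Rightarrow> real" where
  "decay x1 x2 x3 \<equiv> ratio_decay \<theta>2 (x1 * x2) x3"

abbreviation integral23 :: "real \<Rightarrow> real \<Rightarrow> real \<Rightarrow> real \<Rightarrow> real \<Rightarrow> complex" where
  "integral23 d2 m2 d3 m3 x1 \<equiv> LINT (x2, x3):annulus d2 m2 \<times> annulus d3 m3|lborel. K (x1, x2, x3)"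

abbreviation integral13 :: "real \<Rightarrow> real \<Rightarrow> real \<Rightarrow> real \<Rightarrow> real \<Rightarrow> complex" where
  "integral13 d1 m1 d3 m3 x2 \<equiv> LINT (x1, x3):annulus d1 m1 \<times> annulus d3 m3|lborel. K (x1, x2, x3)"

abbreviation integral12 :: "real \<Rightarrow> real \<Rightarrow> real \<Rightarrow> real \<Rightarrow> real \<Rightarrow> complex" where
  "integral12 d1 m1 d2 m2 x3 \<equiv> LINT (x1, x2):annulus d1 m1 \<times> annulus d2 m2|lborel. K (x1, x2, x3)"

abbreviation slice1 :: "(real \<Rightarrow> complex) \<Rightarrow> real \<Rightarrow> real \<Rightarrow> real \<Rightarrow> real \<Rightarrow> complex" where
  "slice1 w e n x2 x3 \<equiv> LINT x1:annulus e n|lborel. w x1 * K (x1, x2, x3)"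

abbreviation slice2 :: "(real \<Rightarrow> complex) \<Rightarrow> real \<Rightarrow> real \<Rightarrow> real \<Rightarrow> real \<Rightarrow> complex" where
  "slice2 w e n x1 x3 \<equiv> LINT x2:annulus e n|lborel. w x2 * K (x1, x2, x3)"

abbreviation slice3 :: "(real \<Rightarrow> complex) \<Rightarrow> real \<Rightarrow> real \<Rightarrow> real \<Rightarrow> real \<Rightarrow> complex" where
  "slice3 w e n x1 x2 \<equiv> LINT x3:annulus e n|lborel. w x3 * K (x1, x2, x3)"

text \<open>
  The regularity condition asks for increments in all three variables. Where no
  difference is taken, half of the variable serves as the increment.
\<close>

lemma difference_bound:
  assumes "\<alpha> \<in> {0, 1}" "\<beta> \<in> {0, 1}" "\<gamma> \<in> {0, 1}" "\<beta> + \<gamma> \<le> 1 \<or> \<alpha> + \<gamma> \<le> 1"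
    and h: "2 * \<bar>h1\<bar> \<le> \<bar>x1\<bar>" "0 < \<bar>h1\<bar>" "2 * \<bar>h2\<bar> \<le> \<bar>x2\<bar>" "0 < \<bar>h2\<bar>" "2 * \<bar>h3\<bar> \<le> \<bar>x3\<bar>" "0 < \<bar>h3\<bar>"
  shows "norm (diff1 \<alpha> h1 (diff2 \<beta> h2 (diff3 \<gamma> h3 K)) (x1, x2, x3))
    \<le> C * \<bar>h1\<bar> powr (real \<alpha> * \<theta>) * \<bar>h2\<bar> powr (real \<beta> * \<theta>) * \<bar>h3\<bar> powr (real \<gamma> * \<theta>) /
       (\<bar>x1\<bar> powr (real \<alpha> * \<theta> + 1) * \<bar>x2\<bar> powr (real \<beta> * \<theta> + 1) * \<bar>x3\<bar> powr (real \<gamma> * \<theta> + 1)) * decay x1 x2 x3"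
proof -
  have "norm (diff1 \<alpha> h1 (diff2 \<beta> h2 (diff3 \<gamma> h3 K)) (x1, x2, x3))
    \<le> C * \<bar>h1\<bar> powr (real \<alpha> * \<theta>) * \<bar>h2\<bar> powr (real \<beta> * \<theta>) * \<bar>h3\<bar> powr (real \<gamma> * \<theta>) /
       (\<bar>x1\<bar> powr (real \<alpha> * \<theta> + 1) * \<bar>x2\<bar> powr (real \<beta> * \<theta> + 1) * \<bar>x3\<bar> powr (real \<gamma> * \<theta> + 1) *
        (\<bar>x1 * x2 / x3\<bar> + \<bar>x3 / (x1 * x2)\<bar>) powr \<theta>2)"
    using assms by (intro regular[unfolded regularity_def, rule_format]) auto
  also have "(\<bar>x1 * x2 / x3\<bar> + \<bar>x3 / (x1 * x2)\<bar>) powr \<theta>2 = inverse (decay x1 x2 x3)"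
    by (simp add: ratio_decay_def powr_minus add.commute)
  finally show ?thesis by (simp add: divide_inverse mult_ac)
qed

lemma K_size:
  assumes "x1 \<noteq> 0" "x2 \<noteq> 0" "x3 \<noteq> 0"
  shows "norm (K (x1, x2, x3)) \<le> C / (\<bar>x1\<bar> * \<bar>x2\<bar> * \<bar>x3\<bar>) * decay x1 x2 x3"
  using difference_bound[of 0 0 0 "x1 / 2" x1 "x2 / 2" x2 "x3 / 2" x3] assms
  by (simp add: diff1_def diff2_def diff3_def)

lemma K_diff1:
  assumes "2 * \<bar>h\<bar> \<le> \<bar>x1\<bar>" "0 < \<bar>h\<bar>" "x2 \<noteq> 0" "x3 \<noteq> 0"
  shows "norm (K (x1 + h, x2, x3) - K (x1, x2, x3))
    \<le> C * \<bar>h\<bar> powr \<theta> / (\<bar>x1\<bar> powr (\<theta> + 1) * \<bar>x2\<bar> * \<bar>x3\<bar>) * decay x1 x2 x3"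
  using difference_bound[of 1 0 0 h x1 "x2 / 2" x2 "x3 / 2" x3] assms
  by (simp add: diff1_def diff2_def diff3_def)

lemma K_diff2:
  assumes "x1 \<noteq> 0" "2 * \<bar>h\<bar> \<le> \<bar>x2\<bar>" "0 < \<bar>h\<bar>" "x3 \<noteq> 0"
  shows "norm (K (x1, x2 + h, x3) - K (x1, x2, x3))
    \<le> C * \<bar>h\<bar> powr \<theta> / (\<bar>x1\<bar> * \<bar>x2\<bar> powr (\<theta> + 1) * \<bar>x3\<bar>) * decay x1 x2 x3"
  using difference_bound[of 0 1 0 "x1 / 2" x1 h x2 "x3 / 2" x3] assms
  by (simp add: diff1_def diff2_def diff3_def norm_minus_commute)

lemma K_diff3:
  assumes "x1 \<noteq> 0" "x2 \<noteq> 0" "2 * \<bar>h\<bar> \<le> \<bar>x3\<bar>" "0 < \<bar>h\<bar>"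
  shows "norm (K (x1, x2, x3 + h) - K (x1, x2, x3))
    \<le> C * \<bar>h\<bar> powr \<theta> / (\<bar>x1\<bar> * \<bar>x2\<bar> * \<bar>x3\<bar> powr (\<theta> + 1)) * decay x1 x2 x3"
  using difference_bound[of 0 0 1 "x1 / 2" x1 "x2 / 2" x2 h x3] assms
  by (simp add: diff1_def diff2_def diff3_def)

lemma K_diff12:
  assumes "2 * \<bar>h\<bar> \<le> \<bar>x1\<bar>" "0 < \<bar>h\<bar>" "2 * \<bar>k\<bar> \<le> \<bar>x2\<bar>" "0 < \<bar>k\<bar>" "x3 \<noteq> 0"
  shows "norm ((K (x1 + h, x2 + k, x3) - K (x1 + h, x2, x3)) - (K (x1, x2 + k, x3) - K (x1, x2, x3)))
    \<le> C * \<bar>h\<bar> powr \<theta> * \<bar>k\<bar> powr \<theta> / (\<bar>x1\<bar> powr (\<theta> + 1) * \<bar>x2\<bar> powr (\<theta> + 1) * \<bar>x3\<bar>) * decay x1 x2 x3"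
proof -
  have "diff1 1 h (diff2 1 k (diff3 0 (x3 / 2) K)) (x1, x2, x3)
      = - ((K (x1 + h, x2 + k, x3) - K (x1 + h, x2, x3)) - (K (x1, x2 + k, x3) - K (x1, x2, x3)))"
    by (simp add: diff1_def diff2_def diff3_def)
  hence "norm (diff1 1 h (diff2 1 k (diff3 0 (x3 / 2) K)) (x1, x2, x3))
      = norm ((K (x1 + h, x2 + k, x3) - K (x1 + h, x2, x3)) - (K (x1, x2 + k, x3) - K (x1, x2, x3)))"
    by (simp only: norm_minus_cancel)
  thus ?thesis using difference_bound[of 1 1 0 h x1 k x2 "x3 / 2" x3] assms by simp
qed

lemma K_diff13:
  assumes "2 * \<bar>h\<bar> \<le> \<bar>x1\<bar>" "0 < \<bar>h\<bar>" "x2 \<noteq> 0" "2 * \<bar>k\<bar> \<le> \<bar>x3\<bar>" "0 < \<bar>k\<bar>"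
  shows "norm ((K (x1 + h, x2, x3 + k) - K (x1 + h, x2, x3)) - (K (x1, x2, x3 + k) - K (x1, x2, x3)))
    \<le> C * \<bar>h\<bar> powr \<theta> * \<bar>k\<bar> powr \<theta> / (\<bar>x1\<bar> powr (\<theta> + 1) * \<bar>x2\<bar> * \<bar>x3\<bar> powr (\<theta> + 1)) * decay x1 x2 x3"
proof -
  have "diff1 1 h (diff2 0 (x2 / 2) (diff3 1 k K)) (x1, x2, x3)
      = - ((K (x1 + h, x2, x3 + k) - K (x1 + h, x2, x3)) - (K (x1, x2, x3 + k) - K (x1, x2, x3)))"
    by (simp add: diff1_def diff2_def diff3_def)
  hence "norm (diff1 1 h (diff2 0 (x2 / 2) (diff3 1 k K)) (x1, x2, x3))
      = norm ((K (x1 + h, x2, x3 + k) - K (x1 + h, x2, x3)) - (K (x1, x2, x3 + k) - K (x1, x2, x3)))"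
    by (simp only: norm_minus_cancel)
  thus ?thesis using difference_bound[of 1 0 1 h x1 "x2 / 2" x2 k x3] assms by simp
qed

lemma K_diff23:
  assumes "x1 \<noteq> 0" "2 * \<bar>h\<bar> \<le> \<bar>x2\<bar>" "0 < \<bar>h\<bar>" "2 * \<bar>k\<bar> \<le> \<bar>x3\<bar>" "0 < \<bar>k\<bar>"
  shows "norm ((K (x1, x2 + h, x3 + k) - K (x1, x2 + h, x3)) - (K (x1, x2, x3 + k) - K (x1, x2, x3)))
    \<le> C * \<bar>h\<bar> powr \<theta> * \<bar>k\<bar> powr \<theta> / (\<bar>x1\<bar> * \<bar>x2\<bar> powr (\<theta> + 1) * \<bar>x3\<bar> powr (\<theta> + 1)) * decay x1 x2 x3"
proof -
  have "diff1 0 (x1 / 2) (diff2 1 h (diff3 1 k K)) (x1, x2, x3)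
      = - ((K (x1, x2 + h, x3 + k) - K (x1, x2 + h, x3)) - (K (x1, x2, x3 + k) - K (x1, x2, x3)))"
    by (simp add: diff1_def diff2_def diff3_def)
  hence "norm (diff1 0 (x1 / 2) (diff2 1 h (diff3 1 k K)) (x1, x2, x3))
      = norm ((K (x1, x2 + h, x3 + k) - K (x1, x2 + h, x3)) - (K (x1, x2, x3 + k) - K (x1, x2, x3)))"
    by (simp only: norm_minus_cancel)
  thus ?thesis using difference_bound[of 0 1 1 "x1 / 2" x1 h x2 k x3] assms by simp
qed

lemma C_nonneg: "0 \<le> C"
proof -
  have "0 < decay 1 1 1" by (simp add: ratio_decay_def)
  moreover have "0 \<le> C * decay 1 1 1"
    using order_trans[OF norm_ge_zero K_size[of 1 1 1]] by simp
  ultimately show ?thesis by (simp add: zero_le_mult_iff)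
qed

lemma decay_le_1: "x1 \<noteq> 0 \<Longrightarrow> x2 \<noteq> 0 \<Longrightarrow> x3 \<noteq> 0 \<Longrightarrow> decay x1 x2 x3 \<le> 1"
  by (intro ratio_decay_le_1 theta) auto

text \<open>
  Move one coordinate at a time; the Hoelder bounds for the single differences are locally uniform.
\<close>

lemma K_isCont:
  assumes "a \<noteq> 0" "b \<noteq> 0" "c \<noteq> 0"
  shows "isCont K (a, b, c)"
proof -
  define E where "E y = C * \<bar>fst y - a\<bar> powr \<theta> / (\<bar>a\<bar> powr (\<theta> + 1) * \<bar>fst (snd y)\<bar> * \<bar>snd (snd y)\<bar>)
     + C * \<bar>fst (snd y) - b\<bar> powr \<theta> / (\<bar>a\<bar> * \<bar>b\<bar> powr (\<theta> + 1) * \<bar>snd (snd y)\<bar>)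
     + C * \<bar>snd (snd y) - c\<bar> powr \<theta> / (\<bar>a\<bar> * \<bar>b\<bar> * \<bar>c\<bar> powr (\<theta> + 1))" for y :: R3
  let ?F = "at (a, b, c)"
  have lims: "((\<lambda>y. fst y) \<longlongrightarrow> a) ?F" "((\<lambda>y. fst (snd y)) \<longlongrightarrow> b) ?F" "((\<lambda>y. snd (snd y)) \<longlongrightarrow> c) ?F"
    using tendsto_fst[OF tendsto_ident_at[of "(a, b, c)" UNIV]]
      tendsto_fst[OF tendsto_snd[OF tendsto_ident_at[of "(a, b, c)" UNIV]]]
      tendsto_snd[OF tendsto_snd[OF tendsto_ident_at[of "(a, b, c)" UNIV]]] by simp_all
  have p0: "((\<lambda>y. \<bar>g y - l\<bar> powr \<theta>) \<longlongrightarrow> 0) ?F" if "(g \<longlongrightarrow> l) ?F" for g :: "R3 \<Rightarrow> real" and l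
  proof (rule tendsto_zero_powrI)
    show "((\<lambda>y. \<bar>g y - l\<bar>) \<longlongrightarrow> 0) ?F" using that by (intro tendsto_rabs_zero) (simp add: LIM_zero)
  qed (use theta in auto)
  have "(E \<longlongrightarrow> C * 0 / (\<bar>a\<bar> powr (\<theta> + 1) * \<bar>b\<bar> * \<bar>c\<bar>) + C * 0 / (\<bar>a\<bar> * \<bar>b\<bar> powr (\<theta> + 1) * \<bar>c\<bar>)
      + C * 0 / (\<bar>a\<bar> * \<bar>b\<bar> * \<bar>c\<bar> powr (\<theta> + 1))) ?F"
    unfolding E_def[abs_def]
    by (intro tendsto_intros p0 lims) (use assms in auto)
  hence E0: "(E \<longlongrightarrow> 0) ?F" by simp
  have near: "\<forall>\<^sub>F y in ?F. \<bar>g y - l\<bar> < \<bar>l\<bar> / 2" if "(g \<longlongrightarrow> l) ?F" "l \<noteq> 0" for g :: "R3 \<Rightarrow> real" and l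
    using tendstoD[OF that(1), of "\<bar>l\<bar> / 2"] that(2) by (simp add: dist_real_def)
  have "\<forall>\<^sub>F y in ?F. norm (K y - K (a, b, c)) \<le> E y"
    using near[OF lims(1) assms(1)] near[OF lims(2) assms(2)] near[OF lims(3) assms(3)]
  proof eventually_elim
    fix y :: R3
    assume n: "\<bar>fst y - a\<bar> < \<bar>a\<bar> / 2" "\<bar>fst (snd y) - b\<bar> < \<bar>b\<bar> / 2" "\<bar>snd (snd y) - c\<bar> < \<bar>c\<bar> / 2"
    obtain y1 y2 y3 where y: "y = (y1, y2, y3)" by (cases y)
    have nz: "y1 \<noteq> 0" "y2 \<noteq> 0" "y3 \<noteq> 0" using n y by auto
    have drop: "C * u / D * decay r s t \<le> C * u / D"
      if "0 \<le> u" "0 \<le> D" "r \<noteq> 0" "s \<noteq> 0" "t \<noteq> 0" for u D r s t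
      using that C_nonneg by (intro mult_left_le decay_le_1) auto
    have 1: "norm (K (y1, y2, y3) - K (a, y2, y3)) \<le> C * \<bar>y1 - a\<bar> powr \<theta> / (\<bar>a\<bar> powr (\<theta> + 1) * \<bar>y2\<bar> * \<bar>y3\<bar>)"
    proof (cases "y1 = a")
      case False
      have "norm (K (a + (y1 - a), y2, y3) - K (a, y2, y3))
          \<le> C * \<bar>y1 - a\<bar> powr \<theta> / (\<bar>a\<bar> powr (\<theta> + 1) * \<bar>y2\<bar> * \<bar>y3\<bar>) * decay a y2 y3"
        using n y False nz by (intro K_diff1) auto
      also have "\<dots> \<le> C * \<bar>y1 - a\<bar> powr \<theta> / (\<bar>a\<bar> powr (\<theta> + 1) * \<bar>y2\<bar> * \<bar>y3\<bar>)"
        using nz assms by (intro drop) auto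
      finally show ?thesis by simp
    qed (use C_nonneg theta in simp)
    have 2: "norm (K (a, y2, y3) - K (a, b, y3)) \<le> C * \<bar>y2 - b\<bar> powr \<theta> / (\<bar>a\<bar> * \<bar>b\<bar> powr (\<theta> + 1) * \<bar>y3\<bar>)"
    proof (cases "y2 = b")
      case False
      have "norm (K (a, b + (y2 - b), y3) - K (a, b, y3))
          \<le> C * \<bar>y2 - b\<bar> powr \<theta> / (\<bar>a\<bar> * \<bar>b\<bar> powr (\<theta> + 1) * \<bar>y3\<bar>) * decay a b y3"
        using n y False nz assms by (intro K_diff2) auto
      also have "\<dots> \<le> C * \<bar>y2 - b\<bar> powr \<theta> / (\<bar>a\<bar> * \<bar>b\<bar> powr (\<theta> + 1) * \<bar>y3\<bar>)"
        using nz assms by (intro drop) auto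
      finally show ?thesis by simp
    qed (use C_nonneg theta in simp)
    have 3: "norm (K (a, b, y3) - K (a, b, c)) \<le> C * \<bar>y3 - c\<bar> powr \<theta> / (\<bar>a\<bar> * \<bar>b\<bar> * \<bar>c\<bar> powr (\<theta> + 1))"
    proof (cases "y3 = c")
      case False
      have "norm (K (a, b, c + (y3 - c)) - K (a, b, c))
          \<le> C * \<bar>y3 - c\<bar> powr \<theta> / (\<bar>a\<bar> * \<bar>b\<bar> * \<bar>c\<bar> powr (\<theta> + 1)) * decay a b c"
        using n y False nz assms by (intro K_diff3) auto
      also have "\<dots> \<le> C * \<bar>y3 - c\<bar> powr \<theta> / (\<bar>a\<bar> * \<bar>b\<bar> * \<bar>c\<bar> powr (\<theta> + 1))"
        using nz assms by (intro drop) auto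
      finally show ?thesis by simp
    qed (use C_nonneg theta in simp)
    have "K y - K (a, b, c) = (K (y1, y2, y3) - K (a, y2, y3)) + (K (a, y2, y3) - K (a, b, y3)) + (K (a, b, y3) - K (a, b, c))"
      by (simp add: y)
    hence "norm (K y - K (a, b, c)) \<le> C * \<bar>y1 - a\<bar> powr \<theta> / (\<bar>a\<bar> powr (\<theta> + 1) * \<bar>y2\<bar> * \<bar>y3\<bar>)
        + C * \<bar>y2 - b\<bar> powr \<theta> / (\<bar>a\<bar> * \<bar>b\<bar> powr (\<theta> + 1) * \<bar>y3\<bar>)
        + C * \<bar>y3 - c\<bar> powr \<theta> / (\<bar>a\<bar> * \<bar>b\<bar> * \<bar>c\<bar> powr (\<theta> + 1))"
      by (simp only:) (intro norm_triangle_mono 1 2 3)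
    thus "norm (K y - K (a, b, c)) \<le> E y" by (simp add: E_def y)
  qed
  from Lim_null_comparison[OF this E0] have "((\<lambda>y. K y - K (a, b, c)) \<longlongrightarrow> 0) ?F" .
  thus ?thesis by (simp add: isCont_def LIM_zero_iff)
qed

lemma K_measurable [measurable]: "K \<in> borel_measurable borel"
proof -
  define U where "U = {x :: R3. fst x \<noteq> 0 \<and> fst (snd x) \<noteq> 0 \<and> snd (snd x) \<noteq> 0}"
  have "open U" unfolding U_def by (intro open_Collect_conj open_Collect_neq continuous_intros)
  moreover have "continuous_on U K"
    by (rule continuous_at_imp_continuous_on) (auto simp: U_def intro: K_isCont)
  ultimately have "(\<lambda>x. indicator U x *\<^sub>R K x) \<in> borel_measurable borel"
    by (intro borel_measurable_continuous_on_indicator) auto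
  also have "(\<lambda>x. indicator U x *\<^sub>R K x) = K"
    using planes by (auto simp: fun_eq_iff U_def indicator_def)
  finally show ?thesis .
qed

lemma K_measurable_comp:
  assumes "f \<in> borel_measurable M" "g \<in> borel_measurable M" "h \<in> borel_measurable M"
  shows "(\<lambda>p. K (f p, g p, h p)) \<in> borel_measurable M"
proof -
  have "(\<lambda>p. (f p, g p, h p)) \<in> M \<rightarrow>\<^sub>M borel \<Otimes>\<^sub>M borel \<Otimes>\<^sub>M borel" using assms by measurable
  hence "(\<lambda>p. (f p, g p, h p)) \<in> M \<rightarrow>\<^sub>M borel" by (simp add: borel_prod)
  from measurable_compose[OF this K_measurable] show ?thesis .
qed

lemma K_bounded:
  assumes "0 < e1" "0 < e2" "0 < e3" "e1 \<le> \<bar>x1\<bar>" "e2 \<le> \<bar>x2\<bar>" "e3 \<le> \<bar>x3\<bar>"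
  shows "norm (K (x1, x2, x3)) \<le> C / (e1 * e2 * e3)"
proof -
  have nz: "x1 \<noteq> 0" "x2 \<noteq> 0" "x3 \<noteq> 0" using assms by auto
  have "norm (K (x1, x2, x3)) \<le> C / (\<bar>x1\<bar> * \<bar>x2\<bar> * \<bar>x3\<bar>) * decay x1 x2 x3" by (rule K_size[OF nz])
  also have "\<dots> \<le> C / (\<bar>x1\<bar> * \<bar>x2\<bar> * \<bar>x3\<bar>)"
    using C_nonneg by (intro mult_left_le decay_le_1 nz) auto
  also have "\<dots> \<le> C / (e1 * e2 * e3)"
    using assms C_nonneg by (intro divide_left_mono mult_mono mult_pos_pos) auto
  finally show ?thesis .
qed

lemma slice3_cz_kernel2:
  assumes [measurable]: "w \<in> borel_measurable borel" and w: "\<And>t. norm (w t) \<le> 1" and e: "0 < e"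
  shows "cz_kernel2 \<theta> (4 * C / \<theta>2) (slice3 w e n)"
proof (rule slice_cz_kernel2[where s = "\<lambda>x y. x * y", OF _ _ w theta(2) C_nonneg e])
  show "(\<lambda>(x, y, t). K (x, y, t)) \<in> borel_measurable borel" by simp
next
  fix x y t :: real assume "x \<noteq> 0" "y \<noteq> 0" "t \<noteq> 0"
  from K_size[OF this] show "norm (K (x, y, t)) \<le> C / (\<bar>x\<bar> * \<bar>y\<bar>) * (ratio_decay \<theta>2 (x * y) t / \<bar>t\<bar>)"
    by (simp add: divide_inverse mult_ac)
next
  fix x y t h :: real assume "2 * \<bar>h\<bar> \<le> \<bar>x\<bar>" "0 < \<bar>h\<bar>" "y \<noteq> 0" "t \<noteq> 0"
  from K_diff1[OF this] show "norm (K (x + h, y, t) - K (x, y, t))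
      \<le> C * \<bar>h\<bar> powr \<theta> / (\<bar>x\<bar> powr (\<theta> + 1) * \<bar>y\<bar>) * (ratio_decay \<theta>2 (x * y) t / \<bar>t\<bar>)"
    by (simp add: divide_inverse mult_ac)
next
  fix x y t k :: real assume "x \<noteq> 0" "2 * \<bar>k\<bar> \<le> \<bar>y\<bar>" "0 < \<bar>k\<bar>" "t \<noteq> 0"
  from K_diff2[OF this] show "norm (K (x, y + k, t) - K (x, y, t))
      \<le> C * \<bar>k\<bar> powr \<theta> / (\<bar>x\<bar> * \<bar>y\<bar> powr (\<theta> + 1)) * (ratio_decay \<theta>2 (x * y) t / \<bar>t\<bar>)"
    by (simp add: divide_inverse mult_ac)
next
  fix x y t h k :: real assume "2 * \<bar>h\<bar> \<le> \<bar>x\<bar>" "0 < \<bar>h\<bar>" "2 * \<bar>k\<bar> \<le> \<bar>y\<bar>" "0 < \<bar>k\<bar>" "t \<noteq> 0"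
  from K_diff12[OF this] show "norm ((K (x + h, y + k, t) - K (x + h, y, t)) - (K (x, y + k, t) - K (x, y, t)))
      \<le> C * \<bar>h\<bar> powr \<theta> * \<bar>k\<bar> powr \<theta> / (\<bar>x\<bar> powr (\<theta> + 1) * \<bar>y\<bar> powr (\<theta> + 1)) * (ratio_decay \<theta>2 (x * y) t / \<bar>t\<bar>)"
    by (simp add: divide_inverse mult_ac)
qed simp_all

lemma decay_as_x2: "decay x1 x2 x3 = ratio_decay \<theta>2 (x3 / x1) x2"
  by (simp add: ratio_decay_def mult_ac add.commute)

lemma decay_as_x1: "decay x1 x2 x3 = ratio_decay \<theta>2 (x3 / x2) x1"
  by (simp add: ratio_decay_def mult_ac add.commute)

lemma slice2_cz_kernel2:
  assumes [measurable]: "w \<in> borel_measurable borel" and w: "\<And>t. norm (w t) \<le> 1" and e: "0 < e"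
  shows "cz_kernel2 \<theta> (4 * C / \<theta>2) (slice2 w e n)"
proof (rule slice_cz_kernel2[where s = "\<lambda>x y. y / x", OF _ _ w theta(2) C_nonneg e])
  have "(\<lambda>p :: R3. K (fst p, snd (snd p), fst (snd p))) \<in> borel_measurable borel"
    by (rule K_measurable_comp) (auto intro!: borel_measurable_continuous_onI continuous_intros)
  thus "(\<lambda>(x, y, t). K (x, t, y)) \<in> borel_measurable borel" by (simp add: case_prod_beta')
next
  fix x y t :: real assume "x \<noteq> 0" "y \<noteq> 0" "t \<noteq> 0"
  from K_size[OF this(1,3,2)] show "norm (K (x, t, y)) \<le> C / (\<bar>x\<bar> * \<bar>y\<bar>) * (ratio_decay \<theta>2 (y / x) t / \<bar>t\<bar>)"
    unfolding decay_as_x2 by (simp add: divide_inverse mult_ac)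
next
  fix x y t h :: real assume "2 * \<bar>h\<bar> \<le> \<bar>x\<bar>" "0 < \<bar>h\<bar>" "y \<noteq> 0" "t \<noteq> 0"
  from K_diff1[OF this(1,2,4,3)] show "norm (K (x + h, t, y) - K (x, t, y))
      \<le> C * \<bar>h\<bar> powr \<theta> / (\<bar>x\<bar> powr (\<theta> + 1) * \<bar>y\<bar>) * (ratio_decay \<theta>2 (y / x) t / \<bar>t\<bar>)"
    unfolding decay_as_x2 by (simp add: divide_inverse mult_ac)
next
  fix x y t k :: real assume "x \<noteq> 0" "2 * \<bar>k\<bar> \<le> \<bar>y\<bar>" "0 < \<bar>k\<bar>" "t \<noteq> 0"
  from K_diff3[OF this(1,4,2,3)] show "norm (K (x, t, y + k) - K (x, t, y))
      \<le> C * \<bar>k\<bar> powr \<theta> / (\<bar>x\<bar> * \<bar>y\<bar> powr (\<theta> + 1)) * (ratio_decay \<theta>2 (y / x) t / \<bar>t\<bar>)"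
    unfolding decay_as_x2 by (simp add: divide_inverse mult_ac)
next
  fix x y t h k :: real assume "2 * \<bar>h\<bar> \<le> \<bar>x\<bar>" "0 < \<bar>h\<bar>" "2 * \<bar>k\<bar> \<le> \<bar>y\<bar>" "0 < \<bar>k\<bar>" "t \<noteq> 0"
  from K_diff13[OF this(1,2,5,3,4)] show "norm ((K (x + h, t, y + k) - K (x + h, t, y)) - (K (x, t, y + k) - K (x, t, y)))
      \<le> C * \<bar>h\<bar> powr \<theta> * \<bar>k\<bar> powr \<theta> / (\<bar>x\<bar> powr (\<theta> + 1) * \<bar>y\<bar> powr (\<theta> + 1)) * (ratio_decay \<theta>2 (y / x) t / \<bar>t\<bar>)"
    unfolding decay_as_x2 by (simp add: divide_inverse mult_ac)
qed simp_all

lemma slice1_cz_kernel2: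
  assumes [measurable]: "w \<in> borel_measurable borel" and w: "\<And>t. norm (w t) \<le> 1" and e: "0 < e"
  shows "cz_kernel2 \<theta> (4 * C / \<theta>2) (slice1 w e n)"
proof (rule slice_cz_kernel2[where s = "\<lambda>x y. y / x", OF _ _ w theta(2) C_nonneg e])
  have "(\<lambda>p :: R3. K (snd (snd p), fst p, fst (snd p))) \<in> borel_measurable borel"
    by (rule K_measurable_comp) (auto intro!: borel_measurable_continuous_onI continuous_intros)
  thus "(\<lambda>(x, y, t). K (t, x, y)) \<in> borel_measurable borel" by (simp add: case_prod_beta')
next
  fix x y t :: real assume "x \<noteq> 0" "y \<noteq> 0" "t \<noteq> 0"
  from K_size[OF this(3,1,2)] show "norm (K (t, x, y)) \<le> C / (\<bar>x\<bar> * \<bar>y\<bar>) * (ratio_decay \<theta>2 (y / x) t / \<bar>t\<bar>)"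
    unfolding decay_as_x1 by (simp add: divide_inverse mult_ac)
next
  fix x y t h :: real assume "2 * \<bar>h\<bar> \<le> \<bar>x\<bar>" "0 < \<bar>h\<bar>" "y \<noteq> 0" "t \<noteq> 0"
  from K_diff2[OF this(4,1,2,3)] show "norm (K (t, x + h, y) - K (t, x, y))
      \<le> C * \<bar>h\<bar> powr \<theta> / (\<bar>x\<bar> powr (\<theta> + 1) * \<bar>y\<bar>) * (ratio_decay \<theta>2 (y / x) t / \<bar>t\<bar>)"
    unfolding decay_as_x1 by (simp add: divide_inverse mult_ac)
next
  fix x y t k :: real assume "x \<noteq> 0" "2 * \<bar>k\<bar> \<le> \<bar>y\<bar>" "0 < \<bar>k\<bar>" "t \<noteq> 0"
  from K_diff3[OF this(4,1,2,3)] show "norm (K (t, x, y + k) - K (t, x, y))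
      \<le> C * \<bar>k\<bar> powr \<theta> / (\<bar>x\<bar> * \<bar>y\<bar> powr (\<theta> + 1)) * (ratio_decay \<theta>2 (y / x) t / \<bar>t\<bar>)"
    unfolding decay_as_x1 by (simp add: divide_inverse mult_ac)
next
  fix x y t h k :: real assume "2 * \<bar>h\<bar> \<le> \<bar>x\<bar>" "0 < \<bar>h\<bar>" "2 * \<bar>k\<bar> \<le> \<bar>y\<bar>" "0 < \<bar>k\<bar>" "t \<noteq> 0"
  from K_diff23[OF this(5,1,2,3,4)] show "norm ((K (t, x + h, y + k) - K (t, x + h, y)) - (K (t, x, y + k) - K (t, x, y)))
      \<le> C * \<bar>h\<bar> powr \<theta> * \<bar>k\<bar> powr \<theta> / (\<bar>x\<bar> powr (\<theta> + 1) * \<bar>y\<bar> powr (\<theta> + 1)) * (ratio_decay \<theta>2 (y / x) t / \<bar>t\<bar>)"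
    unfolding decay_as_x1 by (simp add: divide_inverse mult_ac)
qed simp_all

lemma annulus_times [measurable]: "annulus d m \<times> annulus e n \<in> sets borel"
  by (simp add: borel_prod[symmetric])

lemma partial_integral_cz1:
  assumes d: "0 < d2" "0 < d3" "0 < m2" "0 < m3"
  shows "cz_kernel \<theta> C (integral23 d2 m2 d3 m3)"
proof -
  let ?S = "annulus d2 m2 \<times> annulus d3 m3"
  have "cz_kernel \<theta> C (\<lambda>t. LINT p:?S|lborel. K (t, fst p, snd p))"
  proof (rule integral_cz_kernel)
    have "(\<lambda>q :: R3. K (fst q, fst (snd q), snd (snd q))) \<in> borel_measurable borel"
      by (rule K_measurable_comp) (auto intro!: borel_measurable_continuous_onI continuous_intros)
    thus "(\<lambda>(t, p). K (t, fst p, snd p)) \<in> borel_measurable (borel \<Otimes>\<^sub>M borel)"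
      by (simp add: borel_prod case_prod_beta')
    show "\<exists>D. \<forall>p\<in>?S. norm (K (t, fst p, snd p)) \<le> D" if "t \<noteq> 0" for t
      using d that by (intro exI[of _ "C / (\<bar>t\<bar> * d2 * d3)"] ballI) (auto simp: annulus_def intro!: K_bounded)
    show "norm (LINT p:?S|lborel. K (t, fst p, snd p)) \<le> C / \<bar>t\<bar>" if "t \<noteq> 0" for t
      using cancel_c[unfolded cancellation_c_def, rule_format, of d2 d3 m2 m3 0 "t / 2" t] d that
      by (simp add: diff1_def case_prod_beta' set_lebesgue_integral_def)
    show "norm (LINT p:?S|lborel. K (t + h, fst p, snd p) - K (t, fst p, snd p)) \<le> C * \<bar>h\<bar> powr \<theta> / \<bar>t\<bar> powr (\<theta> + 1)"
      if "2 * \<bar>h\<bar> \<le> \<bar>t\<bar>" "0 < \<bar>h\<bar>" for t h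
      using cancel_c[unfolded cancellation_c_def, rule_format, of d2 d3 m2 m3 1 h t] d that
      by (simp add: diff1_def case_prod_beta')
  qed (simp_all add: bounded_Times bounded_annulus)
  thus ?thesis by (simp add: case_prod_beta')
qed

lemma partial_integral_cz2:
  assumes d: "0 < d1" "0 < d3" "0 < m1" "0 < m3"
  shows "cz_kernel \<theta> C (integral13 d1 m1 d3 m3)"
proof -
  let ?S = "annulus d1 m1 \<times> annulus d3 m3"
  have "cz_kernel \<theta> C (\<lambda>t. LINT p:?S|lborel. K (fst p, t, snd p))"
  proof (rule integral_cz_kernel)
    have "(\<lambda>q :: R3. K (fst (snd q), fst q, snd (snd q))) \<in> borel_measurable borel"
      by (rule K_measurable_comp) (auto intro!: borel_measurable_continuous_onI continuous_intros)
    thus "(\<lambda>(t, p). K (fst p, t, snd p)) \<in> borel_measurable (borel \<Otimes>\<^sub>M borel)"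
      by (simp add: borel_prod case_prod_beta')
    show "\<exists>D. \<forall>p\<in>?S. norm (K (fst p, t, snd p)) \<le> D" if "t \<noteq> 0" for t
      using d that by (intro exI[of _ "C / (d1 * \<bar>t\<bar> * d3)"] ballI) (auto simp: annulus_def intro!: K_bounded)
    show "norm (LINT p:?S|lborel. K (fst p, t, snd p)) \<le> C / \<bar>t\<bar>" if "t \<noteq> 0" for t
      using cancel_d[unfolded cancellation_d_def, rule_format, of d1 d3 m1 m3 0 "t / 2" t] d that
      by (simp add: diff2_def case_prod_beta' set_lebesgue_integral_def)
    show "norm (LINT p:?S|lborel. K (fst p, t + h, snd p) - K (fst p, t, snd p)) \<le> C * \<bar>h\<bar> powr \<theta> / \<bar>t\<bar> powr (\<theta> + 1)"
      if "2 * \<bar>h\<bar> \<le> \<bar>t\<bar>" "0 < \<bar>h\<bar>" for t h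
      using cancel_d[unfolded cancellation_d_def, rule_format, of d1 d3 m1 m3 1 h t] d that
      by (simp add: diff2_def case_prod_beta')
  qed (simp_all add: bounded_Times bounded_annulus)
  thus ?thesis by (simp add: case_prod_beta')
qed

lemma partial_integral_cz3:
  assumes d: "0 < d1" "0 < d2" "0 < m1" "0 < m2"
  shows "cz_kernel \<theta> C (integral12 d1 m1 d2 m2)"
proof -
  let ?S = "annulus d1 m1 \<times> annulus d2 m2"
  have "cz_kernel \<theta> C (\<lambda>t. LINT p:?S|lborel. K (fst p, snd p, t))"
  proof (rule integral_cz_kernel)
    have "(\<lambda>q :: R3. K (fst (snd q), snd (snd q), fst q)) \<in> borel_measurable borel"
      by (rule K_measurable_comp) (auto intro!: borel_measurable_continuous_onI continuous_intros)
    thus "(\<lambda>(t, p). K (fst p, snd p, t)) \<in> borel_measurable (borel \<Otimes>\<^sub>M borel)"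
      by (simp add: borel_prod case_prod_beta')
    show "\<exists>D. \<forall>p\<in>?S. norm (K (fst p, snd p, t)) \<le> D" if "t \<noteq> 0" for t
      using d that by (intro exI[of _ "C / (d1 * d2 * \<bar>t\<bar>)"] ballI) (auto simp: annulus_def intro!: K_bounded)
    show "norm (LINT p:?S|lborel. K (fst p, snd p, t)) \<le> C / \<bar>t\<bar>" if "t \<noteq> 0" for t
      using cancel_b[unfolded cancellation_b_def, rule_format, of d1 d2 m1 m2 0 "t / 2" t] d that
      by (simp add: diff3_def case_prod_beta' set_lebesgue_integral_def)
    show "norm (LINT p:?S|lborel. K (fst p, snd p, t + h) - K (fst p, snd p, t)) \<le> C * \<bar>h\<bar> powr \<theta> / \<bar>t\<bar> powr (\<theta> + 1)"
      if "2 * \<bar>h\<bar> \<le> \<bar>t\<bar>" "0 < \<bar>h\<bar>" for t h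
      using cancel_b[unfolded cancellation_b_def, rule_format, of d1 d2 m1 m2 1 h t] d that
      by (simp add: diff3_def case_prod_beta')
  qed (simp_all add: bounded_Times bounded_annulus)
  thus ?thesis by (simp add: case_prod_beta')
qed

end

section \<open>The multiplier of a truncated kernel\<close>

lemma low_pass_annulus:
  fixes f :: "R3 \<Rightarrow> complex" and g :: "real \<times> real \<Rightarrow> complex"
  shows "(LINT x:annulus e1 n1 \<times> annulus e2 n2 \<times> annulus e3 n3|lborel.
            (of_bool (\<bar>fst x\<bar> \<le> r1) * of_bool (\<bar>fst (snd x)\<bar> \<le> r2) * of_bool (\<bar>snd (snd x)\<bar> \<le> r3)) * f x)
          = (LINT x:annulus e1 (min n1 r1) \<times> annulus e2 (min n2 r2) \<times> annulus e3 (min n3 r3)|lborel. f x)"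
    and "(LINT (x, y):annulus e1 n1 \<times> annulus e2 n2|lborel. of_bool (\<bar>x\<bar> \<le> r1) * of_bool (\<bar>y\<bar> \<le> r2) * g (x, y))
          = (LINT (x, y):annulus e1 (min n1 r1) \<times> annulus e2 (min n2 r2)|lborel. g (x, y))"
  unfolding set_lebesgue_integral_def
  by (intro Bochner_Integration.integral_cong refl, auto simp: annulus_def indicator_def)+

text \<open>
  The contributions of the terms with no, one and two oscillating factors; \<open>2\<pi> + 2 + 1/\<theta>\<close> is
  the value of \<^const>\<open>osc_bound\<close> for the radius \<open>2\<pi>/|\<xi>|\<close>.
\<close>

definition multiplier_constant :: "real \<Rightarrow> real \<Rightarrow> real \<Rightarrow> real" where
  "multiplier_constant \<theta> \<theta>2 C = C + 6 * C * (2 * pi + 2 + 1 / \<theta>) + 48 * C / \<theta>2 * (2 * pi + 2 + 1 / \<theta>)\<^sup>2"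

context zygmund_kernel
begin

lemma weighted_Fubini:
  fixes u1 u2 u3 :: "real \<Rightarrow> complex" and n1 n2 n3 :: real
  assumes [measurable]: "u1 \<in> borel_measurable borel" "u2 \<in> borel_measurable borel" "u3 \<in> borel_measurable borel"
    and u: "\<And>x. norm (u1 x) \<le> 2" "\<And>x. norm (u2 x) \<le> 2" "\<And>x. norm (u3 x) \<le> 2"
    and e: "0 < e1" "0 < e2" "0 < e3"
  defines "I \<equiv> LINT x:annulus e1 n1 \<times> annulus e2 n2 \<times> annulus e3 n3|lborel.
      (u1 (fst x) * u2 (fst (snd x)) * u3 (snd (snd x))) * K x"
  shows "set_integrable lborel (annulus e1 n1 \<times> annulus e2 n2 \<times> annulus e3 n3)
      (\<lambda>x. (u1 (fst x) * u2 (fst (snd x)) * u3 (snd (snd x))) * K x)"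
    and "I = (LINT x1:annulus e1 n1|lborel. u1 x1 *
           (LINT (x2, x3):annulus e2 n2 \<times> annulus e3 n3|lborel. u2 x2 * u3 x3 * K (x1, x2, x3)))"
    and "I = (LINT x2:annulus e2 n2|lborel. u2 x2 *
           (LINT (x1, x3):annulus e1 n1 \<times> annulus e3 n3|lborel. u1 x1 * u3 x3 * K (x1, x2, x3)))"
    and "I = (LINT x3:annulus e3 n3|lborel. u3 x3 *
           (LINT (x1, x2):annulus e1 n1 \<times> annulus e2 n2|lborel. u1 x1 * u2 x2 * K (x1, x2, x3)))"
    and "I = (LINT x2:annulus e2 n2|lborel. u2 x2 * (LINT x1:annulus e1 n1|lborel. u1 x1 *
           slice3 u3 e3 n3 x1 x2))"
    and "I = (LINT x3:annulus e3 n3|lborel. u3 x3 * (LINT x1:annulus e1 n1|lborel. u1 x1 *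
           slice2 u2 e2 n2 x1 x3))"
    and "I = (LINT x3:annulus e3 n3|lborel. u3 x3 * (LINT x2:annulus e2 n2|lborel. u2 x2 *
           slice1 u1 e1 n1 x2 x3))"
proof -
  define f where "f x = (u1 (fst x) * u2 (fst (snd x)) * u3 (snd (snd x))) * K x" for x
  have fm: "f \<in> borel_measurable borel"
  proof -
    have "(\<lambda>x :: R3. u1 (fst x)) \<in> borel_measurable borel" "(\<lambda>x :: R3. u2 (fst (snd x))) \<in> borel_measurable borel"
      "(\<lambda>x :: R3. u3 (snd (snd x))) \<in> borel_measurable borel"
      by (rule measurable_compose[OF borel_measurable_continuous_onI]; (intro continuous_intros)?; measurable)+
    thus ?thesis unfolding f_def[abs_def] by (intro borel_measurable_times K_measurable)
  qed
  define D where "D = 2 * 2 * 2 * (C / (e1 * e2 * e3))"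
  have D: "\<forall>x1\<in>annulus e1 n1. \<forall>x2\<in>annulus e2 n2. \<forall>x3\<in>annulus e3 n3. norm (f (x1, x2, x3)) \<le> D"
  proof (intro ballI)
    fix x1 x2 x3 assume x: "x1 \<in> annulus e1 n1" "x2 \<in> annulus e2 n2" "x3 \<in> annulus e3 n3"
    have "norm (K (x1, x2, x3)) \<le> C / (e1 * e2 * e3)"
      using x e by (intro K_bounded) (auto simp: annulus_def)
    thus "norm (f (x1, x2, x3)) \<le> D" unfolding f_def D_def norm_mult fst_conv snd_conv
      by (intro mult_mono u) auto
  qed
  note F = triple_integral_Fubini[OF fm annulus_measurable[of e1 n1] annulus_measurable[of e2 n2] annulus_measurable[of e3 n3]
      bounded_annulus bounded_annulus bounded_annulus D]
  have I: "I = (LINT x:annulus e1 n1 \<times> annulus e2 n2 \<times> annulus e3 n3|lborel. f x)"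
    by (simp add: I_def f_def)
  have "set_integrable lborel (annulus e1 n1 \<times> annulus e2 n2 \<times> annulus e3 n3) f"
    by (rule set_integrable_bounded_on[OF fm, where D = D])
      (use D in \<open>auto simp: borel_prod[symmetric] intro!: bounded_Times bounded_annulus\<close>)
  thus "set_integrable lborel (annulus e1 n1 \<times> annulus e2 n2 \<times> annulus e3 n3)
      (\<lambda>x. (u1 (fst x) * u2 (fst (snd x)) * u3 (snd (snd x))) * K x)"
    by (simp add: f_def[abs_def])
  note pull = set_integral_mult_right[symmetric] case_prod_beta' f_def fst_conv snd_conv
  show "I = (LINT x1:annulus e1 n1|lborel. u1 x1 *
           (LINT (x2, x3):annulus e2 n2 \<times> annulus e3 n3|lborel. u2 x2 * u3 x3 * K (x1, x2, x3)))"
    unfolding I F(1) by (simp only: pull mult_ac)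
  show "I = (LINT x2:annulus e2 n2|lborel. u2 x2 *
           (LINT (x1, x3):annulus e1 n1 \<times> annulus e3 n3|lborel. u1 x1 * u3 x3 * K (x1, x2, x3)))"
    unfolding I F(2) by (simp only: pull mult_ac)
  show "I = (LINT x3:annulus e3 n3|lborel. u3 x3 *
           (LINT (x1, x2):annulus e1 n1 \<times> annulus e2 n2|lborel. u1 x1 * u2 x2 * K (x1, x2, x3)))"
    unfolding I F(3) by (simp only: pull mult_ac)
  show "I = (LINT x2:annulus e2 n2|lborel. u2 x2 * (LINT x1:annulus e1 n1|lborel. u1 x1 *
           slice3 u3 e3 n3 x1 x2))"
    unfolding I F(4) by (simp only: pull mult_ac)
  show "I = (LINT x3:annulus e3 n3|lborel. u3 x3 * (LINT x1:annulus e1 n1|lborel. u1 x1 *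
           slice2 u2 e2 n2 x1 x3))"
    unfolding I F(5) by (simp only: pull mult_ac)
  show "I = (LINT x3:annulus e3 n3|lborel. u3 x3 * (LINT x2:annulus e2 n2|lborel. u2 x2 *
           slice1 u1 e1 n1 x2 x3))"
    unfolding I F(6) by (simp only: pull mult_ac)
qed

text \<open>
  Grouping the two terms \<open>q\<^sub>1q\<^sub>2p\<^sub>3\<close> and \<open>q\<^sub>1q\<^sub>2q\<^sub>3\<close> of the expansion as \<open>q\<^sub>1q\<^sub>2w\<^sub>3\<close> keeps the number of simultaneous
  differences of the kernel at two.
\<close>

lemma multiplier_decomposition:
  assumes e: "0 < e1" "0 < e2" "0 < e3"
  shows "fourier (truncate (e1, e2, e3) (n1, n2, n3) K) (\<xi>1, \<xi>2, \<xi>3) =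
      (LINT x:annulus e1 (min n1 r1) \<times> annulus e2 (min n2 r2) \<times> annulus e3 (min n3 r3)|lborel. K x)
    + osc_integral \<xi>1 r1 e1 n1 (integral23 e2 (min n2 r2) e3 (min n3 r3))
    + osc_integral \<xi>2 r2 e2 n2 (integral13 e1 (min n1 r1) e3 (min n3 r3))
    + osc_integral \<xi>3 r3 e3 n3 (integral12 e1 (min n1 r1) e2 (min n2 r2))
    + osc_integral \<xi>2 r2 e2 n2 (\<lambda>x2. osc_integral \<xi>1 r1 e1 n1 (\<lambda>x1. slice3 (\<lambda>t. cis (- (\<xi>3 * t))) e3 n3 x1 x2))
    + osc_integral \<xi>3 r3 e3 n3 (\<lambda>x3. osc_integral \<xi>1 r1 e1 n1 (\<lambda>x1. slice2 (\<lambda>t. of_bool (\<bar>t\<bar> \<le> r2)) e2 n2 x1 x3))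
    + osc_integral \<xi>3 r3 e3 n3 (\<lambda>x3. osc_integral \<xi>2 r2 e2 n2 (\<lambda>x2. slice1 (\<lambda>t. of_bool (\<bar>t\<bar> \<le> r1)) e1 n1 x2 x3))"
proof -
  let ?A = "annulus e1 n1 \<times> annulus e2 n2 \<times> annulus e3 n3"
  define w where "w \<xi> = (\<lambda>x. cis (- (\<xi> * x)))" for \<xi> :: real
  define p where "p r = (\<lambda>x. of_bool (\<bar>x\<bar> \<le> r) :: complex)" for r :: real
  define W where "W u1 u2 u3 = (\<lambda>x :: R3. (u1 (fst x) * u2 (fst (snd x)) * u3 (snd (snd x))) * K x)" for u1 u2 u3 :: "real \<Rightarrow> complex"
  have m[measurable]: "w \<xi> \<in> borel_measurable borel" "p r \<in> borel_measurable borel" for \<xi> r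
    unfolding w_def p_def by measurable
  have b: "norm (w \<xi> x) \<le> 2" "norm (p r x) \<le> 2" for \<xi> r x by (auto simp: w_def p_def)
  have wpq: "w \<xi> x = osc \<xi> r x + p r x" for \<xi> r x by (simp add: w_def p_def osc_def)
  note q = osc_measurable norm_osc_le
  note WF = weighted_Fubini[OF _ _ _ _ _ _ e, folded W_def]
  have i: "set_integrable lborel ?A (W (p r1) (p r2) (p r3))"
    "set_integrable lborel ?A (W (osc \<xi>1 r1) (p r2) (p r3))"
    "set_integrable lborel ?A (W (p r1) (osc \<xi>2 r2) (p r3))"
    "set_integrable lborel ?A (W (p r1) (p r2) (osc \<xi>3 r3))"
    "set_integrable lborel ?A (W (osc \<xi>1 r1) (osc \<xi>2 r2) (w \<xi>3))"
    "set_integrable lborel ?A (W (osc \<xi>1 r1) (p r2) (osc \<xi>3 r3))"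
    "set_integrable lborel ?A (W (p r1) (osc \<xi>2 r2) (osc \<xi>3 r3))"
    by (intro WF(1) m b q)+
  have "fourier (truncate (e1, e2, e3) (n1, n2, n3) K) (\<xi>1, \<xi>2, \<xi>3) = (LINT x:?A|lborel. W (w \<xi>1) (w \<xi>2) (w \<xi>3) x)"
    unfolding fourier_def set_lebesgue_integral_def
  proof (intro Bochner_Integration.integral_cong refl)
    fix x :: R3
    obtain x1 x2 x3 where x: "x = (x1, x2, x3)" by (cases x)
    have "cis (- (x \<bullet> (\<xi>1, \<xi>2, \<xi>3))) = w \<xi>1 x1 * w \<xi>2 x2 * w \<xi>3 x3"
      by (simp add: x w_def cis_mult algebra_simps)
    thus "cis (- (x \<bullet> (\<xi>1, \<xi>2, \<xi>3))) * truncate (e1, e2, e3) (n1, n2, n3) K x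
        = indicator ?A x *\<^sub>R W (w \<xi>1) (w \<xi>2) (w \<xi>3) x"
      by (simp add: truncate_def W_def x indicator_def)
  qed
  also have "\<dots> = (LINT x:?A|lborel. W (p r1) (p r2) (p r3) x + W (osc \<xi>1 r1) (p r2) (p r3) x
      + W (p r1) (osc \<xi>2 r2) (p r3) x + W (p r1) (p r2) (osc \<xi>3 r3) x
      + W (osc \<xi>1 r1) (osc \<xi>2 r2) (w \<xi>3) x + W (osc \<xi>1 r1) (p r2) (osc \<xi>3 r3) x
      + W (p r1) (osc \<xi>2 r2) (osc \<xi>3 r3) x)"
  proof -
    have "W (w \<xi>1) (w \<xi>2) (w \<xi>3) x = W (p r1) (p r2) (p r3) x + W (osc \<xi>1 r1) (p r2) (p r3) x
      + W (p r1) (osc \<xi>2 r2) (p r3) x + W (p r1) (p r2) (osc \<xi>3 r3) x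
      + W (osc \<xi>1 r1) (osc \<xi>2 r2) (w \<xi>3) x + W (osc \<xi>1 r1) (p r2) (osc \<xi>3 r3) x
      + W (p r1) (osc \<xi>2 r2) (osc \<xi>3 r3) x" for x
      unfolding W_def wpq[of \<xi>1 _ r1] wpq[of \<xi>2 _ r2] wpq[of \<xi>3 _ r3] by (simp add: algebra_simps)
    thus ?thesis by simp
  qed
  also have "\<dots> = (LINT x:?A|lborel. W (p r1) (p r2) (p r3) x) + (LINT x:?A|lborel. W (osc \<xi>1 r1) (p r2) (p r3) x)
      + (LINT x:?A|lborel. W (p r1) (osc \<xi>2 r2) (p r3) x) + (LINT x:?A|lborel. W (p r1) (p r2) (osc \<xi>3 r3) x)
      + (LINT x:?A|lborel. W (osc \<xi>1 r1) (osc \<xi>2 r2) (w \<xi>3) x) + (LINT x:?A|lborel. W (osc \<xi>1 r1) (p r2) (osc \<xi>3 r3) x)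
      + (LINT x:?A|lborel. W (p r1) (osc \<xi>2 r2) (osc \<xi>3 r3) x)"
    using i by (simp add: set_integral_add)
  also have "(LINT x:?A|lborel. W (p r1) (p r2) (p r3) x)
      = (LINT x:annulus e1 (min n1 r1) \<times> annulus e2 (min n2 r2) \<times> annulus e3 (min n3 r3)|lborel. K x)"
    unfolding W_def p_def by (rule low_pass_annulus(1))
  also have "(LINT x:?A|lborel. W (osc \<xi>1 r1) (p r2) (p r3) x) = osc_integral \<xi>1 r1 e1 n1 (integral23 e2 (min n2 r2) e3 (min n3 r3))"
    unfolding WF(2)[OF q(1) m(2) m(2) q(2) b(2) b(2)] unfolding p_def
    using low_pass_annulus(2)[where g = "\<lambda>(x2, x3). K (_, x2, x3)"] by simp
  also have "(LINT x:?A|lborel. W (p r1) (osc \<xi>2 r2) (p r3) x) = osc_integral \<xi>2 r2 e2 n2 (integral13 e1 (min n1 r1) e3 (min n3 r3))"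
    unfolding WF(3)[OF m(2) q(1) m(2) b(2) q(2) b(2)] unfolding p_def
    using low_pass_annulus(2)[where g = "\<lambda>(x1, x3). K (x1, _, x3)"] by simp
  also have "(LINT x:?A|lborel. W (p r1) (p r2) (osc \<xi>3 r3) x) = osc_integral \<xi>3 r3 e3 n3 (integral12 e1 (min n1 r1) e2 (min n2 r2))"
    unfolding WF(4)[OF m(2) m(2) q(1) b(2) b(2) q(2)] unfolding p_def
    using low_pass_annulus(2)[where g = "\<lambda>(x1, x2). K (x1, x2, _)"] by simp
  also have "(LINT x:?A|lborel. W (osc \<xi>1 r1) (osc \<xi>2 r2) (w \<xi>3) x) = osc_integral \<xi>2 r2 e2 n2 (\<lambda>x2. osc_integral \<xi>1 r1 e1 n1 (\<lambda>x1. slice3 (\<lambda>t. cis (- (\<xi>3 * t))) e3 n3 x1 x2))"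
    unfolding WF(5)[OF q(1) q(1) m(1) q(2) q(2) b(1)] unfolding w_def ..
  also have "(LINT x:?A|lborel. W (osc \<xi>1 r1) (p r2) (osc \<xi>3 r3) x) = osc_integral \<xi>3 r3 e3 n3 (\<lambda>x3. osc_integral \<xi>1 r1 e1 n1 (\<lambda>x1. slice2 (\<lambda>t. of_bool (\<bar>t\<bar> \<le> r2)) e2 n2 x1 x3))"
    unfolding WF(6)[OF q(1) m(2) q(1) q(2) b(2) q(2)] unfolding p_def ..
  also have "(LINT x:?A|lborel. W (p r1) (osc \<xi>2 r2) (osc \<xi>3 r3) x) = osc_integral \<xi>3 r3 e3 n3 (\<lambda>x3. osc_integral \<xi>2 r2 e2 n2 (\<lambda>x2. slice1 (\<lambda>t. of_bool (\<bar>t\<bar> \<le> r1)) e1 n1 x2 x3))"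
    unfolding WF(7)[OF m(2) q(1) q(1) b(2) q(2) q(2)] unfolding p_def ..
  finally show ?thesis .
qed

lemma multiplier_bound:
  assumes e: "0 < e1" "0 < e2" "0 < e3" and n: "0 < n1" "0 < n2" "0 < n3"
    and \<xi>: "\<xi>1 \<noteq> 0" "\<xi>2 \<noteq> 0" "\<xi>3 \<noteq> 0"
  shows "norm (fourier (truncate (e1, e2, e3) (n1, n2, n3) K) (\<xi>1, \<xi>2, \<xi>3)) \<le> multiplier_constant \<theta> \<theta>2 C"
proof -
  define b where "b = 2 * pi + 2 + 1 / \<theta>"
  define r where "r \<xi> = 2 * pi / \<bar>\<xi>\<bar>" for \<xi> :: real
  have r: "\<xi> \<noteq> 0 \<Longrightarrow> 0 < r \<xi>" and ob: "\<xi> \<noteq> 0 \<Longrightarrow> osc_bound \<theta> \<xi> (r \<xi>) = b" for \<xi>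
    by (simp_all add: r_def b_def osc_bound_resonant)
  have mn: "0 < min n1 (r \<xi>1)" "0 < min n2 (r \<xi>2)" "0 < min n3 (r \<xi>3)" using n r \<xi> by auto
  have single: "norm (osc_integral \<xi> (r \<xi>) e n \<phi>) \<le> 2 * C * b"
    if "cz_kernel \<theta> C \<phi>" "\<xi> \<noteq> 0" "0 < e" for \<phi> \<xi> e n
    using osc_annulus_bound[OF that(1) theta(1) that(2) r[OF that(2)] that(3)] by (simp add: ob that)
  have double: "norm (osc_integral \<eta> (r \<eta>) d m (\<lambda>y. osc_integral \<xi> (r \<xi>) e n (\<lambda>x. \<psi> x y))) \<le> 16 * C / \<theta>2 * b\<^sup>2"
    if "cz_kernel2 \<theta> (4 * C / \<theta>2) \<psi>" "\<xi> \<noteq> 0" "\<eta> \<noteq> 0" "0 < e" "0 < d" for \<psi> \<xi> \<eta> e d n m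
    using osc_double_bound[OF that(1) theta(1) that(2) r[OF that(2)] that(4) that(3) r[OF that(3)] that(5), of m n]
    by (simp add: ob that power2_eq_square mult_ac)
  have "norm (fourier (truncate (e1, e2, e3) (n1, n2, n3) K) (\<xi>1, \<xi>2, \<xi>3))
    \<le> C + 2 * C * b + 2 * C * b + 2 * C * b + 16 * C / \<theta>2 * b\<^sup>2 + 16 * C / \<theta>2 * b\<^sup>2 + 16 * C / \<theta>2 * b\<^sup>2"
    unfolding multiplier_decomposition[OF e, of n1 n2 n3 \<xi>1 \<xi>2 \<xi>3 "r \<xi>1" "r \<xi>2" "r \<xi>3"]
    by (intro norm_triangle_mono single double partial_integral_cz1 partial_integral_cz2 partial_integral_cz3
        slice3_cz_kernel2 slice2_cz_kernel2 slice1_cz_kernel2 cancel_a[unfolded cancellation_a_def, rule_format] e mn \<xi>)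
      (auto simp: of_bool_def)
  thus ?thesis by (simp add: b_def multiplier_constant_def algebra_simps)
qed

text \<open>
  For fixed \<open>x\<^sub>3\<close> the decay factor is at most \<open>|x\<^sub>1x\<^sub>2/x\<^sub>3|\<^sup>\<theta>\<close>, which makes the kernel absolutely integrable in
  \<open>(x\<^sub>1, x\<^sub>2)\<close> near the origin.
\<close>

lemma low_pass3_convergent:
  assumes x3: "x3 \<noteq> 0"
    and 1: "\<And>k. 0 < e1 k" "e1 \<longlonglongrightarrow> 0" "filterlim n1 at_top sequentially"
    and 2: "\<And>k. 0 < e2 k" "e2 \<longlonglongrightarrow> 0" "filterlim n2 at_top sequentially"
  shows "convergent (\<lambda>k. integral12 (e1 k) (min (n1 k) 1) (e2 k) (min (n2 k) 1) x3)"
proof (rule convergentI, rule set_integral_dominated_convergence[where T = "({-1..1} - {0}) \<times> ({-1..1} - {0})"])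
  define v where "v t = indicator {0..1} \<bar>t\<bar> * \<bar>t\<bar> powr (\<theta>2 - 1)" for t :: real
  have v0: "0 \<le> v t" for t by (simp add: v_def)
  define w where "w p = C / \<bar>x3\<bar> * \<bar>x3\<bar> powr (- \<theta>2) * (v (fst p) * v (snd p))" for p
  have vi: "integrable lborel v" unfolding v_def[abs_def] by (rule integrable_powr_origin_even) (use theta in auto)
  have "integrable (lborel \<Otimes>\<^sub>M lborel) w"
    unfolding w_def[abs_def] by (intro integrable_mult_right lborel_pair.integrable_mult_pair vi)
  thus "integrable lborel w" by (simp add: lborel_prod)
  show "0 \<le> w p" for p unfolding w_def using C_nonneg v0 by simp
  show "norm (case p of (x1, x2) \<Rightarrow> K (x1, x2, x3)) \<le> w p"
    if p: "p \<in> annulus (e1 k) (min (n1 k) 1) \<times> annulus (e2 k) (min (n2 k) 1)" for k p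
  proof -
    obtain x1 x2 where px: "p = (x1, x2)" by (cases p)
    have nz: "x1 \<noteq> 0" "x2 \<noteq> 0" "\<bar>x1\<bar> \<le> 1" "\<bar>x2\<bar> \<le> 1"
      using p px 1(1)[of k] 2(1)[of k] by (auto simp: annulus_def)
    have "decay x1 x2 x3 \<le> \<bar>x1 * x2 / x3\<bar> powr \<theta>2"
      unfolding ratio_decay_commute[of _ "x1 * x2"] using nz x3 theta by (intro ratio_decay_le) auto
    also have "\<dots> = \<bar>x1\<bar> powr \<theta>2 * \<bar>x2\<bar> powr \<theta>2 * \<bar>x3\<bar> powr (- \<theta>2)"
      by (simp add: abs_mult powr_divide powr_mult powr_minus_divide)
    finally have d: "decay x1 x2 x3 \<le> \<bar>x1\<bar> powr \<theta>2 * \<bar>x2\<bar> powr \<theta>2 * \<bar>x3\<bar> powr (- \<theta>2)" .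
    have "norm (K (x1, x2, x3)) \<le> C / (\<bar>x1\<bar> * \<bar>x2\<bar> * \<bar>x3\<bar>) * decay x1 x2 x3"
      by (rule K_size[OF nz(1,2) x3])
    also have "\<dots> \<le> C / (\<bar>x1\<bar> * \<bar>x2\<bar> * \<bar>x3\<bar>) * (\<bar>x1\<bar> powr \<theta>2 * \<bar>x2\<bar> powr \<theta>2 * \<bar>x3\<bar> powr (- \<theta>2))"
      using C_nonneg by (intro mult_left_mono d) auto
    also have "\<dots> = w p"
      using nz by (simp add: w_def v_def px powr_diff field_simps)
    finally show ?thesis by (simp add: px)
  qed
  have m: "(\<lambda>p :: real \<times> real. K (fst p, snd p, x3)) \<in> borel_measurable borel"
    by (rule K_measurable_comp) (auto intro!: borel_measurable_continuous_onI continuous_intros)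
  thus "(\<lambda>(x1, x2). K (x1, x2, x3)) \<in> borel_measurable lborel" by (simp add: case_prod_beta')
  thus "(\<lambda>(x1, x2). K (x1, x2, x3)) \<in> borel_measurable lborel" .
  show "annulus (e1 k) (min (n1 k) 1) \<times> annulus (e2 k) (min (n2 k) 1) \<in> sets lborel" for k by simp
  show "({-1..1} - {0}) \<times> ({-1..1} - {0}) \<in> sets (lborel :: (real \<times> real) measure)"
    by (simp add: borel_prod[symmetric])
  have ex: "\<forall>\<^sub>F k in sequentially. x \<in> annulus (e k) (min (n k) 1) \<longleftrightarrow> x \<in> {-1..1} - {0}"
    if "\<And>k. 0 < e k" "e \<longlonglongrightarrow> 0" "filterlim n at_top sequentially" for e n :: "nat \<Rightarrow> real" and x :: real
    using annulus_exhausts[OF that, of x] by eventually_elim (auto simp: annulus_def)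
  show "AE p in lborel. (\<forall>\<^sub>F k in sequentially. p \<in> annulus (e1 k) (min (n1 k) 1) \<times> annulus (e2 k) (min (n2 k) 1)
        \<longleftrightarrow> p \<in> ({-1..1} - {0}) \<times> ({-1..1} - {0})) \<and>
      (p \<in> ({-1..1} - {0}) \<times> ({-1..1} - {0}) \<longrightarrow> (\<lambda>k. case p of (x1, x2) \<Rightarrow> K (x1, x2, x3)) \<longlonglongrightarrow> (case p of (x1, x2) \<Rightarrow> K (x1, x2, x3)))"
  proof (rule always_eventually, intro allI conjI impI tendsto_const)
    fix p :: "real \<times> real"
    show "\<forall>\<^sub>F k in sequentially. p \<in> annulus (e1 k) (min (n1 k) 1) \<times> annulus (e2 k) (min (n2 k) 1)
        \<longleftrightarrow> p \<in> ({-1..1} - {0}) \<times> ({-1..1} - {0})"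
      using ex[OF 1, of "fst p"] ex[OF 2, of "snd p"] by eventually_elim (auto simp: mem_Times_iff)
  qed
qed

lemma multiplier_convergent:
  assumes 1: "\<And>k. 0 < e1 k" "e1 \<longlonglongrightarrow> 0" "filterlim n1 at_top sequentially" "\<And>k. 0 < n1 k"
    and 2: "\<And>k. 0 < e2 k" "e2 \<longlonglongrightarrow> 0" "filterlim n2 at_top sequentially" "\<And>k. 0 < n2 k"
    and 3: "\<And>k. 0 < e3 k" "e3 \<longlonglongrightarrow> 0" "filterlim n3 at_top sequentially" "\<And>k. 0 < n3 k"
    and c0: "convergent (\<lambda>k. LINT x:annulus (e1 k) (min (n1 k) 1) \<times> annulus (e2 k) (min (n2 k) 1) \<times> annulus (e3 k) (min (n3 k) 1)|lborel. K x)"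
    and c1: "AE x1 in lborel. convergent (\<lambda>k. integral23 (e2 k) (min (n2 k) 1) (e3 k) (min (n3 k) 1) x1)"
    and c2: "AE x2 in lborel. convergent (\<lambda>k. integral13 (e1 k) (min (n1 k) 1) (e3 k) (min (n3 k) 1) x2)"
    and \<xi>: "\<xi>1 \<noteq> 0" "\<xi>2 \<noteq> 0" "\<xi>3 \<noteq> 0"
  shows "convergent (\<lambda>k. fourier (truncate (e1 k, e2 k, e3 k) (n1 k, n2 k, n3 k) K) (\<xi>1, \<xi>2, \<xi>3))"
proof -
  have mn: "0 < min (n1 k) 1" "0 < min (n2 k) 1" "0 < min (n3 k) 1" for k using 1 2 3 by auto
  have slice: "convergent (\<lambda>k. LINT t:annulus (e k) (n k)|lborel. w t * f t)"
    if "f \<in> borel_measurable borel" "w \<in> borel_measurable borel" "\<And>t. norm (w t) \<le> 1" "s \<noteq> 0" "0 \<le> D"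
      "\<And>t. t \<noteq> 0 \<Longrightarrow> norm (f t) \<le> D * (ratio_decay \<theta>2 s t / \<bar>t\<bar>)"
      "\<And>k. 0 < e k" "e \<longlonglongrightarrow> 0" "filterlim n at_top sequentially"
    for f w :: "real \<Rightarrow> complex" and s D :: real and e n :: "nat \<Rightarrow> real"
    using that by (intro slice_convergent[where \<theta> = \<theta>2 and s = s and D = D] theta) auto
  have low: "norm (of_bool P :: complex) \<le> 1" for P by simp
  have lowm: "(\<lambda>x. of_bool (\<bar>x\<bar> \<le> 1) :: complex) \<in> borel_measurable (borel :: real measure)" by measurable
  have s12: "convergent (\<lambda>k. slice3 (\<lambda>t. cis (- (\<xi>3 * t))) (e3 k) (n3 k) x1 x2)"
    if "x1 \<noteq> 0" "x2 \<noteq> 0" for x1 x2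
  proof (rule slice[where s = "x1 * x2" and D = "C / (\<bar>x1\<bar> * \<bar>x2\<bar>)"])
    fix t :: real assume "t \<noteq> 0"
    from K_size[OF that this] show "norm (K (x1, x2, t)) \<le> C / (\<bar>x1\<bar> * \<bar>x2\<bar>) * (decay x1 x2 t / \<bar>t\<bar>)"
      by (simp add: divide_inverse mult_ac)
  qed (use that C_nonneg 3 in \<open>auto intro!: K_measurable_comp\<close>)
  have s13: "convergent (\<lambda>k. slice2 (\<lambda>t. of_bool (\<bar>t\<bar> \<le> 1)) (e2 k) (n2 k) x1 x3)"
    if "x1 \<noteq> 0" "x3 \<noteq> 0" for x1 x3
  proof (rule slice[where s = "x3 / x1" and D = "C / (\<bar>x1\<bar> * \<bar>x3\<bar>)"])
    fix t :: real assume "t \<noteq> 0"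
    from K_size[OF that(1) this that(2)] show "norm (K (x1, t, x3)) \<le> C / (\<bar>x1\<bar> * \<bar>x3\<bar>) * (ratio_decay \<theta>2 (x3 / x1) t / \<bar>t\<bar>)"
      unfolding decay_as_x2 by (simp add: divide_inverse mult_ac)
  qed (use that C_nonneg 2 lowm in \<open>auto intro!: K_measurable_comp\<close>)
  have s23: "convergent (\<lambda>k. slice1 (\<lambda>t. of_bool (\<bar>t\<bar> \<le> 1)) (e1 k) (n1 k) x2 x3)"
    if "x2 \<noteq> 0" "x3 \<noteq> 0" for x2 x3
  proof (rule slice[where s = "x3 / x2" and D = "C / (\<bar>x2\<bar> * \<bar>x3\<bar>)"])
    fix t :: real assume "t \<noteq> 0"
    from K_size[OF this that] show "norm (K (t, x2, x3)) \<le> C / (\<bar>x2\<bar> * \<bar>x3\<bar>) * (ratio_decay \<theta>2 (x3 / x2) t / \<bar>t\<bar>)"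
      unfolding decay_as_x1 by (simp add: divide_inverse mult_ac)
  qed (use that C_nonneg 1 lowm in \<open>auto intro!: K_measurable_comp\<close>)
  have c3: "AE x3 in lborel. convergent (\<lambda>k. integral12 (e1 k) (min (n1 k) 1) (e2 k) (min (n2 k) 1) x3)"
    using AE_lborel_singleton[of 0] by eventually_elim (rule low_pass3_convergent[OF _ 1(1-3) 2(1-3)])
  have cism: "(\<lambda>x. cis (- (\<xi> * x))) \<in> borel_measurable borel" for \<xi> by measurable
  have cis1: "norm (cis t) \<le> 1" for t by simp
  show ?thesis
    unfolding multiplier_decomposition[OF 1(1) 2(1) 3(1), where ?r1.0 = 1 and ?r2.0 = 1 and ?r3.0 = 1]
  proof (intro convergent_add c0)
    show "convergent (\<lambda>k. osc_integral \<xi>1 1 (e1 k) (n1 k) (integral23 (e2 k) (min (n2 k) 1) (e3 k) (min (n3 k) 1)))"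
      by (rule osc_annulus_convergent[OF partial_integral_cz1 theta(1) \<xi>(1) _ 1(1-3) c1]) (use 2 3 mn in auto)
    show "convergent (\<lambda>k. osc_integral \<xi>2 1 (e2 k) (n2 k) (integral13 (e1 k) (min (n1 k) 1) (e3 k) (min (n3 k) 1)))"
      by (rule osc_annulus_convergent[OF partial_integral_cz2 theta(1) \<xi>(2) _ 2(1-3) c2]) (use 1 3 mn in auto)
    show "convergent (\<lambda>k. osc_integral \<xi>3 1 (e3 k) (n3 k) (integral12 (e1 k) (min (n1 k) 1) (e2 k) (min (n2 k) 1)))"
      by (rule osc_annulus_convergent[OF partial_integral_cz3 theta(1) \<xi>(3) _ 3(1-3) c3]) (use 1 2 mn in auto)
    show "convergent (\<lambda>k. osc_integral \<xi>2 1 (e2 k) (n2 k) (\<lambda>x2. osc_integral \<xi>1 1 (e1 k) (n1 k) (\<lambda>x1. slice3 (\<lambda>t. cis (- (\<xi>3 * t))) (e3 k) (n3 k) x1 x2)))"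
      by (rule osc_double_convergent[OF slice3_cz_kernel2[OF cism cis1 3(1)] theta(1) \<xi>(1) _ 1(1-3) \<xi>(2) _ 2(1-3) s12]) auto
    show "convergent (\<lambda>k. osc_integral \<xi>3 1 (e3 k) (n3 k) (\<lambda>x3. osc_integral \<xi>1 1 (e1 k) (n1 k) (\<lambda>x1. slice2 (\<lambda>t. of_bool (\<bar>t\<bar> \<le> 1)) (e2 k) (n2 k) x1 x3)))"
      by (rule osc_double_convergent[OF slice2_cz_kernel2[OF lowm low 2(1)] theta(1) \<xi>(1) _ 1(1-3) \<xi>(3) _ 3(1-3) s13]) auto
    show "convergent (\<lambda>k. osc_integral \<xi>3 1 (e3 k) (n3 k) (\<lambda>x3. osc_integral \<xi>2 1 (e2 k) (n2 k) (\<lambda>x2. slice1 (\<lambda>t. of_bool (\<bar>t\<bar> \<le> 1)) (e1 k) (n1 k) x2 x3)))"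
      by (rule osc_double_convergent[OF slice1_cz_kernel2[OF lowm low 1(1)] theta(1) \<xi>(2) _ 2(1-3) \<xi>(3) _ 3(1-3) s23]) auto
  qed
qed

end

section \<open>Passing to the limit of the truncations\<close>

lemma AE_lborel_coordinate_neq:
  fixes k :: "'a::euclidean_space"
  assumes "k \<in> Basis"
  shows "AE x in lborel. x \<bullet> k \<noteq> c"
proof -
  have "{x. x \<bullet> k = c} \<in> null_sets lebesgue"
    using negligible_standard_hyperplane[OF assms, of c] by (simp add: negligible_iff_null_sets)
  moreover have "closed {x. x \<bullet> k = c}" by (intro closed_Collect_eq continuous_intros)
  ultimately have "{x. x \<bullet> k = c} \<in> null_sets lborel"
    by (subst (asm) null_sets_completion_iff) auto
  from AE_not_in[OF this] show ?thesis by simp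
qed

lemma AE_R3_coordinates_neq:
  "AE x in (lborel :: R3 measure). fst x \<noteq> c \<and> fst (snd x) \<noteq> c \<and> snd (snd x) \<noteq> c"
proof -
  have b: "(1, 0) \<in> (Basis :: R3 set)" "(0, 1, 0) \<in> (Basis :: R3 set)" "(0, 0, 1) \<in> (Basis :: R3 set)"
    by (auto simp: Basis_prod_def zero_prod_def)
  show ?thesis
    using AE_lborel_coordinate_neq[OF b(1), of c] AE_lborel_coordinate_neq[OF b(2), of c]
      AE_lborel_coordinate_neq[OF b(3), of c]
    by eventually_elim (auto simp: inner_prod_def)
qed

lemma AE_R3_abs_coordinates_neq:
  "AE x in (lborel :: R3 measure). \<bar>fst x\<bar> \<noteq> c \<and> \<bar>fst (snd x)\<bar> \<noteq> c \<and> \<bar>snd (snd x)\<bar> \<noteq> c"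
  using AE_R3_coordinates_neq[of c] AE_R3_coordinates_neq[of "- c"]
  by eventually_elim auto

lemma annulus_nonzero: "0 < e \<Longrightarrow> x \<in> annulus e n \<Longrightarrow> x \<noteq> 0"
  by (auto simp: annulus_def)

context zygmund_kernel
begin

text \<open>
  A truncated kernel is continuous off the finitely many coordinate hyperplanes that bound its box:
  in the interior it agrees with \<open>K\<close>, outside the closed box it vanishes.
\<close>

lemma truncate_nice:
  assumes e: "0 < e1" "0 < e2" "0 < e3"
  shows "nice_kernel (truncate (e1, e2, e3) (n1, n2, n3) K)"
proof -
  let ?A = "annulus e1 n1 \<times> annulus e2 n2 \<times> annulus e3 n3"
  let ?T = "truncate (e1, e2, e3) (n1, n2, n3) K"
  have T: "?T x = (if x \<in> ?A then K x else 0)" for x by (simp add: truncate_def)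
  have A: "?A \<in> sets borel" by (simp add: borel_prod[symmetric])
  have "?T = (\<lambda>x. indicator ?A x *\<^sub>R K x)" by (auto simp: T indicator_def)
  moreover have "(\<lambda>x. indicator ?A x *\<^sub>R K x) \<in> borel_measurable borel"
    by (intro borel_measurable_scaleR borel_measurable_indicator A K_measurable)
  ultimately have meas: "?T \<in> borel_measurable borel" by simp
  have nonneg: "0 \<le> C / (e1 * e2 * e3)"
    by (intro divide_nonneg_pos mult_pos_pos C_nonneg e)
  have bound: "norm (?T x) \<le> C / (e1 * e2 * e3)" for x
  proof -
    obtain x1 x2 x3 where x: "x = (x1, x2, x3)" by (metis prod.collapse)
    have "norm (K (x1, x2, x3)) \<le> C / (e1 * e2 * e3)"
      if "x1 \<in> annulus e1 n1" "x2 \<in> annulus e2 n2" "x3 \<in> annulus e3 n3"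
      by (rule K_bounded[OF e]) (use that in \<open>simp_all add: annulus_def\<close>)
    thus ?thesis using nonneg unfolding T x by (auto simp: mem_Times_iff)
  qed
  obtain R where "\<forall>x\<in>?A. norm x \<le> R"
    using bounded_Times[OF bounded_annulus bounded_Times[OF bounded_annulus bounded_annulus]]
    unfolding bounded_iff by blast
  hence support: "\<forall>x. R < norm x \<longrightarrow> ?T x = 0" unfolding T by force
  have cont: "AE x in lborel. isCont ?T x"
    using AE_R3_abs_coordinates_neq[of e1] AE_R3_abs_coordinates_neq[of e2] AE_R3_abs_coordinates_neq[of e3]
      AE_R3_abs_coordinates_neq[of n1] AE_R3_abs_coordinates_neq[of n2] AE_R3_abs_coordinates_neq[of n3]
  proof eventually_elim
    fix x :: R3
    assume ne: "\<bar>fst x\<bar> \<noteq> e1 \<and> \<bar>fst (snd x)\<bar> \<noteq> e1 \<and> \<bar>snd (snd x)\<bar> \<noteq> e1"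
      "\<bar>fst x\<bar> \<noteq> e2 \<and> \<bar>fst (snd x)\<bar> \<noteq> e2 \<and> \<bar>snd (snd x)\<bar> \<noteq> e2"
      "\<bar>fst x\<bar> \<noteq> e3 \<and> \<bar>fst (snd x)\<bar> \<noteq> e3 \<and> \<bar>snd (snd x)\<bar> \<noteq> e3"
      "\<bar>fst x\<bar> \<noteq> n1 \<and> \<bar>fst (snd x)\<bar> \<noteq> n1 \<and> \<bar>snd (snd x)\<bar> \<noteq> n1"
      "\<bar>fst x\<bar> \<noteq> n2 \<and> \<bar>fst (snd x)\<bar> \<noteq> n2 \<and> \<bar>snd (snd x)\<bar> \<noteq> n2"
      "\<bar>fst x\<bar> \<noteq> n3 \<and> \<bar>fst (snd x)\<bar> \<noteq> n3 \<and> \<bar>snd (snd x)\<bar> \<noteq> n3"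
    show "isCont ?T x"
    proof (cases "x \<in> ?A")
      case True
      define U where "U = {y :: R3. e1 < \<bar>fst y\<bar> \<and> \<bar>fst y\<bar> < n1 \<and> e2 < \<bar>fst (snd y)\<bar> \<and> \<bar>fst (snd y)\<bar> < n2
        \<and> e3 < \<bar>snd (snd y)\<bar> \<and> \<bar>snd (snd y)\<bar> < n3}"
      have "open U" unfolding U_def by (intro open_Collect_conj open_Collect_less continuous_intros)
      moreover have "x \<in> U"
      proof -
        have le: "e1 \<le> \<bar>fst x\<bar>" "\<bar>fst x\<bar> \<le> n1" "e2 \<le> \<bar>fst (snd x)\<bar>" "\<bar>fst (snd x)\<bar> \<le> n2"
          "e3 \<le> \<bar>snd (snd x)\<bar>" "\<bar>snd (snd x)\<bar> \<le> n3"
          using True by (simp_all add: mem_Times_iff annulus_def)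
        have "e1 \<noteq> \<bar>fst x\<bar>" "\<bar>fst x\<bar> \<noteq> n1" "e2 \<noteq> \<bar>fst (snd x)\<bar>" "\<bar>fst (snd x)\<bar> \<noteq> n2"
          "e3 \<noteq> \<bar>snd (snd x)\<bar>" "\<bar>snd (snd x)\<bar> \<noteq> n3"
          using ne by (blast dest: sym)+
        thus ?thesis unfolding U_def mem_Collect_eq less_le using le by (intro conjI)
      qed
      ultimately have "\<forall>\<^sub>F y in nhds x. y \<in> U" by (rule eventually_nhds_in_open)
      hence "\<forall>\<^sub>F y in nhds x. ?T y = K y"
        by eventually_elim (simp add: U_def T annulus_def mem_Times_iff)
      moreover have "isCont K x"
        using K_isCont[of "fst x" "fst (snd x)" "snd (snd x)"] True e annulus_nonzero
        by (auto simp: mem_Times_iff)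
      ultimately show ?thesis using isCont_cong[of ?T K x] by simp
    next
      case False
      have "closed ?A"
      proof -
        have "closed (annulus e n)" for e n
          unfolding annulus_def by (intro closed_Collect_conj closed_Collect_le continuous_intros)
        thus ?thesis by (intro closed_Times)
      qed
      hence "\<forall>\<^sub>F y in nhds x. y \<in> - ?A" using False by (intro eventually_nhds_in_open) auto
      hence "\<forall>\<^sub>F y in nhds x. ?T y = 0"
        by eventually_elim (simp add: T)
      hence "isCont ?T x = isCont (\<lambda>_. 0 :: complex) x" by (rule isCont_cong)
      thus ?thesis by simp
    qed
  qed
  show ?thesis
    unfolding nice_kernel_def
    by (intro conjI meas cont exI[of _ "C / (e1 * e2 * e3)"] exI[of _ R] allI bound support)
qed

lemma multiplier_bound_AE:
  assumes "0 < e1" "0 < e2" "0 < e3" "0 < n1" "0 < n2" "0 < n3"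
  shows "AE \<xi> in lborel. norm (fourier (truncate (e1, e2, e3) (n1, n2, n3) K) \<xi>) \<le> multiplier_constant \<theta> \<theta>2 C"
  using AE_R3_coordinates_neq[of 0]
proof eventually_elim
  case (elim \<xi>)
  thus ?case using multiplier_bound[OF assms, of "fst \<xi>" "fst (snd \<xi>)" "snd (snd \<xi>)"] by simp
qed

end

text \<open>
  A decreasing countable basis makes limits along a filter accessible to sequences that run through
  the basis sets.
\<close>

definition filter_basis :: "'a filter \<Rightarrow> (nat \<Rightarrow> 'a set) \<Rightarrow> bool" where
  "filter_basis F X \<longleftrightarrow> (\<forall>m n. m \<le> n \<longrightarrow> X n \<subseteq> X m) \<and> (\<forall>P. eventually P F \<longleftrightarrow> (\<exists>m. \<forall>x\<in>X m. P x))"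

lemma filter_basis_decreasing: "filter_basis F X \<Longrightarrow> m \<le> n \<Longrightarrow> X n \<subseteq> X m"
  unfolding filter_basis_def by simp

lemma filter_basis_eventually: "filter_basis F X \<Longrightarrow> eventually P F \<longleftrightarrow> (\<exists>m. \<forall>x\<in>X m. P x)"
  unfolding filter_basis_def by (drule conjunct2, erule spec)

lemma filter_basis_prod:
  assumes F: "filter_basis F X" and G: "filter_basis G Y"
  shows "filter_basis (F \<times>\<^sub>F G) (\<lambda>m. X m \<times> Y m)"
  unfolding filter_basis_def
proof (intro conjI allI impI)
  note dX = filter_basis_decreasing[OF F] and dY = filter_basis_decreasing[OF G]
  show "X n \<times> Y n \<subseteq> X m \<times> Y m" if "m \<le> n" for m n using dX[OF that] dY[OF that] by (rule Sigma_mono)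
  fix P
  note eF = filter_basis_eventually[OF F] and eG = filter_basis_eventually[OF G]
  show "eventually P (F \<times>\<^sub>F G) \<longleftrightarrow> (\<exists>m. \<forall>x\<in>X m \<times> Y m. P x)"
  proof
    assume "eventually P (F \<times>\<^sub>F G)"
    then obtain Q R where "eventually Q F" "eventually R G" and QR: "\<And>x y. Q x \<Longrightarrow> R y \<Longrightarrow> P (x, y)"
      unfolding eventually_prod_filter by blast
    then obtain m n where "\<forall>x\<in>X m. Q x" "\<forall>y\<in>Y n. R y" unfolding eF eG by blast
    moreover have "X (max m n) \<subseteq> X m" "Y (max m n) \<subseteq> Y n" by (rule dX dY, simp)+
    ultimately have "P (x, y)" if "x \<in> X (max m n)" "y \<in> Y (max m n)" for x y
      using that by (intro QR) blast+
    hence "\<forall>x\<in>X (max m n) \<times> Y (max m n). P x" by blast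
    thus "\<exists>m. \<forall>x\<in>X m \<times> Y m. P x" by blast
  next
    assume "\<exists>m. \<forall>x\<in>X m \<times> Y m. P x"
    then obtain m where m: "\<forall>x\<in>X m \<times> Y m. P x" by blast
    have "eventually (\<lambda>x. x \<in> X m) F" "eventually (\<lambda>y. y \<in> Y m) G" unfolding eF eG by auto
    thus "eventually P (F \<times>\<^sub>F G)" unfolding eventually_prod_filter using m by blast
  qed
qed

lemma filter_basis_at_right_0: "filter_basis (at_right (0::real)) (\<lambda>m. {0<..<1 / real (Suc m)})"
  unfolding filter_basis_def
proof (intro conjI allI impI)
  show "{0<..<1 / real (Suc n)} \<subseteq> {0<..<1 / real (Suc m)}" if "m \<le> n" for m n
  proof -
    have "1 / real (Suc n) \<le> 1 / real (Suc m)" using that by (intro divide_left_mono) auto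
    thus ?thesis by auto
  qed
  fix P :: "real \<Rightarrow> bool"
  show "eventually P (at_right 0) \<longleftrightarrow> (\<exists>m. \<forall>x\<in>{0<..<1 / real (Suc m)}. P x)"
  proof
    assume "eventually P (at_right 0)"
    then obtain b where b: "0 < b" "\<And>y. 0 < y \<Longrightarrow> y < b \<Longrightarrow> P y"
      unfolding eventually_at_right_field by blast
    obtain m where "1 / real (Suc m) < b" using nat_approx_posE[OF b(1)] by blast
    thus "\<exists>m. \<forall>x\<in>{0<..<1 / real (Suc m)}. P x" using b(2) by (intro exI[of _ m]) auto
  next
    assume "\<exists>m. \<forall>x\<in>{0<..<1 / real (Suc m)}. P x"
    then obtain m where "\<forall>x\<in>{0<..<1 / real (Suc m)}. P x" by blast
    thus "eventually P (at_right 0)"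
      unfolding eventually_at_right_field by (intro exI[of _ "1 / real (Suc m)"]) auto
  qed
qed

lemma filter_basis_at_top: "filter_basis (at_top :: real filter) (\<lambda>m. {real m<..})"
  unfolding filter_basis_def
proof (intro conjI allI impI)
  show "{real n<..} \<subseteq> {real m<..}" if "m \<le> n" for m n using that by auto
  fix P :: "real \<Rightarrow> bool"
  show "eventually P at_top \<longleftrightarrow> (\<exists>m. \<forall>x\<in>{real m<..}. P x)"
  proof
    assume "eventually P at_top"
    then obtain b where b: "\<And>y. b < y \<Longrightarrow> P y" unfolding eventually_at_top_dense by blast
    obtain m where "b \<le> real m" using real_arch_simple by blast
    thus "\<exists>m. \<forall>x\<in>{real m<..}. P x" using b by (intro exI[of _ m]) auto
  next
    assume "\<exists>m. \<forall>x\<in>{real m<..}. P x"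
    thus "eventually P at_top" unfolding eventually_at_top_dense by auto
  qed
qed

lemma filter_basis_sequence:
  assumes "filter_basis F X" "\<And>n. s n \<in> X n"
  shows "filterlim s F sequentially"
  unfolding filterlim_iff
proof (intro allI impI)
  fix P assume "eventually P F"
  then obtain m where "\<forall>x\<in>X m. P x" unfolding filter_basis_eventually[OF assms(1)] by blast
  moreover have "s n \<in> X m" if "m \<le> n" for n
    using assms(2) filter_basis_decreasing[OF assms(1) that] by blast
  ultimately show "\<forall>\<^sub>F n in sequentially. P (s n)" unfolding eventually_sequentially by blast
qed

text \<open>
  It is enough that each such sequence has a subsequence with the right limit, because a
  sequence of counterexamples has none.
\<close>

lemma filter_basis_tendsto:
  fixes \<phi> :: "'a \<Rightarrow> 'b::metric_space"
  assumes X: "filter_basis F X"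
    and s: "\<And>s. (\<And>n. s n \<in> X n) \<Longrightarrow> \<exists>r. strict_mono (r :: nat \<Rightarrow> nat) \<and> (\<lambda>n. \<phi> (s (r n))) \<longlonglongrightarrow> L"
  shows "(\<phi> \<longlongrightarrow> L) F"
proof (rule tendstoI, rule ccontr)
  fix \<epsilon> :: real assume \<epsilon>: "0 < \<epsilon>" and "\<not> (\<forall>\<^sub>F x in F. dist (\<phi> x) L < \<epsilon>)"
  hence "\<forall>m. \<exists>x\<in>X m. \<not> dist (\<phi> x) L < \<epsilon>" unfolding filter_basis_eventually[OF X] by blast
  then obtain z where z: "\<And>m. z m \<in> X m" "\<And>m. \<not> dist (\<phi> (z m)) L < \<epsilon>" by metis
  obtain r :: "nat \<Rightarrow> nat" where "(\<lambda>n. \<phi> (z (r n))) \<longlonglongrightarrow> L" using s[OF z(1)] by blast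
  from tendstoD[OF this \<epsilon>] have "\<forall>\<^sub>F n in sequentially. False" using z(2) by simp
  thus False by simp
qed

definition trunc_box :: "nat \<Rightarrow> (R3 \<times> R3) set" where
  "trunc_box m = ({0<..<1 / real (Suc m)} \<times> {0<..<1 / real (Suc m)} \<times> {0<..<1 / real (Suc m)})
     \<times> ({real m<..} \<times> {real m<..} \<times> {real m<..})"

lemma filter_basis_trunc_limit: "filter_basis trunc_limit trunc_box"
  unfolding trunc_limit_def trunc_box_def
  by (intro filter_basis_prod filter_basis_at_right_0 filter_basis_at_top)

lemma trunc_box_sequence:
  assumes "\<And>k. ((e1 k, e2 k, e3 k), (n1 k, n2 k, n3 k)) \<in> trunc_box k"
  shows "\<And>k. 0 < e1 k" "e1 \<longlonglongrightarrow> 0" "filterlim n1 at_top sequentially" "\<And>k. 0 < n1 k"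
    and "\<And>k. 0 < e2 k" "e2 \<longlonglongrightarrow> 0" "filterlim n2 at_top sequentially" "\<And>k. 0 < n2 k"
    and "\<And>k. 0 < e3 k" "e3 \<longlonglongrightarrow> 0" "filterlim n3 at_top sequentially" "\<And>k. 0 < n3 k"
proof -
  have r: "filterlim e (at_right 0) sequentially" if "\<And>k. e k \<in> {0<..<1 / real (Suc k)}" for e
    using filter_basis_sequence[OF filter_basis_at_right_0 that] .
  have t: "filterlim n at_top sequentially" if "\<And>k. n k \<in> {real k<..}" for n
    using filter_basis_sequence[OF filter_basis_at_top that] .
  have m: "e1 k \<in> {0<..<1 / real (Suc k)}" "e2 k \<in> {0<..<1 / real (Suc k)}" "e3 k \<in> {0<..<1 / real (Suc k)}"
    "n1 k \<in> {real k<..}" "n2 k \<in> {real k<..}" "n3 k \<in> {real k<..}" for k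
    using assms[of k] by (auto simp: trunc_box_def)
  show "0 < e1 k" "0 < e2 k" "0 < e3 k" for k using m[of k] by auto
  show "0 < n1 k" "0 < n2 k" "0 < n3 k" for k using m[of k] by (auto intro: le_less_trans[of 0 "real k"])
  show "e1 \<longlonglongrightarrow> 0" "e2 \<longlonglongrightarrow> 0" "e3 \<longlonglongrightarrow> 0"
    using r[of e1] r[of e2] r[of e3] m by (auto simp: filterlim_at)
  show "filterlim n1 at_top sequentially" "filterlim n2 at_top sequentially" "filterlim n3 at_top sequentially"
    by (rule t[OF m(4)], rule t[OF m(5)], rule t[OF m(6)])
qed

text \<open>
  The conditions on \<open>K\<close> and the truncations see only points with nonzero coordinates, so values on
  the coordinate planes may be replaced by \<open>0\<close>.
\<close>

definition off_planes :: "(R3 \<Rightarrow> complex) \<Rightarrow> R3 \<Rightarrow> complex" where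
  "off_planes K x = (if fst x = 0 \<or> fst (snd x) = 0 \<or> snd (snd x) = 0 then 0 else K x)"

lemma off_planes_eq: "x1 \<noteq> 0 \<Longrightarrow> x2 \<noteq> 0 \<Longrightarrow> x3 \<noteq> 0 \<Longrightarrow> off_planes K (x1, x2, x3) = K (x1, x2, x3)"
  by (simp add: off_planes_def)

lemma zygmund_kernel_off_planes:
  assumes "0 < \<theta>1" "0 < \<theta>2" "regularity \<theta>1 \<theta>2 C K" "cancellation_a C K" "cancellation_b \<theta>1 C K"
    "cancellation_c \<theta>1 C K" "cancellation_d \<theta>1 C K"
  shows "zygmund_kernel \<theta>1 \<theta>2 C (off_planes K)"
proof
  show "0 < \<theta>1" "0 < \<theta>2" by fact+
  show "off_planes K (x1, x2, x3) = 0" if "x1 = 0 \<or> x2 = 0 \<or> x3 = 0" for x1 x2 x3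
    using that by (auto simp: off_planes_def)
  have reg_eq: "diff1 a h1 (diff2 b h2 (diff3 c h3 (off_planes K))) (x1, x2, x3) = diff1 a h1 (diff2 b h2 (diff3 c h3 K)) (x1, x2, x3)"
    if "\<bar>x1\<bar> \<ge> 2 * \<bar>h1\<bar> \<and> \<bar>h1\<bar> > 0 \<and> \<bar>x2\<bar> \<ge> 2 * \<bar>h2\<bar> \<and> \<bar>h2\<bar> > 0 \<and> \<bar>x3\<bar> \<ge> 2 * \<bar>h3\<bar> \<and> \<bar>h3\<bar> > 0"
    for a b c x1 x2 x3 h1 h2 h3
  proof -
    have "x1 \<noteq> 0" "x1 + h1 \<noteq> 0" "x2 \<noteq> 0" "x2 + h2 \<noteq> 0" "x3 \<noteq> 0" "x3 + h3 \<noteq> 0" using that by auto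
    thus ?thesis by (simp add: diff1_def diff2_def diff3_def off_planes_eq)
  qed
  show "regularity \<theta>1 \<theta>2 C (off_planes K)"
    using assms(3) unfolding regularity_def by (simp add: reg_eq)
  have box: "annulus d1 r1 \<times> annulus d2 r2 \<times> annulus d3 r3 \<in> sets (lborel :: R3 measure)" for d1 r1 d2 r2 d3 r3
    by (simp add: borel_prod[symmetric])
  have box2: "annulus d1 r1 \<times> annulus d2 r2 \<in> sets (lborel :: (real \<times> real) measure)" for d1 r1 d2 r2
    by (simp add: borel_prod[symmetric])
  have "(LINT x:annulus d1 r1 \<times> annulus d2 r2 \<times> annulus d3 r3|lborel. off_planes K x)
      = (LINT x:annulus d1 r1 \<times> annulus d2 r2 \<times> annulus d3 r3|lborel. K x)" if "0 < d1" "0 < d2" "0 < d3" for d1 d2 d3 r1 r2 r3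
    by (rule set_lebesgue_integral_cong[OF box]) (use that in \<open>auto intro!: off_planes_eq dest: annulus_nonzero\<close>)
  thus "cancellation_a C (off_planes K)" using assms(4) unfolding cancellation_a_def by simp
  have "(LINT (x1, x2):annulus d1 r1 \<times> annulus d2 r2|lborel. diff3 c h (off_planes K) (x1, x2, x3))
      = (LINT (x1, x2):annulus d1 r1 \<times> annulus d2 r2|lborel. diff3 c h K (x1, x2, x3))"
    if "0 < d1" "0 < d2" "\<bar>x3\<bar> \<ge> 2 * \<bar>h\<bar> \<and> \<bar>h\<bar> > 0" for d1 d2 r1 r2 c h x3
  proof (rule set_lebesgue_integral_cong[OF box2], clarify)
    fix x1 x2 assume "x1 \<in> annulus d1 r1" "x2 \<in> annulus d2 r2"
    moreover have "x3 \<noteq> 0" "x3 + h \<noteq> 0" using that(3) by auto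
    ultimately have "x1 \<noteq> 0" "x2 \<noteq> 0" "x3 \<noteq> 0" "x3 + h \<noteq> 0"
      using that(1,2) annulus_nonzero by blast+
    thus "diff3 c h (off_planes K) (x1, x2, x3) = diff3 c h K (x1, x2, x3)"
      by (simp add: diff3_def off_planes_eq)
  qed
  thus "cancellation_b \<theta>1 C (off_planes K)" using assms(5) unfolding cancellation_b_def by simp
  have "(LINT (x2, x3):annulus d1 r1 \<times> annulus d2 r2|lborel. diff1 c h (off_planes K) (x1, x2, x3))
      = (LINT (x2, x3):annulus d1 r1 \<times> annulus d2 r2|lborel. diff1 c h K (x1, x2, x3))"
    if "0 < d1" "0 < d2" "\<bar>x1\<bar> \<ge> 2 * \<bar>h\<bar> \<and> \<bar>h\<bar> > 0" for d1 d2 r1 r2 c h x1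
  proof (rule set_lebesgue_integral_cong[OF box2], clarify)
    fix x2 x3 assume "x2 \<in> annulus d1 r1" "x3 \<in> annulus d2 r2"
    moreover have "x1 \<noteq> 0" "x1 + h \<noteq> 0" using that(3) by auto
    ultimately have "x1 \<noteq> 0" "x2 \<noteq> 0" "x3 \<noteq> 0" "x1 + h \<noteq> 0"
      using that(1,2) annulus_nonzero by blast+
    thus "diff1 c h (off_planes K) (x1, x2, x3) = diff1 c h K (x1, x2, x3)"
      by (simp add: diff1_def off_planes_eq)
  qed
  thus "cancellation_c \<theta>1 C (off_planes K)" using assms(6) unfolding cancellation_c_def by simp
  have "(LINT (x1, x3):annulus d1 r1 \<times> annulus d2 r2|lborel. diff2 c h (off_planes K) (x1, x2, x3))
      = (LINT (x1, x3):annulus d1 r1 \<times> annulus d2 r2|lborel. diff2 c h K (x1, x2, x3))"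
    if "0 < d1" "0 < d2" "\<bar>x2\<bar> \<ge> 2 * \<bar>h\<bar> \<and> \<bar>h\<bar> > 0" for d1 d2 r1 r2 c h x2
  proof (rule set_lebesgue_integral_cong[OF box2], clarify)
    fix x1 x3 assume "x1 \<in> annulus d1 r1" "x3 \<in> annulus d2 r2"
    moreover have "x2 \<noteq> 0" "x2 + h \<noteq> 0" using that(3) by auto
    ultimately have "x1 \<noteq> 0" "x2 \<noteq> 0" "x3 \<noteq> 0" "x2 + h \<noteq> 0"
      using that(1,2) annulus_nonzero by blast+
    thus "diff2 c h (off_planes K) (x1, x2, x3) = diff2 c h K (x1, x2, x3)"
      by (simp add: diff2_def off_planes_eq)
  qed
  thus "cancellation_d \<theta>1 C (off_planes K)" using assms(7) unfolding cancellation_d_def by simp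
qed

lemma truncate_off_planes:
  assumes "0 < e1" "0 < e2" "0 < e3"
  shows "truncate (e1, e2, e3) (n1, n2, n3) (off_planes K) = truncate (e1, e2, e3) (n1, n2, n3) K"
  using assms by (auto simp: truncate_def fun_eq_iff intro!: off_planes_eq dest: annulus_nonzero)

lemma mem_annulus_min_1: "x \<in> annulus e (min n 1) \<longleftrightarrow> -1 \<le> x \<and> x \<le> 1 \<and> x \<in> annulus e n"
  by (auto simp: annulus_def)

text \<open>
  Cutting a truncated kernel to the unit box changes the outer radii to at most \<open>1\<close>, which are the boxes in
  \<open>multiplier_decomposition\<close> for unit radii.
\<close>

lemma truncated_unit_box:
  assumes e: "0 < e1" "0 < e2" "0 < e3"
  shows "(LINT x:{-1..1} \<times> {-1..1} \<times> {-1..1}|lborel. truncate (e1, e2, e3) (n1, n2, n3) K x)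
      = (LINT x:annulus e1 (min n1 1) \<times> annulus e2 (min n2 1) \<times> annulus e3 (min n3 1)|lborel. off_planes K x)"
    and "x1 \<in> annulus e1 n1 \<Longrightarrow>
      (LINT (x2, x3):{-1..1} \<times> {-1..1}|lborel. truncate (e1, e2, e3) (n1, n2, n3) K (x1, x2, x3))
      = (LINT (x2, x3):annulus e2 (min n2 1) \<times> annulus e3 (min n3 1)|lborel. off_planes K (x1, x2, x3))"
    and "x2 \<in> annulus e2 n2 \<Longrightarrow>
      (LINT (x1, x3):{-1..1} \<times> {-1..1}|lborel. truncate (e1, e2, e3) (n1, n2, n3) K (x1, x2, x3))
      = (LINT (x1, x3):annulus e1 (min n1 1) \<times> annulus e3 (min n3 1)|lborel. off_planes K (x1, x2, x3))"
  unfolding set_lebesgue_integral_def truncate_off_planes[OF e, of n1 n2 n3 K, symmetric]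
  by (intro Bochner_Integration.integral_cong refl; auto simp: truncate_def indicator_def mem_annulus_min_1 split: if_splits)+

lemma trunc_convolution_sequence:
  fixes K :: "R3 \<Rightarrow> complex"
  assumes Z: "zygmund_kernel \<theta>1 \<theta>2 C (off_planes K)" and T: "truncated_integrals_converge K"
    and s: "\<And>k. s k \<in> trunc_box k" and f: "square_integrable lborel f"
  obtains g where "square_integrable lborel g"
    "(\<lambda>k. energy lborel (\<lambda>x. conv (truncate (fst (s k)) (snd (s k)) K) f x - g x)) \<longlonglongrightarrow> 0"
    "energy lborel g \<le> (multiplier_constant \<theta>1 \<theta>2 C)\<^sup>2 * energy lborel f"
proof -
  interpret zygmund_kernel \<theta>1 \<theta>2 C "off_planes K" by (rule Z)
  define e1 where "e1 k = fst (fst (s k))" for k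
  define e2 where "e2 k = fst (snd (fst (s k)))" for k
  define e3 where "e3 k = snd (snd (fst (s k)))" for k
  define n1 where "n1 k = fst (snd (s k))" for k
  define n2 where "n2 k = fst (snd (snd (s k)))" for k
  define n3 where "n3 k = snd (snd (snd (s k)))" for k
  note defs = e1_def e2_def e3_def n1_def n2_def n3_def
  have sk: "s k = ((e1 k, e2 k, e3 k), (n1 k, n2 k, n3 k))" for k by (simp add: defs)
  have box: "((e1 k, e2 k, e3 k), (n1 k, n2 k, n3 k)) \<in> trunc_box k" for k using s[of k] sk[of k] by simp
  note S = trunc_box_sequence[OF box]
  have lim_s: "filterlim s trunc_limit sequentially"
    by (rule filter_basis_sequence[OF filter_basis_trunc_limit s])
  have Tk: "truncate (fst (s k)) (snd (s k)) K = truncate (e1 k, e2 k, e3 k) (n1 k, n2 k, n3 k) (off_planes K)" for k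
    unfolding sk fst_conv snd_conv by (rule truncate_off_planes[symmetric]) (rule S)+
  have conv_seq: "convergent (\<lambda>k. \<Phi> (s k))" if "\<exists>l. (\<Phi> \<longlongrightarrow> l) trunc_limit" for \<Phi> :: "R3 \<times> R3 \<Rightarrow> complex"
    using that filterlim_compose[OF _ lim_s] by (blast intro: convergentI)
  have T0: "\<exists>l. ((\<lambda>(\<epsilon>, N). LINT x:{-1..1} \<times> {-1..1} \<times> {-1..1}|lborel. truncate \<epsilon> N K x) \<longlongrightarrow> l) trunc_limit"
    and T1: "AE x1 in lborel. \<exists>l. ((\<lambda>(\<epsilon>, N). LINT (x2, x3):{-1..1} \<times> {-1..1}|lborel. truncate \<epsilon> N K (x1, x2, x3)) \<longlongrightarrow> l) trunc_limit"
    and T2: "AE x2 in lborel. \<exists>l. ((\<lambda>(\<epsilon>, N). LINT (x1, x3):{-1..1} \<times> {-1..1}|lborel. truncate \<epsilon> N K (x1, x2, x3)) \<longlongrightarrow> l) trunc_limit"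
    using T unfolding truncated_integrals_converge_def by blast+
  have c0: "convergent (\<lambda>k. LINT x:annulus (e1 k) (min (n1 k) 1) \<times> annulus (e2 k) (min (n2 k) 1) \<times> annulus (e3 k) (min (n3 k) 1)|lborel. off_planes K x)"
    using conv_seq[OF T0] unfolding sk split_conv truncated_unit_box(1)[OF S(1,5,9)] .
  have c1: "AE x1 in lborel. convergent (\<lambda>k. LINT (x2, x3):annulus (e2 k) (min (n2 k) 1) \<times> annulus (e3 k) (min (n3 k) 1)|lborel. off_planes K (x1, x2, x3))"
    using T1 AE_lborel_singleton[of 0]
  proof eventually_elim
    fix x1 :: real
    assume l: "\<exists>l. ((\<lambda>(\<epsilon>, N). LINT (x2, x3):{-1..1} \<times> {-1..1}|lborel. truncate \<epsilon> N K (x1, x2, x3)) \<longlongrightarrow> l) trunc_limit"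
      and "x1 \<noteq> 0"
    have "\<forall>\<^sub>F k in sequentially. (LINT (x2, x3):annulus (e2 k) (min (n2 k) 1) \<times> annulus (e3 k) (min (n3 k) 1)|lborel. off_planes K (x1, x2, x3))
        = (case s k of (\<epsilon>, N) \<Rightarrow> LINT (x2, x3):{-1..1} \<times> {-1..1}|lborel. truncate \<epsilon> N K (x1, x2, x3))"
      using annulus_exhausts[OF S(1-3), of x1]
      by eventually_elim (use \<open>x1 \<noteq> 0\<close> in \<open>simp add: sk truncated_unit_box(2)[OF S(1,5,9)]\<close>)
    from convergent_cong[OF this] conv_seq[OF l]
    show "convergent (\<lambda>k. LINT (x2, x3):annulus (e2 k) (min (n2 k) 1) \<times> annulus (e3 k) (min (n3 k) 1)|lborel. off_planes K (x1, x2, x3))"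
      by simp
  qed
  have c2: "AE x2 in lborel. convergent (\<lambda>k. LINT (x1, x3):annulus (e1 k) (min (n1 k) 1) \<times> annulus (e3 k) (min (n3 k) 1)|lborel. off_planes K (x1, x2, x3))"
    using T2 AE_lborel_singleton[of 0]
  proof eventually_elim
    fix x2 :: real
    assume l: "\<exists>l. ((\<lambda>(\<epsilon>, N). LINT (x1, x3):{-1..1} \<times> {-1..1}|lborel. truncate \<epsilon> N K (x1, x2, x3)) \<longlongrightarrow> l) trunc_limit"
      and "x2 \<noteq> 0"
    have "\<forall>\<^sub>F k in sequentially. (LINT (x1, x3):annulus (e1 k) (min (n1 k) 1) \<times> annulus (e3 k) (min (n3 k) 1)|lborel. off_planes K (x1, x2, x3))
        = (case s k of (\<epsilon>, N) \<Rightarrow> LINT (x1, x3):{-1..1} \<times> {-1..1}|lborel. truncate \<epsilon> N K (x1, x2, x3))"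
      using annulus_exhausts[OF S(5-7), of x2]
      by eventually_elim (use \<open>x2 \<noteq> 0\<close> in \<open>simp add: sk truncated_unit_box(3)[OF S(1,5,9)]\<close>)
    from convergent_cong[OF this] conv_seq[OF l]
    show "convergent (\<lambda>k. LINT (x1, x3):annulus (e1 k) (min (n1 k) 1) \<times> annulus (e3 k) (min (n3 k) 1)|lborel. off_planes K (x1, x2, x3))"
      by simp
  qed
  have nice: "nice_kernel (truncate (e1 k, e2 k, e3 k) (n1 k, n2 k, n3 k) (off_planes K))" for k
    by (intro truncate_nice S)
  note bnd = multiplier_bound_AE[OF S(1,5,9) S(4,8,12)]
  have lim: "AE \<xi> in lborel. convergent (\<lambda>k. fourier (truncate (e1 k, e2 k, e3 k) (n1 k, n2 k, n3 k) (off_planes K)) \<xi>)"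
    using AE_R3_coordinates_neq[of 0]
  proof eventually_elim
    fix \<xi> :: R3 assume nz: "fst \<xi> \<noteq> 0 \<and> fst (snd \<xi>) \<noteq> 0 \<and> snd (snd \<xi>) \<noteq> 0"
    show "convergent (\<lambda>k. fourier (truncate (e1 k, e2 k, e3 k) (n1 k, n2 k, n3 k) (off_planes K)) \<xi>)"
      using multiplier_convergent[OF S c0 c1 c2, of "fst \<xi>" "fst (snd \<xi>)" "snd (snd \<xi>)"] nz by simp
  qed
  show thesis
    by (rule convolution_sequence_converges[OF nice bnd lim f]) (rule that, simp_all add: Tk)
qed

lemma energy_limit_unique:
  assumes u: "\<And>k. square_integrable M (u k)" and g: "square_integrable M g" "square_integrable M g'"
    and l: "(\<lambda>k. energy M (\<lambda>x. u k x - g x)) \<longlonglongrightarrow> 0" "(\<lambda>k. energy M (\<lambda>x. u k x - g' x)) \<longlonglongrightarrow> 0"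
  shows "energy M (\<lambda>x. g x - g' x) = 0"
proof -
  have "energy M (\<lambda>x. g x - g' x) \<le> 2 * energy M (\<lambda>x. u k x - g x) + 2 * energy M (\<lambda>x. u k x - g' x)" for k
    using energy_diff_triangle[OF g(1) u[of k] g(2)] by (simp add: energy_minus[of M g])
  moreover have "(\<lambda>k. 2 * energy M (\<lambda>x. u k x - g x) + 2 * energy M (\<lambda>x. u k x - g' x)) \<longlonglongrightarrow> 2 * 0 + 2 * 0"
    by (intro tendsto_intros l)
  ultimately have "energy M (\<lambda>x. g x - g' x) \<le> 2 * 0 + 2 * 0" by (intro LIMSEQ_le_const) auto
  thus ?thesis using energy_nonneg[of M "\<lambda>x. g x - g' x"] by linarith
qed

lemma in_L2_iff: "in_L2 f \<longleftrightarrow> square_integrable lborel f"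
  by (simp add: in_L2_def square_integrable_def)

lemma L2_norm_eq: "L2_norm f = sqrt (energy lborel f)"
  by (simp add: L2_norm_def energy_def)

lemma convolution_eq_conv: "convolution k f = conv k f"
  by (simp add: Defs.convolution_def fun_eq_iff)

theorem corollary1p2:
  fixes \<theta>1 \<theta>2 C :: real
  assumes "0 < \<theta>1" and "\<theta>1 \<le> 1" and "0 < \<theta>2" and "\<theta>2 < 1"
  shows "\<exists>A::real. \<forall>K :: real \<times> real \<times> real \<Rightarrow> complex.
    regularity \<theta>1 \<theta>2 C K \<and> cancellation_a C K \<and> cancellation_b \<theta>1 C K \<and>
    cancellation_c \<theta>1 C K \<and> cancellation_d \<theta>1 C K \<and> truncated_integrals_converge K \<longrightarrow>
    (\<forall>f. in_L2 f \<longrightarrow>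
      (\<exists>g. tendsto_L2 (\<lambda>(\<epsilon>, N). convolution (truncate \<epsilon> N K) f) g trunc_limit \<and>
           L2_norm g \<le> A * L2_norm f))"
proof (intro exI[of _ "\<bar>multiplier_constant \<theta>1 \<theta>2 C\<bar>"] allI impI)
  fix K :: "R3 \<Rightarrow> complex" and f :: "R3 \<Rightarrow> complex"
  assume H: "regularity \<theta>1 \<theta>2 C K \<and> cancellation_a C K \<and> cancellation_b \<theta>1 C K \<and>
    cancellation_c \<theta>1 C K \<and> cancellation_d \<theta>1 C K \<and> truncated_integrals_converge K"
    and "in_L2 f"
  hence f: "square_integrable lborel f" by (simp add: in_L2_iff)
  define M where "M = multiplier_constant \<theta>1 \<theta>2 C"
  have Z: "zygmund_kernel \<theta>1 \<theta>2 C (off_planes K)"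
    using H assms by (intro zygmund_kernel_off_planes) auto
  have T: "truncated_integrals_converge K" using H by blast
  interpret zygmund_kernel \<theta>1 \<theta>2 C "off_planes K" by (rule Z)
  define u where "u z = conv (truncate (fst z) (snd z) K) f" for z :: "R3 \<times> R3"
  have u: "square_integrable lborel (u z)" if z: "z \<in> trunc_box m" for z m
  proof -
    obtain e1 e2 e3 n1 n2 n3 where zz: "z = ((e1, e2, e3), (n1, n2, n3))" by (metis prod.collapse)
    have e: "0 < e1" "0 < e2" "0 < e3" and n: "0 < n1" "0 < n2" "0 < n3"
      using z by (auto simp: zz trunc_box_def intro: le_less_trans[of 0 "real m"])
    show ?thesis
      using conv_energy_bounded(1)[OF truncate_nice[OF e] f multiplier_bound_AE[OF e n]]
      by (simp add: u_def zz truncate_off_planes[OF e])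
  qed
  have seq: "\<exists>g. square_integrable lborel g \<and> (\<lambda>k. energy lborel (\<lambda>x. u (s k) x - g x)) \<longlonglongrightarrow> 0
      \<and> energy lborel g \<le> M\<^sup>2 * energy lborel f" if "\<And>k. s k \<in> trunc_box k" for s
    by (rule trunc_convolution_sequence[OF Z T that f]) (auto simp: u_def M_def)
  \<comment> \<open>One fixed sequence of truncations defines the limit.\<close>
  define s0 where "s0 k = (let e = 1 / (2 * real (Suc k)); n = real (Suc k) in ((e, e, e), (n, n, n)))" for k
  have s0: "s0 k \<in> trunc_box k" for k by (simp add: s0_def trunc_box_def Let_def field_simps)
  obtain g where g: "square_integrable lborel g" "(\<lambda>k. energy lborel (\<lambda>x. u (s0 k) x - g x)) \<longlonglongrightarrow> 0"
    and gM: "energy lborel g \<le> M\<^sup>2 * energy lborel f" using seq[OF s0] by blast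
  have "((\<lambda>z. energy lborel (\<lambda>x. u z x - g x)) \<longlongrightarrow> 0) trunc_limit"
  proof (rule filter_basis_tendsto[OF filter_basis_trunc_limit])
    fix s :: "nat \<Rightarrow> R3 \<times> R3" assume s: "\<And>k. s k \<in> trunc_box k"
    \<comment> \<open>The interleaved sequence converges too, so its limit agrees with both limits.\<close>
    define t where "t k = (if even k then s0 k else s k)" for k
    have t: "t k \<in> trunc_box k" for k using s s0 by (simp add: t_def)
    obtain g' where g': "square_integrable lborel g'" "(\<lambda>k. energy lborel (\<lambda>x. u (t k) x - g' x)) \<longlonglongrightarrow> 0"
      using seq[OF t] by blast
    have ev: "strict_mono (\<lambda>k::nat. 2 * k)" and od: "strict_mono (\<lambda>k::nat. 2 * k + 1)"
      by (auto simp: strict_mono_def)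
    have "(\<lambda>k. energy lborel (\<lambda>x. u (s0 (2 * k)) x - g' x)) \<longlonglongrightarrow> 0"
      using LIMSEQ_subseq_LIMSEQ[OF g'(2) ev] by (simp add: comp_def t_def)
    moreover have "(\<lambda>k. energy lborel (\<lambda>x. u (s0 (2 * k)) x - g x)) \<longlonglongrightarrow> 0"
      using LIMSEQ_subseq_LIMSEQ[OF g(2) ev] by (simp add: comp_def)
    ultimately have gg: "energy lborel (\<lambda>x. g' x - g x) = 0"
      by (intro energy_limit_unique[OF _ g'(1) g(1), of "\<lambda>k. u (s0 (2 * k))"]) (auto intro: u[OF s0])
    have "(\<lambda>k. energy lborel (\<lambda>x. u (s (2 * k + 1)) x - g' x)) \<longlonglongrightarrow> 0"
      using LIMSEQ_subseq_LIMSEQ[OF g'(2) od] by (simp add: comp_def t_def)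
    from tendsto_mult_right_zero[OF this, of 2]
    have two: "(\<lambda>k. 2 * energy lborel (\<lambda>x. u (s (2 * k + 1)) x - g' x)) \<longlonglongrightarrow> 0" .
    have "(\<lambda>k. energy lborel (\<lambda>x. u (s (2 * k + 1)) x - g x)) \<longlonglongrightarrow> 0"
    proof (rule tendsto_sandwich[OF _ _ tendsto_const two])
      show "\<forall>\<^sub>F k in sequentially. energy lborel (\<lambda>x. u (s (2 * k + 1)) x - g x) \<le> 2 * energy lborel (\<lambda>x. u (s (2 * k + 1)) x - g' x)"
        using energy_diff_triangle[OF u[OF s] g'(1) g(1)] gg by simp
    qed simp
    thus "\<exists>r. strict_mono r \<and> (\<lambda>k. energy lborel (\<lambda>x. u (s (r k)) x - g x)) \<longlonglongrightarrow> 0"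
      using od by blast
  qed
  hence "((\<lambda>z. sqrt (energy lborel (\<lambda>x. u z x - g x))) \<longlongrightarrow> sqrt 0) trunc_limit" by (rule tendsto_real_sqrt)
  moreover have "\<forall>\<^sub>F z in trunc_limit. square_integrable lborel (u z)"
    unfolding filter_basis_eventually[OF filter_basis_trunc_limit] using u by blast
  moreover have "(\<lambda>(\<epsilon>, N). convolution (truncate \<epsilon> N K) f) = u"
    by (auto simp: fun_eq_iff u_def convolution_eq_conv)
  ultimately have "tendsto_L2 (\<lambda>(\<epsilon>, N). convolution (truncate \<epsilon> N K) f) g trunc_limit"
    using g(1) by (simp add: tendsto_L2_def in_L2_iff L2_norm_eq)
  moreover have "L2_norm g \<le> \<bar>M\<bar> * L2_norm f"
    using real_sqrt_le_mono[OF gM] by (simp add: L2_norm_eq real_sqrt_mult)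
  ultimately show "\<exists>g. tendsto_L2 (\<lambda>(\<epsilon>, N). convolution (truncate \<epsilon> N K) f) g trunc_limit \<and>
           L2_norm g \<le> \<bar>multiplier_constant \<theta>1 \<theta>2 C\<bar> * L2_norm f"
    unfolding M_def by blast
qed

end
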